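(* Let $0<\alpha<2$, $n>\alpha$ and $\tau=\frac{n+\alpha}{n-\alpha}$. Suppose that $f:(0,+\infty)\to[0,+\infty)$ is locally bounded and that $\frac{f(t)}{t^\tau}$ is monotonically decreasing in $(0,+\infty)$. Let $u\in\mathcal{L}_\alpha\cap C^{1,1}_{loc}(\mathbb{R}^n)$ be a positive solution to $$(-\Delta)^{\alpha/2}u(x)=f(u(x)),\qquad x\in\mathbb{R}^n.$$ Then either $u\equiv C_0$ for some constant $C_0>0$ satisfying $f(C_0)=0$, or there exists $C>0$ such that $f(t)=Ct^\tau$ for every $t\in\left(0,\max_{x\in\mathbb{R}^n}u(x)\right]$ and $$u(x)=\frac{\beta_1}{\left(|x-x_0|^2+\beta_2^2\right)^{\frac{n-\alpha}{2}}}\qquad\text{for all }x\in\mathbb{R}^n,$$ for some $\beta_1,\beta_2>0$ and $x_0\in\mathbb{R}^n$.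
   Context: The fractional Laplacian is $(-\Delta)^{\alpha/2}u(x)=C_{n,\alpha}\,\mathrm{P.V.}\int_{\mathbb{R}^n}\frac{u(x)-u(z)}{|x-z|^{n+\alpha}}\,dz$, where $\mathrm{P.V.}$ is the Cauchy principal value and $C_{n,\alpha}>0$ is a normalization constant. The space $\mathcal{L}_\alpha$ is the set of $u:\mathbb{R}^n\to\mathbb{R}$ with $\int_{\mathbb{R}^n}\frac{|u(x)|}{1+|x|^{n+\alpha}}\,dx<\infty$. "Monotonically decreasing" is meant in the weak sense (non-increasing). "Locally bounded" means bounded on compact subsets of $(0,+\infty)$. The equation holds pointwise. *)

theory Defs
  imports "HOL-Analysis.Analysis"
begin

text \<open>Cauchy principal value at \<open>x\<close>: truncated Lebesgue integrals over \<open>|z - x| > \<epsilon>\<close>, which have to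
  exist for every \<open>\<epsilon> > 0\<close>, converge as \<open>\<epsilon> \<rightarrow> 0+\<close>.\<close>

definition has_pv_integral ::
    "(real^'n::finite \<Rightarrow> real) \<Rightarrow> real \<Rightarrow> real^'n \<Rightarrow> bool" where
  "has_pv_integral g I x \<longleftrightarrow>
     (\<forall>\<epsilon>>0. set_integrable lebesgue (- cball x \<epsilon>) g) \<and>
     ((\<lambda>\<epsilon>. LINT z:(- cball x \<epsilon>)|lebesgue. g z) \<longlongrightarrow> I) (at_right 0)"

text \<open>\<open>has_frac_laplacian c \<alpha> u x v\<close>: the principal value defining \<open>(-\<Delta>)\<^bsup>\<alpha>/2\<^esup> u\<close> at \<open>x\<close> exists and
  \<open>(-\<Delta>)\<^bsup>\<alpha>/2\<^esup> u (x) = v\<close>, where the normalization constant \<open>C\<^sub>n\<^sub>,\<^sub>\<alpha>\<close> is the parameter \<open>c\<close>.\<close>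

definition has_frac_laplacian ::
    "real \<Rightarrow> real \<Rightarrow> (real^'n::finite \<Rightarrow> real) \<Rightarrow> real^'n \<Rightarrow> real \<Rightarrow> bool" where
  "has_frac_laplacian c \<alpha> u x v \<longleftrightarrow>
     (\<exists>I. has_pv_integral
            (\<lambda>z. (u x - u z) / norm (x - z) powr (real CARD('n) + \<alpha>)) I x \<and>
          v = c * I)"

definition L_space :: "real \<Rightarrow> (real^'n::finite \<Rightarrow> real) set" where
  "L_space \<alpha> = {u. u \<in> borel_measurable lebesgue \<and>
     integrable lebesgue (\<lambda>x. \<bar>u x\<bar> / (1 + norm x powr (real CARD('n) + \<alpha>)))}"

text \<open>\<open>C\<^bsup>1,1\<^esup>\<^sub>l\<^sub>o\<^sub>c\<close>: differentiable, with gradient Lipschitz on every compact set.\<close>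

definition C11_loc :: "(real^'n::finite \<Rightarrow> real) set" where
  "C11_loc = {u. \<exists>g. (\<forall>x. GDERIV u x :> g x) \<and>
     (\<forall>K. compact K \<longrightarrow> (\<exists>L. L-lipschitz_on K g))}"

definition locally_bounded_pos :: "(real \<Rightarrow> real) \<Rightarrow> bool" where
  "locally_bounded_pos f \<longleftrightarrow> (\<forall>K. compact K \<and> K \<subseteq> {0<..} \<longrightarrow> bounded (f ` K))"

end

theory Submission
  imports Defs
begin

text \<open>Method of moving spheres. For a centre \<open>a\<close> and a radius \<open>r\<close> let \<open>w a r\<close> be the Kelvin transform of
  \<open>u (a + _)\<close> in the sphere of radius \<open>r\<close> minus \<open>u (a + _)\<close>. The equation is invariant under Kelvin transforms
  up to the nonlinearity, because \<open>|z|\<^sup>\<alpha>\<^sup>-\<^sup>n\<close> is \<open>\<alpha>\<close>-harmonic away from the origin. Since \<open>w a r\<close> is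
  antisymmetric under the inversion, its fractional Laplacian at a negative minimum in the ball is
  negative, with a bound that blows up at the sphere, while monotonicity of \<open>f t / t\<^sup>\<tau>\<close> bounds it from below
  by a multiple of the minimum. Hence \<open>w a r \<ge> 0\<close> in the ball for small \<open>r\<close>, and this persists for slightly
  larger \<open>r\<close> unless \<open>w a r\<close> vanishes identically. If \<open>w a r \<ge> 0\<close> for all \<open>a\<close> and \<open>r\<close>, then \<open>u\<close> is constant.
  Otherwise \<open>|x|\<^sup>n\<^sup>-\<^sup>\<alpha> u x\<close> has a limit at infinity, every centre has a radius with \<open>w a r = 0\<close>, and the
  behaviour of \<open>u\<close> at infinity forces the square of this radius to be \<open>|a - b|\<^sup>2 + k\<close>; as it is a
  multiple of a power of \<open>u a\<close>, this determines \<open>u\<close>.\<close>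

section \<open>Inversions\<close>

text \<open>Two obstacles shape the argument. The principal value converges only conditionally, and
  an inversion does not carry a ball about \<open>x\<close> to a ball about its image. The
  transformation rule is therefore proved for truncated integrals, with an error over annuli of
  relative width of order \<epsilon>; for differentiable \<open>u\<close> this error is of order
  \<epsilon>^(2-\<alpha>). Moreover no pointwise decay of \<open>u\<close> at infinity is known
  beforehand, so \<open>w a r\<close> is not controlled near the centre: a minimum need not be
  attained, and \<open>w a s\<close> need not be close to \<open>w a r\<close> there by compactness.
  A multiple of the Kelvin factor minus 1, and an exact rescaling identity between two radii, deal
  with this. The exponents fit because the Jacobian (r/|z|)^(2n) and the kernel factor
  (r/|z|)^(-n-\<alpha>) leave (r/|z|)^(n-\<alpha>), whose \<tau>-th power is (r/|z|)^(n+\<alpha>);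
  hence f t / t^\<tau> is what an invariant sphere preserves.\<close>

definition inversion :: "real \<Rightarrow> 'a::real_inner \<Rightarrow> 'a" where
  "inversion r z = (r\<^sup>2 / (norm z)\<^sup>2) *\<^sub>R z"

lemma inversion_0 [simp]: "inversion r 0 = 0"
  by (simp add: inversion_def)

lemma inversion_eq_0_iff [simp]: "r \<noteq> 0 \<Longrightarrow> inversion r z = 0 \<longleftrightarrow> z = 0"
  by (simp add: inversion_def)

lemma norm_inversion: "norm (inversion r z) = r\<^sup>2 / norm z"
  by (simp add: inversion_def power2_eq_square)

text \<open>The centre is sent to itself by the convention for division by zero, so the map is an
  involution of the whole space, and images can be rewritten as preimages with no exceptional
  point.\<close>

lemma inversion_inversion [simp]: "r \<noteq> 0 \<Longrightarrow> inversion r (inversion r z) = z"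
  by (cases "z = 0") (auto simp: inversion_def power2_eq_square)

text \<open>The distortion factor is a product of a factor in \<open>x\<close> and a factor in
  \<open>z\<close>. For this reason a power of the distance changes under the inversion only by
  factors that can be absorbed into the function.\<close>

lemma norm_inversion_diff:
  assumes "x \<noteq> 0" "z \<noteq> 0"
  shows "norm (inversion r x - inversion r z) = r\<^sup>2 * norm (x - z) / (norm x * norm z)"
proof -
  have "(norm (inversion r x - inversion r z))\<^sup>2 = (r\<^sup>2 * norm (x - z) / (norm x * norm z))\<^sup>2"
    using assms unfolding power_mult_distrib power_divide
    by (simp add: inversion_def power2_norm_eq_inner inner_diff field_simps)
  thus ?thesis by (simp add: power2_eq_iff_nonneg)
qed

lemma norm_diff_inversion:
  assumes "x \<noteq> 0" "z \<noteq> 0" "r \<noteq> 0"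
  shows "norm (inversion r x - z) = norm z * norm (x - inversion r z) / norm x"
proof -
  have "norm (inversion r x - inversion r (inversion r z)) =
      r\<^sup>2 * norm (x - inversion r z) / (norm x * norm (inversion r z))"
    by (rule norm_inversion_diff) (use assms in auto)
  thus ?thesis using assms by (simp add: norm_inversion)
qed

lemma continuous_on_inversion: "0 \<notin> S \<Longrightarrow> continuous_on S (inversion r)"
  unfolding inversion_def by (intro continuous_intros) auto

lemma borel_measurable_inversion [measurable]:
  "inversion r \<in> borel_measurable (borel :: 'a::euclidean_space measure)"
  unfolding inversion_def by measurable

lemma inversion_vimage_borel:
  fixes A :: "'a::euclidean_space set"
  shows "A \<in> sets borel \<Longrightarrow> inversion r -` A \<in> sets borel"
  using measurable_sets[OF borel_measurable_inversion, of A r] by simp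

section \<open>Jacobian of the inversion and change of variables\<close>

lemma has_derivative_inversion:
  assumes "z \<noteq> 0"
  shows "(inversion r has_derivative
     (\<lambda>h. (r\<^sup>2 / (norm z)\<^sup>2) *\<^sub>R (h - (2 * (z \<bullet> h) / (z \<bullet> z)) *\<^sub>R z))) (at z within S)"
proof -
  have "((\<lambda>z. (r\<^sup>2 / (z \<bullet> z)) *\<^sub>R z) has_derivative
     (\<lambda>h. (r\<^sup>2 / (z \<bullet> z)) *\<^sub>R (h - (2 * (z \<bullet> h) / (z \<bullet> z)) *\<^sub>R z))) (at z within S)"
    using assms
    by (auto intro!: derivative_eq_intros simp: fun_eq_iff inner_commute scaleR_diff_right field_simps)
  thus ?thesis unfolding inversion_def power2_norm_eq_inner .
qed

lemma orthogonal_transformation_reflection: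
  fixes z :: "'a::euclidean_space"
  assumes "z \<noteq> 0"
  shows "orthogonal_transformation (\<lambda>h. h - (2 * (z \<bullet> h) / (z \<bullet> z)) *\<^sub>R z)"
  unfolding orthogonal_transformation_def
proof (intro conjI allI)
  show "linear (\<lambda>h. h - (2 * (z \<bullet> h) / (z \<bullet> z)) *\<^sub>R z)"
    by (rule linearI) (simp_all add: inner_add algebra_simps add_divide_distrib)
  show "(v - (2 * (z \<bullet> v) / (z \<bullet> z)) *\<^sub>R z) \<bullet> (w - (2 * (z \<bullet> w) / (z \<bullet> z)) *\<^sub>R z) = v \<bullet> w" for v w
    using assms by (simp add: inner_diff inner_commute field_simps)
qed

text \<open>The derivative is the reflection in the hyperplane orthogonal to \<open>z\<close>,
  scaled by r^2/|z|^2; in absolute value only the scaling contributes to the determinant.\<close>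

lemma abs_det_inversion:
  fixes z :: "real^'n::finite"
  assumes "z \<noteq> 0"
  shows "\<bar>det (matrix (\<lambda>h. (r\<^sup>2 / (norm z)\<^sup>2) *\<^sub>R (h - (2 * (z \<bullet> h) / (z \<bullet> z)) *\<^sub>R z)))\<bar> =
    (r\<^sup>2 / (norm z)\<^sup>2) ^ CARD('n)"
proof -
  let ?Q = "\<lambda>h. h - (2 * (z \<bullet> h) / (z \<bullet> z)) *\<^sub>R z"
  have o: "orthogonal_transformation ?Q" by (rule orthogonal_transformation_reflection[OF assms])
  have "matrix (\<lambda>h. (r\<^sup>2 / (norm z)\<^sup>2) *\<^sub>R ?Q h) = matrix ((*\<^sub>R) (r\<^sup>2 / (norm z)\<^sup>2) \<circ> ?Q)"
    by (simp add: o_def)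
  also have "\<dots> = matrix ((*\<^sub>R) (r\<^sup>2 / (norm z)\<^sup>2)) ** matrix ?Q"
    by (intro matrix_compose orthogonal_transformation_linear[OF o] bounded_linear.linear[OF bounded_linear_scaleR_right])
  finally show ?thesis
    using o by (simp add: det_mul abs_mult power_abs)
qed

text \<open>The change of variables theorem of the library wants a well-ordered index type, so every
  finite index type is given a well-ordered copy.\<close>

typedef 'a wo = "UNIV :: 'a set" ..

instance wo :: (finite) finite
proof
  have "UNIV = Abs_wo ` (UNIV :: 'a set)"
    by (metis Abs_wo_cases surj_def)
  thus "finite (UNIV :: 'a wo set)" by (metis finite finite_imageI)
qed

lemma ex_inj_nat: "\<exists>f :: 'a::finite \<Rightarrow> nat. inj f"
  using finite_imp_inj_to_nat_seg[of "UNIV :: 'a set"] by auto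

instantiation wo :: (finite) wellorder
begin

definition less_eq_wo :: "'a wo \<Rightarrow> 'a wo \<Rightarrow> bool" where
  "less_eq_wo x y \<longleftrightarrow> (SOME f :: 'a \<Rightarrow> nat. inj f) (Rep_wo x) \<le> (SOME f. inj f) (Rep_wo y)"

definition less_wo :: "'a wo \<Rightarrow> 'a wo \<Rightarrow> bool" where
  "less_wo x y \<longleftrightarrow> (SOME f :: 'a \<Rightarrow> nat. inj f) (Rep_wo x) < (SOME f. inj f) (Rep_wo y)"

instance
proof
  fix x y z :: "'a wo" and P :: "'a wo \<Rightarrow> bool"
  let ?f = "SOME f :: 'a \<Rightarrow> nat. inj f"
  have "inj ?f" by (rule someI_ex[OF ex_inj_nat])
  show "x < y \<longleftrightarrow> x \<le> y \<and> \<not> y \<le> x" "x \<le> x" "x \<le> y \<Longrightarrow> y \<le> z \<Longrightarrow> x \<le> z" "x \<le> y \<or> y \<le> x"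
    unfolding less_eq_wo_def less_wo_def by auto
  show "x \<le> y \<Longrightarrow> y \<le> x \<Longrightarrow> x = y"
    using \<open>inj ?f\<close> unfolding less_eq_wo_def by (metis Rep_wo_inject antisym injD)
  show "P x" if "\<And>x. (\<And>y. y < x \<Longrightarrow> P y) \<Longrightarrow> P x"
    by (induction "?f (Rep_wo x)" arbitrary: x rule: less_induct) (metis that less_wo_def)
qed

end

text \<open>It suffices to compare the measures on boxes. On a box without the centre the
  differentiable change of variables applies, because the inversion maps \<open>S\<close>
  injectively onto it, and the removed point is a null set.\<close>

lemma distr_inversion_wellorder:
  assumes "r > 0"
  shows "distr (density lborel (\<lambda>z. ennreal ((r\<^sup>2 / (norm z)\<^sup>2) ^ CARD('n)))) borel
      (inversion r) = (lborel :: (real^'n::{finite,wellorder}) measure)"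
proof (rule lborel_eqI[symmetric])
  fix l u :: "real^'n::_" assume lu: "\<And>b. b \<in> Basis \<Longrightarrow> l \<bullet> b \<le> u \<bullet> b"
  let ?J = "\<lambda>z::real^'n::_. (r\<^sup>2 / (norm z)\<^sup>2) ^ CARD('n)"
  let ?B = "box l u - {0}"
  have meas: "(\<lambda>z. ennreal (?J z)) \<in> borel_measurable borel" by measurable
  define S where "S = inversion r ` ?B"
  have S_eq: "S = inversion r -` ?B"
    unfolding S_def using assms by (force simp: image_iff)
  have Sb: "S \<in> sets borel"
    unfolding S_eq by (rule inversion_vimage_borel) simp
  have im: "inversion r ` S = ?B"
    unfolding S_def using assms by (force simp: image_iff)
  have "inversion r ` S \<in> lmeasurable \<and> measure lebesgue (inversion r ` S) = measure lebesgue ?B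
     \<longleftrightarrow> ((\<lambda>z. \<bar>det (matrix (\<lambda>h. (r\<^sup>2 / (norm z)\<^sup>2) *\<^sub>R (h - (2 * (z \<bullet> h) / (z \<bullet> z)) *\<^sub>R z)))\<bar>)
       has_integral measure lebesgue ?B) S"
  proof (intro has_measure_differentiable_image has_derivative_inversion)
    show "S \<in> sets lebesgue" using Sb by auto
    show "z \<noteq> 0" if "z \<in> S" for z using that assms by (auto simp: S_def)
    show "inj_on (inversion r) S"
      by (rule inj_on_inverseI[of _ "inversion r"]) (use assms in simp)
  qed
  moreover have "?B \<in> lmeasurable" by (intro fmeasurable.Diff) (auto simp: negligible_imp_measurable)
  ultimately have "((\<lambda>z. \<bar>det (matrix (\<lambda>h. (r\<^sup>2 / (norm z)\<^sup>2) *\<^sub>R (h - (2 * (z \<bullet> h) / (z \<bullet> z)) *\<^sub>R z)))\<bar>)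
       has_integral measure lebesgue ?B) S"
    unfolding im by blast
  hence "(?J has_integral measure lebesgue ?B) S"
    by (rule has_integral_eq[rotated]) (rule abs_det_inversion, use assms in \<open>auto simp: S_def\<close>)
  hence "(\<integral>\<^sup>+z. indicator S z * ?J z \<partial>lborel) = measure lebesgue ?B"
  proof (intro nn_integral_has_integral_lborel)
    note Sb [measurable]
    show "(\<lambda>z. indicator S z * ?J z) \<in> borel_measurable borel" by measurable
    have "(\<lambda>z. if z \<in> S then ?J z else 0) = (\<lambda>z. indicator S z * ?J z)" by auto
    thus "(?J has_integral measure lebesgue ?B) S \<Longrightarrow>
        ((\<lambda>z. indicator S z * ?J z) has_integral measure lebesgue ?B) UNIV"
      using has_integral_restrict_UNIV[of S ?J "measure lebesgue ?B"] by simp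
  qed auto
  moreover have "emeasure (distr (density lborel (\<lambda>z. ennreal (?J z))) borel (inversion r)) (box l u)
      = (\<integral>\<^sup>+z. ennreal (?J z) * indicator (inversion r -` box l u) z \<partial>lborel)"
    by (subst emeasure_distr) (auto simp: emeasure_density inversion_vimage_borel)
  \<comment> \<open>The preimage of the box may contain the centre while \<open>S\<close> does not;
    there the density is 0 by the convention for division, so the integrands agree
    everywhere.\<close>
  moreover have "\<dots> = (\<integral>\<^sup>+z. indicator S z * ?J z \<partial>lborel)"
    by (intro nn_integral_cong) (auto simp: S_eq indicator_def)
  moreover have "measure lebesgue ?B = measure lebesgue (box l u)"
    by (rule measure_Diff_null_set) auto
  ultimately show "emeasure (distr (density lborel (\<lambda>z. ennreal (?J z))) borel (inversion r)) (box l u)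
    = (\<Prod>b\<in>Basis. (u - l) \<bullet> b)"
    using lu by simp
qed simp

lemma prod_Basis_cart: "(\<Prod>b\<in>Basis. f b) = (\<Prod>i\<in>UNIV. f (axis i (1::real)))"
  by (simp add: Basis_vec_def axis_eq_axis inj_on_def prod.reindex UNION_singleton_eq_range)

text \<open>On a box both measures give the product of the side lengths, only with the factors in
  another order.\<close>

lemma distr_reindex_lborel:
  fixes p :: "'m::finite \<Rightarrow> 'n::finite"
  assumes "bij p"
  shows "distr lborel borel (\<lambda>z. \<chi> i. z $ p i) = (lborel :: (real^'m) measure)"
proof (rule lborel_eqI[symmetric])
  fix l u :: "real^'m" assume lu: "\<And>b. b \<in> Basis \<Longrightarrow> l \<bullet> b \<le> u \<bullet> b"
  let ?T = "\<lambda>z::real^'n. (\<chi> i. z $ p i) :: real^'m"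
  let ?q = "\<lambda>z::real^'m. (\<chi> j. z $ inv p j) :: real^'n"
  have T: "?T \<in> borel_measurable borel"
    by (intro borel_measurable_continuous_onI continuous_intros)
  have le: "l $ i \<le> u $ i" for i using lu[of "axis i 1"] by (auto simp: inner_axis)
  have prod_eq: "(\<Prod>b\<in>Basis. (?q u - ?q l) \<bullet> b) = (\<Prod>j\<in>UNIV. u $ inv p j - l $ inv p j)"
    by (simp only: prod_Basis_cart) (simp add: inner_axis)
  have ord: "?q l \<bullet> b \<le> ?q u \<bullet> b" if "b \<in> Basis" for b
    using that le by (auto simp: Basis_vec_def inner_axis)
  have "?T -` box l u = box (?q l) (?q u)"
    using assms by (auto simp: mem_box_cart bij_is_surj surj_f_inv_f)
       (metis assms bij_inv_eq_iff)+
  hence "emeasure (distr lborel borel ?T) (box l u) = emeasure lborel (box (?q l) (?q u))"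
    using T by (subst emeasure_distr) auto
  also have "\<dots> = (\<Prod>j\<in>UNIV. u $ inv p j - l $ inv p j)"
    by (simp only: emeasure_lborel_box[OF ord] prod_eq)
  also have "(\<Prod>j\<in>UNIV. u $ inv p j - l $ inv p j) = (\<Prod>i\<in>UNIV. u $ i - l $ i)"
    using bij_imp_bij_inv[OF assms] by (rule prod.reindex_bij_betw)
  finally show "emeasure (distr lborel borel ?T) (box l u) = (\<Prod>b\<in>Basis. (u - l) \<bullet> b)"
    by (simp add: prod_Basis_cart inner_axis)
qed simp

text \<open>The relabelling \<open>?T\<close> of coordinates preserves norms and Lebesgue measure
  and commutes with inversions, so it carries the well-ordered case over to an arbitrary finite
  index type.\<close>

lemma distr_inversion:
  assumes "r > 0"
  shows "distr (density lborel (\<lambda>z. ennreal ((r\<^sup>2 / (norm z)\<^sup>2) ^ CARD('n)))) borel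
      (inversion r) = (lborel :: (real^'n::finite) measure)"
proof -
  let ?T = "\<lambda>z::real^'n wo. (\<chi> i. z $ Abs_wo i) :: real^'n"
  have bij: "bij (Abs_wo :: 'n \<Rightarrow> 'n wo)"
    by (rule bij_betw_byWitness[where f' = Rep_wo]) (auto simp: Abs_wo_inverse Rep_wo_inverse)
  have card: "CARD('n wo) = CARD('n)"
    using bij bij_betw_same_card by metis
  have T: "?T \<in> borel_measurable borel"
    by (intro borel_measurable_continuous_onI continuous_intros)
  have nT: "norm (?T z) = norm z" for z
  proof -
    have "(\<Sum>i\<in>UNIV. (z $ Abs_wo i)\<^sup>2) = (\<Sum>i\<in>UNIV. (z $ i)\<^sup>2)"
      using bij by (rule sum.reindex_bij_betw)
    thus ?thesis by (simp add: norm_vec_def L2_set_def)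
  qed
  have iT: "inversion r (?T z) = ?T (inversion r z)" for z
    by (simp add: inversion_def nT vec_eq_iff)
  have lT: "distr lborel borel ?T = lborel" by (rule distr_reindex_lborel[OF bij])
  show ?thesis
  proof (rule measure_eqI)
    fix A :: "(real^'n) set" assume "A \<in> sets (distr (density lborel (\<lambda>z. ennreal ((r\<^sup>2 / (norm z)\<^sup>2) ^ CARD('n)))) borel (inversion r))"
    hence A: "A \<in> sets borel" by simp
    have TA: "?T -` A \<in> sets borel" using measurable_sets[OF T A] by simp
    have "emeasure (distr (density lborel (\<lambda>z. ennreal ((r\<^sup>2 / (norm z)\<^sup>2) ^ CARD('n)))) borel (inversion r)) A
      = (\<integral>\<^sup>+z. ennreal ((r\<^sup>2 / (norm z)\<^sup>2) ^ CARD('n)) * indicator (inversion r -` A) z \<partial>lborel)"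
      using A by (subst emeasure_distr) (auto simp: emeasure_density inversion_vimage_borel)
    also have "\<dots> = (\<integral>\<^sup>+z. ennreal ((r\<^sup>2 / (norm z)\<^sup>2) ^ CARD('n)) * indicator (inversion r -` A) z \<partial>distr lborel borel ?T)"
      by (simp only: lT)
    also have "\<dots> = (\<integral>\<^sup>+z. ennreal ((r\<^sup>2 / (norm (?T z))\<^sup>2) ^ CARD('n)) * indicator (inversion r -` A) (?T z) \<partial>lborel)"
      using A T by (subst nn_integral_distr) (auto simp: inversion_vimage_borel)
    also have "\<dots> = (\<integral>\<^sup>+z. ennreal ((r\<^sup>2 / (norm z)\<^sup>2) ^ CARD('n wo)) * indicator (inversion r -` (?T -` A)) z \<partial>lborel)"
      by (simp only: nT card indicator_vimage[symmetric] vimage_def iT mem_Collect_eq indicator_def)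
    also have "\<dots> = emeasure (distr (density lborel (\<lambda>z. ennreal ((r\<^sup>2 / (norm z)\<^sup>2) ^ CARD('n wo)))) borel (inversion r)) (?T -` A)"
      using TA by (subst emeasure_distr) (auto simp: emeasure_density inversion_vimage_borel)
    also have "\<dots> = emeasure lborel (?T -` A)"
      by (simp only: distr_inversion_wellorder[OF assms])
    also have "\<dots> = emeasure (distr lborel borel ?T) A"
      using A T by (subst emeasure_distr) auto
    finally show "emeasure (distr (density lborel (\<lambda>z. ennreal ((r\<^sup>2 / (norm z)\<^sup>2) ^ CARD('n)))) borel (inversion r)) A = emeasure lborel A"
      by (simp only: lT)
  qed simp
qed

lemma
  fixes F :: "real^'n::finite \<Rightarrow> real"
  assumes "r > 0" and F [measurable]: "F \<in> borel_measurable borel"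
  shows integrable_inversion_iff: "integrable lborel F \<longleftrightarrow>
      integrable lborel (\<lambda>z. (r\<^sup>2 / (norm z)\<^sup>2) ^ CARD('n) * F (inversion r z))"
    and integral_inversion: "(\<integral>z. F z \<partial>lborel) =
      (\<integral>z. (r\<^sup>2 / (norm z)\<^sup>2) ^ CARD('n) * F (inversion r z) \<partial>lborel)"
proof -
  have "integrable lborel F \<longleftrightarrow> integrable (distr (density lborel (\<lambda>z. ennreal ((r\<^sup>2 / (norm z)\<^sup>2) ^ CARD('n)))) borel
      (inversion r)) F"
    by (simp only: distr_inversion[OF assms(1)])
  also have "\<dots> \<longleftrightarrow> integrable (density lborel (\<lambda>z. ennreal ((r\<^sup>2 / (norm z)\<^sup>2) ^ CARD('n)))) (\<lambda>z. F (inversion r z))"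
    by (subst integrable_distr_eq) auto
  also have "\<dots> \<longleftrightarrow> integrable lborel (\<lambda>z. (r\<^sup>2 / (norm z)\<^sup>2) ^ CARD('n) * F (inversion r z))"
    by (subst integrable_density) auto
  finally show "integrable lborel F \<longleftrightarrow>
      integrable lborel (\<lambda>z. (r\<^sup>2 / (norm z)\<^sup>2) ^ CARD('n) * F (inversion r z))" .
  have "(\<integral>z. F z \<partial>lborel) = (\<integral>z. F z \<partial>(distr (density lborel (\<lambda>z. ennreal ((r\<^sup>2 / (norm z)\<^sup>2) ^ CARD('n)))) borel
      (inversion r)))"
    by (simp only: distr_inversion[OF assms(1)])
  also have "\<dots> = (\<integral>z. F (inversion r z) \<partial>(density lborel (\<lambda>z. ennreal ((r\<^sup>2 / (norm z)\<^sup>2) ^ CARD('n)))))"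
    by (subst integral_distr) auto
  also have "\<dots> = (\<integral>z. (r\<^sup>2 / (norm z)\<^sup>2) ^ CARD('n) * F (inversion r z) \<partial>lborel)"
    by (subst integral_density) auto
  finally show "(\<integral>z. F z \<partial>lborel) =
      (\<integral>z. (r\<^sup>2 / (norm z)\<^sup>2) ^ CARD('n) * F (inversion r z) \<partial>lborel)" .
qed

section \<open>Principal values and the Kelvin transform\<close>

text \<open>Dyadic decomposition: on the shell 2^k \<epsilon> \<le> |x - z| \<le> 2^(k+1) \<epsilon>
  the kernel is at most (2^k \<epsilon>)^(-n-\<alpha>), and the enclosing ball has volume of order
  (2^k \<epsilon>)^n. The products form a geometric series of ratio 2^(-\<alpha>).\<close>

lemma integrable_norm_powr_outside_ball:
  fixes x :: "real^'n::finite"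
  assumes "0 < \<epsilon>" "0 < \<alpha>"
  shows "set_integrable lborel (- cball x \<epsilon>) (\<lambda>z. 1 / norm (x - z) powr (real CARD('n) + \<alpha>))"
proof -
  let ?N = "real CARD('n) + \<alpha>" and ?V = "unit_ball_vol (real CARD('n))"
  let ?g = "\<lambda>k z. indicator (cball x (2 ^ Suc k * \<epsilon>)) z * (2 ^ k * \<epsilon>) powr (- ?N)"
  have le: "indicator (- cball x \<epsilon>) z * (1 / norm (x - z) powr ?N) \<le> (\<Sum>k. ennreal (?g k z))" for z
  proof (cases "z \<in> cball x \<epsilon>")
    case False
    define d where "d = norm (x - z)"
    have d: "d > \<epsilon>" using False by (simp add: d_def dist_norm)
    define k where "k = nat \<lfloor>log 2 (d / \<epsilon>)\<rfloor>"
    have l: "log 2 (d / \<epsilon>) \<ge> 0" using d assms by simp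
    have "real k \<le> log 2 (d / \<epsilon>)" "log 2 (d / \<epsilon>) \<le> real (Suc k)" using l by (auto simp: k_def) linarith
    hence "2 powr real k \<le> d / \<epsilon>" "d / \<epsilon> \<le> 2 powr real (Suc k)"
      using d assms by (simp_all add: le_log_iff log_le_iff)
    hence k: "2 ^ k * \<epsilon> \<le> d" "d \<le> 2 ^ Suc k * \<epsilon>"
      using assms by (simp_all add: powr_realpow field_simps del: of_nat_Suc power_Suc)
    have "1 / d powr ?N = d powr (- ?N)" by (simp only: powr_minus_divide)
    also have "\<dots> \<le> (2 ^ k * \<epsilon>) powr (- ?N)"
      using k assms by (intro powr_mono2') auto
    finally have "1 / d powr ?N \<le> ?g k z" using k(2) by (simp add: d_def dist_norm)
    hence "ennreal (1 / d powr ?N) \<le> ennreal (?g k z)" by (rule ennreal_leI)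
    also have "\<dots> = (\<Sum>j\<in>{k}. ennreal (?g j z))"
      by (simp only: sum.insert_if finite.emptyI empty_iff if_False sum.empty add_0_right)
    also have "\<dots> \<le> (\<Sum>k. ennreal (?g k z))"
      by (rule sum_le_suminf) (simp_all only: summableI finite.intros zero_le)
    finally show ?thesis using False by (simp add: d_def)
  qed simp
  have "(\<integral>\<^sup>+z. (\<Sum>k. ennreal (?g k z)) \<partial>lborel) = (\<Sum>k. \<integral>\<^sup>+z. ennreal (?g k z) \<partial>lborel)"
    by (intro nn_integral_suminf measurable_compose[OF _ measurable_ennreal] borel_measurable_times
        borel_measurable_indicator borel_measurable_const) simp
  also have "(\<lambda>k. \<integral>\<^sup>+z. ennreal (?g k z) \<partial>lborel) =
      (\<lambda>k. ennreal (?V * 2 ^ CARD('n) * \<epsilon> powr (- \<alpha>) * (2 powr (- \<alpha>)) ^ k))"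
  proof
    fix k
    have "(\<integral>\<^sup>+z. ennreal (?g k z) \<partial>lborel) =
        (\<integral>\<^sup>+z. ennreal ((2 ^ k * \<epsilon>) powr (- ?N)) * indicator (cball x (2 ^ Suc k * \<epsilon>)) z \<partial>lborel)"
      by (intro nn_integral_cong) (auto simp: indicator_def)
    also have "\<dots> = ennreal ((2 ^ k * \<epsilon>) powr (- ?N)) * emeasure lborel (cball x (2 ^ Suc k * \<epsilon>))"
      by (rule nn_integral_cmult_indicator) simp
    also have "emeasure lborel (cball x (2 ^ Suc k * \<epsilon>)) = ennreal (?V * (2 ^ Suc k * \<epsilon>) ^ CARD('n))"
      using assms by (subst emeasure_cball) auto
    also have "ennreal ((2 ^ k * \<epsilon>) powr (- ?N)) * \<dots> =
        ennreal ((2 ^ k * \<epsilon>) powr (- ?N) * (?V * (2 ^ Suc k * \<epsilon>) ^ CARD('n)))"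
      by (simp add: ennreal_mult')
    also have "(2 ^ k * \<epsilon>) powr (- ?N) * (?V * (2 ^ Suc k * \<epsilon>) ^ CARD('n)) =
       ?V * 2 ^ CARD('n) * ((2 ^ k * \<epsilon>) powr (- ?N) * (2 ^ k * \<epsilon>) powr (real CARD('n)))"
      using assms by (simp add: powr_realpow power_mult_distrib)
    also have "(2 ^ k * \<epsilon>) powr (- ?N) * (2 ^ k * \<epsilon>) powr (real CARD('n)) = (2 ^ k * \<epsilon>) powr (- \<alpha>)"
      by (simp flip: powr_add)
    also have "\<dots> = \<epsilon> powr (- \<alpha>) * (2 powr (- \<alpha>)) ^ k"
      using assms by (simp add: powr_mult powr_powr mult_ac flip: powr_realpow)
    finally show "(\<integral>\<^sup>+z. ennreal (?g k z) \<partial>lborel) =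
        ennreal (?V * 2 ^ CARD('n) * \<epsilon> powr (- \<alpha>) * (2 powr (- \<alpha>)) ^ k)"
      by (simp add: mult_ac)
  qed
  also have "(\<Sum>k. ennreal (?V * 2 ^ CARD('n) * \<epsilon> powr (- \<alpha>) * (2 powr (- \<alpha>)) ^ k)) < \<infinity>"
  proof -
    have "2 powr (- \<alpha>) < (1::real)" using assms by (simp add: powr_less_one)
    hence "summable (\<lambda>k. ?V * 2 ^ CARD('n) * \<epsilon> powr (- \<alpha>) * (2 powr (- \<alpha>)) ^ k)"
      by (intro summable_mult summable_geometric) simp
    thus ?thesis by (simp add: ennreal_suminf_neq_top top.not_eq_extremum)
  qed
  finally have fin: "(\<integral>\<^sup>+z. (\<Sum>k. ennreal (?g k z)) \<partial>lborel) < \<infinity>" .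
  have "(\<integral>\<^sup>+z. norm (indicator (- cball x \<epsilon>) z * (1 / norm (x - z) powr ?N)) \<partial>lborel)
     \<le> (\<integral>\<^sup>+z. (\<Sum>k. ennreal (?g k z)) \<partial>lborel)"
  proof (rule nn_integral_mono)
    fix z
    have "norm (indicator (- cball x \<epsilon>) z * (1 / norm (x - z) powr ?N)) =
        indicator (- cball x \<epsilon>) z * (1 / norm (x - z) powr ?N)" by simp
    thus "norm (indicator (- cball x \<epsilon>) z * (1 / norm (x - z) powr ?N)) \<le> (\<Sum>k. ennreal (?g k z))"
      using le[of z] by (simp only:)
  qed
  from this and fin
  have "(\<integral>\<^sup>+z. norm (indicator (- cball x \<epsilon>) z * (1 / norm (x - z) powr ?N)) \<partial>lborel) < \<infinity>"
    by (rule le_less_trans)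
  thus ?thesis
    unfolding set_integrable_def real_scaleR_def by (intro integrableI_bounded) auto
qed

section \<open>Truncation by sets that are almost balls\<close>

lemma set_integral_annulus_diff:
  fixes h :: "real^'n::finite \<Rightarrow> real"
  assumes [measurable]: "S \<in> sets borel" "S' \<in> sets borel"
    and S: "- cball y \<rho>' \<subseteq> S" "S \<subseteq> - cball y \<rho>" and S': "- cball y \<rho>' \<subseteq> S'" "S' \<subseteq> - cball y \<rho>"
    and \<rho>: "0 < \<rho>" "\<rho> \<le> \<rho>'" and h: "set_integrable lborel (- cball y \<rho>) h"
    and B: "\<And>z. \<rho> < dist y z \<Longrightarrow> dist y z \<le> \<rho>' \<Longrightarrow> \<bar>h z\<bar> \<le> B"
  shows "\<bar>(LINT z:S|lborel. h z) - (LINT z:S'|lborel. h z)\<bar> \<le>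
    B * (unit_ball_vol (real CARD('n)) * (\<rho>' ^ CARD('n) - \<rho> ^ CARD('n)))"
proof -
  have int: "set_integrable lborel S h" "set_integrable lborel S' h"
    by (rule set_integrable_subset[OF h]; use S S' in simp)+
  let ?A = "cball y \<rho>' - cball y \<rho>"
  have "(LINT z:S|lborel. h z) - (LINT z:S'|lborel. h z) =
      (\<integral>z. (indicator S z - indicator S' z) * h z \<partial>lborel)"
    using int unfolding set_integrable_def set_lebesgue_integral_def
    by (simp add: algebra_simps)
  also have "\<bar>\<dots>\<bar> \<le> (\<integral>z. indicator ?A z * B \<partial>lborel)"
  proof (rule integral_abs_bound_integral)
    show "integrable lborel (\<lambda>z. (indicator S z - indicator S' z) * h z)"
      using int unfolding set_integrable_def by (simp add: algebra_simps)
    show "integrable lborel (\<lambda>z. indicator ?A z * B)"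
      using le_less_trans[OF emeasure_mono[of ?A "cball y \<rho>'"] emeasure_lborel_cball_finite]
      by (intro integrable_mult_left integrable_real_indicator) auto
    show "\<bar>(indicator S z - indicator S' z) * h z\<bar> \<le> indicator ?A z * B" for z
      using S S' B[of z] by (auto simp: indicator_def split: if_splits)
  qed
  also have "\<dots> = B * measure lborel ?A" by simp
  also have "measure lborel ?A = measure lborel (cball y \<rho>') - measure lborel (cball y \<rho>)"
    using \<rho> emeasure_lborel_cball_finite[of y \<rho>'] by (intro measure_Diff) (auto simp: less_top)
  also have "\<dots> = unit_ball_vol (real CARD('n)) * (\<rho>' ^ CARD('n) - \<rho> ^ CARD('n))"
    using \<rho> by (simp add: content_cball algebra_simps)
  finally show ?thesis .
qed

text \<open>Both truncations lie between balls of radii \<epsilon> b/(a+\<epsilon>) and \<epsilon>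
  b/(a-\<epsilon>). The annulus has volume of order \<epsilon>^(n+1), and the integrand on it is of
  order \<epsilon>^(1-n-\<alpha>), so the discrepancy is of order \<epsilon>^(2-\<alpha>). Here
  \<alpha> < 2 enters.\<close>

lemma set_integral_annulus_limit:
  fixes h :: "real^'n::finite \<Rightarrow> real"
  assumes \<alpha>: "0 < \<alpha>" "\<alpha> < 2" and ab: "0 < a" "0 < b"
    and S: "\<And>\<epsilon>. 0 < \<epsilon> \<Longrightarrow> \<epsilon> < a \<Longrightarrow> S \<epsilon> \<in> sets borel \<and>
       - cball y (\<epsilon> * b / (a - \<epsilon>)) \<subseteq> S \<epsilon> \<and> S \<epsilon> \<subseteq> - cball y (\<epsilon> * b / (a + \<epsilon>))"
    and h: "\<And>\<epsilon>. 0 < \<epsilon> \<Longrightarrow> set_integrable lborel (- cball y \<epsilon>) h"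
    and L: "L \<ge> 0" "\<delta> > 0" "\<And>z. z \<noteq> y \<Longrightarrow> dist y z < \<delta> \<Longrightarrow>
       \<bar>h z\<bar> \<le> L * dist y z powr (1 - (real CARD('n) + \<alpha>))"
  shows "((\<lambda>\<epsilon>. (LINT z:S \<epsilon>|lborel. h z) - (LINT z:- cball y (\<epsilon> * (b / a))|lborel. h z)) \<longlongrightarrow> 0) (at_right 0)"
proof -
  let ?N = "real CARD('n) + \<alpha>" and ?V = "unit_ball_vol (real CARD('n))" and ?n = "CARD('n)"
  let ?g = "\<lambda>\<epsilon>::real. (1 / (a - \<epsilon>)) ^ ?n - (1 / (a + \<epsilon>)) ^ ?n"
  let ?E = "\<lambda>\<epsilon>::real. L * ?V * b ^ ?n * (\<epsilon> powr (2 - \<alpha>) * (b / (a + \<epsilon>)) powr (1 - ?N) * (?g \<epsilon> / \<epsilon>))"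
  \<comment> \<open>\<open>?g\<close> vanishes at 0, so \<open>?g \<epsilon> / \<epsilon>\<close> is
    its difference quotient and has a finite limit; this is the extra factor \<epsilon> gained from
    the thinness of the annulus.\<close>
  obtain D where "(?g has_field_derivative D) (at 0)"
    using ab by (rule_tac that) (auto intro!: derivative_eq_intros)
  hence "((\<lambda>\<epsilon>. ?g \<epsilon> / \<epsilon>) \<longlongrightarrow> D) (at 0)"
    by (simp add: has_field_derivative_iff)
  hence D: "((\<lambda>\<epsilon>. ?g \<epsilon> / \<epsilon>) \<longlongrightarrow> D) (at_right 0)"
    by (rule filterlim_mono) (auto simp: at_within_le_at)
  have p: "((\<lambda>\<epsilon>::real. \<epsilon> powr (2 - \<alpha>)) \<longlongrightarrow> 0) (at_right 0)"
    using \<alpha> by (intro tendsto_zero_powrI[where b = "2 - \<alpha>"] tendsto_const tendsto_ident_at)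
      (auto intro: eventually_mono[OF eventually_at_right_less])
  have "(?E \<longlongrightarrow> L * ?V * b ^ ?n * (0 * (b / (a + 0)) powr (1 - ?N) * D)) (at_right 0)"
    using ab by (intro tendsto_intros p D) auto
  hence E: "(?E \<longlongrightarrow> 0) (at_right 0)" by simp
  have "eventually (\<lambda>\<epsilon>. \<epsilon> * b / (a - \<epsilon>) < \<delta>) (at_right 0)"
  proof (rule order_tendstoD)
    show "((\<lambda>\<epsilon>. \<epsilon> * b / (a - \<epsilon>)) \<longlongrightarrow> 0 * b / (a - 0)) (at_right 0)"
      using ab by (intro tendsto_intros) auto
  qed (use L in auto)
  moreover have "eventually (\<lambda>\<epsilon>. 0 < \<epsilon> \<and> \<epsilon> < a) (at_right 0)"
    using ab by (auto simp: eventually_at_right intro!: exI[of _ a])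
  ultimately have "eventually (\<lambda>\<epsilon>. norm ((LINT z:S \<epsilon>|lborel. h z) - (LINT z:- cball y (\<epsilon> * (b / a))|lborel. h z)) \<le> ?E \<epsilon>)
     (at_right 0)"
  proof eventually_elim
    case (elim \<epsilon>)
    let ?\<rho> = "\<epsilon> * b / (a + \<epsilon>)" and ?\<rho>' = "\<epsilon> * b / (a - \<epsilon>)"
    have \<epsilon>: "0 < \<epsilon>" "\<epsilon> < a" using elim by auto
    have \<rho>: "0 < ?\<rho>" "?\<rho> \<le> \<epsilon> * (b / a)" "\<epsilon> * (b / a) \<le> ?\<rho>'"
      using \<epsilon> ab by (auto intro!: divide_left_mono mult_pos_pos)
    have "\<bar>(LINT z:S \<epsilon>|lborel. h z) - (LINT z:- cball y (\<epsilon> * (b / a))|lborel. h z)\<bar> \<le>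
       (L * ?\<rho> powr (1 - ?N)) * (?V * (?\<rho>' ^ ?n - ?\<rho> ^ ?n))"
    proof (rule set_integral_annulus_diff)
      show "\<bar>h z\<bar> \<le> L * ?\<rho> powr (1 - ?N)" if "?\<rho> < dist y z" "dist y z \<le> ?\<rho>'" for z
      proof -
        have "\<bar>h z\<bar> \<le> L * dist y z powr (1 - ?N)"
          using that \<rho> elim by (intro L) auto
        also have "\<dots> \<le> L * ?\<rho> powr (1 - ?N)"
        proof (intro mult_left_mono powr_mono2')
          have "1 \<le> real CARD('n)" using zero_less_card_finite[where 'a='n] by linarith
          thus "1 - ?N \<le> 0" using \<alpha> by linarith
        qed (use that \<rho> L in auto)
        finally show ?thesis .
      qed
    qed (use S[of \<epsilon>] \<epsilon> \<rho> in \<open>auto intro: h\<close>)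
    also have "\<dots> = ?E \<epsilon>"
    proof -
      have "?\<rho>' ^ ?n - ?\<rho> ^ ?n = \<epsilon> ^ ?n * b ^ ?n * ?g \<epsilon>"
        by (simp add: power_mult_distrib power_divide algebra_simps)
      moreover have "?\<rho> powr (1 - ?N) = \<epsilon> powr (1 - ?N) * (b / (a + \<epsilon>)) powr (1 - ?N)"
        using \<epsilon> ab by (subst powr_mult[symmetric]) auto
      moreover have "\<epsilon> powr (1 - ?N) * \<epsilon> ^ ?n = \<epsilon> powr (2 - \<alpha>) / \<epsilon>"
      proof -
        have "\<epsilon> powr (1 - ?N) * \<epsilon> ^ ?n = \<epsilon> powr ((1 - ?N) + real ?n)"
          using \<epsilon> by (simp only: powr_realpow powr_add)
        also have "(1 - ?N) + real ?n = (2 - \<alpha>) - 1" by simp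
        also have "\<epsilon> powr ((2 - \<alpha>) - 1) = \<epsilon> powr (2 - \<alpha>) / \<epsilon>"
          using \<epsilon> by (simp only: powr_diff powr_one)
        finally show ?thesis .
      qed
      moreover have "(L * ?\<rho> powr (1 - ?N)) * (?V * (?\<rho>' ^ ?n - ?\<rho> ^ ?n)) =
        L * ?V * b ^ ?n * ((\<epsilon> powr (1 - ?N) * \<epsilon> ^ ?n) * (b / (a + \<epsilon>)) powr (1 - ?N) * ?g \<epsilon>)"
        by (simp only: calculation(1,2) mult_ac)
      ultimately show ?thesis by simp
    qed
    finally show ?case by simp
  qed
  thus ?thesis by (rule Lim_null_comparison) (rule E)
qed

text \<open>The distance formula turns the condition on \<open>y\<close> into |x' - y| |x| >
  \<epsilon> |y|, where x' is the image of \<open>x\<close>. Since |y| differs from \<open>b\<close>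
  = |x'| by at most |x' - y|, the solution set is enclosed between complements of two balls about
  x'.\<close>

lemma inversion_outside_ball:
  fixes x :: "real^'n::finite"
  assumes "x \<noteq> 0" "r > 0" "0 < \<epsilon>" "\<epsilon> < norm x"
  defines "b \<equiv> norm (inversion r x)"
  shows "- cball (inversion r x) (\<epsilon> * b / (norm x - \<epsilon>)) \<subseteq> inversion r -` (- cball x \<epsilon>)"
    and "inversion r -` (- cball x \<epsilon>) \<subseteq> - cball (inversion r x) (\<epsilon> * b / (norm x + \<epsilon>))"
proof -
  have b: "b > 0" using assms by (simp add: b_def)
  have main: "norm (x - inversion r y) > \<epsilon> \<longleftrightarrow> norm (inversion r x - y) * norm x > \<epsilon> * norm y" if "y \<noteq> 0" for y
    using that assms norm_diff_inversion[of x y r] by (simp add: field_simps)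
  show "- cball (inversion r x) (\<epsilon> * b / (norm x - \<epsilon>)) \<subseteq> inversion r -` (- cball x \<epsilon>)"
  proof
    fix y assume "y \<in> - cball (inversion r x) (\<epsilon> * b / (norm x - \<epsilon>))"
    hence y: "\<epsilon> * b < norm (inversion r x - y) * (norm x - \<epsilon>)"
      using assms by (simp add: dist_norm field_simps)
    show "y \<in> inversion r -` (- cball x \<epsilon>)"
    proof (cases "y = 0")
      case False
      have "norm y \<le> b + norm (inversion r x - y)"
        unfolding b_def by (metis norm_minus_commute norm_triangle_sub)
      hence "\<epsilon> * norm y \<le> \<epsilon> * (b + norm (inversion r x - y))" using assms by simp
      with y have "\<epsilon> * norm y < norm (inversion r x - y) * norm x" by (simp add: algebra_simps)
      thus ?thesis using main[OF False] by (simp add: dist_norm)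
    qed (use assms in simp)
  qed
  show "inversion r -` (- cball x \<epsilon>) \<subseteq> - cball (inversion r x) (\<epsilon> * b / (norm x + \<epsilon>))"
  proof
    fix y assume y: "y \<in> inversion r -` (- cball x \<epsilon>)"
    have "\<epsilon> * b < norm (inversion r x - y) * (norm x + \<epsilon>)"
    proof (cases "y = 0")
      case True
      thus ?thesis using b assms by (simp add: b_def algebra_simps)
    next
      case False
      have "b \<le> norm y + norm (inversion r x - y)"
        unfolding b_def by (metis norm_triangle_sub)
      hence "\<epsilon> * b \<le> \<epsilon> * (norm y + norm (inversion r x - y))" using assms by simp
      moreover have "\<epsilon> * norm y < norm (inversion r x - y) * norm x"
        using y main[OF False] by (simp add: dist_norm)
      ultimately show ?thesis by (simp add: algebra_simps)
    qed
    thus "y \<in> - cball (inversion r x) (\<epsilon> * b / (norm x + \<epsilon>))"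
      using assms by (simp add: dist_norm field_simps)
  qed
qed

text \<open>The Jacobian (r/|z|)^(2n) over the factor (r/|z|)^(n+\<alpha>) of the kernel leaves
  (r/|z|)^(n-\<alpha>): this cancellation dictates the Kelvin exponent. At z = 0 and z = x both
  sides are 0 by convention.\<close>

lemma kernel_inversion:
  fixes x z :: "real^'n::finite"
  assumes "x \<noteq> 0" "r > 0"
  shows "(r\<^sup>2 / (norm z)\<^sup>2) ^ CARD('n) / norm (inversion r x - inversion r z) powr (real CARD('n) + \<alpha>) =
    (norm x / r) powr (real CARD('n) + \<alpha>) * (r / norm z) powr (real CARD('n) - \<alpha>) /
      norm (x - z) powr (real CARD('n) + \<alpha>)"
proof (cases "z = 0 \<or> z = x")
  case False
  let ?N = "real CARD('n) + \<alpha>"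
  have z: "z \<noteq> 0" "z \<noteq> x" using False by auto
  have "norm (inversion r x - inversion r z) = (r / norm z) * ((r / norm x) * norm (x - z))"
    using assms z by (simp add: norm_inversion_diff power2_eq_square mult_ac)
  moreover have "(a * (b * c)) powr q = a powr q * (b powr q * c powr q)"
    if "a \<ge> 0" "b \<ge> 0" "c \<ge> 0" for a b c q :: real
    using that by (simp add: powr_mult)
  ultimately have 1: "norm (inversion r x - inversion r z) powr ?N =
      (r / norm z) powr ?N * ((r / norm x) powr ?N * norm (x - z) powr ?N)"
    using assms by (simp only: zero_le_divide_iff norm_ge_zero less_imp_le simp_thms)
  have 2: "(r\<^sup>2 / (norm z)\<^sup>2) ^ CARD('n) = (r / norm z) powr ?N * (r / norm z) powr (real CARD('n) - \<alpha>)"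
  proof -
    have "(r\<^sup>2 / (norm z)\<^sup>2) ^ CARD('n) = (r / norm z) ^ (2 * CARD('n))"
      by (simp add: power_mult power_divide)
    also have "\<dots> = (r / norm z) powr (real (2 * CARD('n)))"
      using assms z by (subst powr_realpow) auto
    also have "real (2 * CARD('n)) = ?N + (real CARD('n) - \<alpha>)" by simp
    finally show ?thesis by (simp only: powr_add)
  qed
  have 3: "(norm x / r) powr ?N = 1 / (r / norm x) powr ?N"
    using assms by (simp add: powr_divide)
  have "(r / norm z) powr ?N > 0" using assms z by auto
  thus ?thesis unfolding 1 2 3 by simp
qed (use assms in \<open>auto simp: zero_less_card_finite\<close>)

lemma
  fixes x :: "real^'n::finite" and G :: "real^'n \<Rightarrow> real" and \<alpha> :: real
  assumes "x \<noteq> 0" "r > 0" and [measurable]: "S \<in> sets borel" "G \<in> borel_measurable borel"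
  defines "K \<equiv> \<lambda>x z. norm (x - z) powr (real CARD('n) + \<alpha>)"
  shows set_integrable_kernel_inversion:
      "set_integrable lborel (inversion r -` S) (\<lambda>y. G y / K (inversion r x) y) \<longleftrightarrow>
       set_integrable lborel S (\<lambda>z. (r / norm z) powr (real CARD('n) - \<alpha>) * G (inversion r z) / K x z)"
    and set_integral_kernel_inversion:
      "(LINT y:inversion r -` S|lborel. G y / K (inversion r x) y) = (norm x / r) powr (real CARD('n) + \<alpha>) *
       (LINT z:S|lborel. (r / norm z) powr (real CARD('n) - \<alpha>) * G (inversion r z) / K x z)"
proof -
  have [measurable]: "inversion r -` S \<in> sets borel" by (rule inversion_vimage_borel) simp
  let ?F = "\<lambda>y. indicator (inversion r -` S) y * (G y / K (inversion r x) y)"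
  let ?c = "(norm x / r) powr (real CARD('n) + \<alpha>)"
  have F [measurable]: "?F \<in> borel_measurable borel" unfolding K_def by measurable
  have eq: "(r\<^sup>2 / (norm z)\<^sup>2) ^ CARD('n) * ?F (inversion r z) =
     ?c * (indicator S z * ((r / norm z) powr (real CARD('n) - \<alpha>) * G (inversion r z) / K x z))" for z
  proof -
    have "(r\<^sup>2 / (norm z)\<^sup>2) ^ CARD('n) * ?F (inversion r z) = indicator S z * G (inversion r z) *
        ((r\<^sup>2 / (norm z)\<^sup>2) ^ CARD('n) / K (inversion r x) (inversion r z))"
      using assms(2) by (simp add: indicator_def)
    thus ?thesis
      unfolding K_def kernel_inversion[OF assms(1,2)] by simp
  qed
  have "?c \<noteq> 0" using assms by simp
  thus "set_integrable lborel (inversion r -` S) (\<lambda>y. G y / K (inversion r x) y) \<longleftrightarrow>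
       set_integrable lborel S (\<lambda>z. (r / norm z) powr (real CARD('n) - \<alpha>) * G (inversion r z) / K x z)"
    using integrable_inversion_iff[OF assms(2) F]
    unfolding set_integrable_def real_scaleR_def eq integrable_mult_left_iff by simp
  show "(LINT y:inversion r -` S|lborel. G y / K (inversion r x) y) = ?c *
       (LINT z:S|lborel. (r / norm z) powr (real CARD('n) - \<alpha>) * G (inversion r z) / K x z)"
    using integral_inversion[OF assms(2) F]
    unfolding set_lebesgue_integral_def real_scaleR_def eq integral_mult_right_zero .
qed

text \<open>The principal value with respect to \<open>lborel\<close> and with the normalization
  constant left out, so that translation and change of variables apply directly. The constant
  reappears as a divisor on the right-hand side of the equation.\<close>

definition frac_pv :: "real \<Rightarrow> (real^'n::finite \<Rightarrow> real) \<Rightarrow> real^'n \<Rightarrow> real \<Rightarrow> bool" where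
  "frac_pv \<alpha> U x I \<longleftrightarrow>
     (\<forall>\<epsilon>>0. set_integrable lborel (- cball x \<epsilon>) (\<lambda>z. (U x - U z) / norm (x - z) powr (real CARD('n) + \<alpha>))) \<and>
     ((\<lambda>\<epsilon>. LINT z:- cball x \<epsilon>|lborel. (U x - U z) / norm (x - z) powr (real CARD('n) + \<alpha>)) \<longlongrightarrow> I)
       (at_right 0)"

text \<open>The first term is the Kelvin transform. At the centre, division by zero makes the value
  \<open>- U 0\<close>, which has no geometric meaning; sign conditions therefore exclude
  \<open>z = 0\<close>.\<close>

definition kelvin_diff :: "real \<Rightarrow> real \<Rightarrow> (real^'n::finite \<Rightarrow> real) \<Rightarrow> real^'n \<Rightarrow> real" where
  "kelvin_diff \<alpha> r U z = (r / norm z) powr (real CARD('n) - \<alpha>) * U (inversion r z) - U z"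

lemma differentiable_imp_local_lipschitz:
  fixes U :: "'a::real_normed_vector \<Rightarrow> 'b::real_normed_vector"
  assumes "U differentiable (at x)"
  obtains L \<delta> where "L \<ge> 0" "\<delta> > 0" "\<And>z. dist x z < \<delta> \<Longrightarrow> norm (U x - U z) \<le> L * dist x z"
proof -
  obtain U' where U': "(U has_derivative U') (at x)" using assms differentiable_def by blast
  then interpret bounded_linear U' by (rule has_derivative_bounded_linear)
  obtain K where K: "K > 0" "\<And>h. norm (U' h) \<le> norm h * K" using pos_bounded by blast
  obtain \<delta> where \<delta>: "\<delta> > 0" "\<And>z. norm (z - x) < \<delta> \<Longrightarrow> norm (U z - U x - U' (z - x)) \<le> 1 * norm (z - x)"
    using U' unfolding has_derivative_at_alt by (metis zero_less_one)
  show ?thesis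
  proof (rule that)
    fix z assume "dist x z < \<delta>"
    hence "norm (U z - U x - U' (z - x)) \<le> norm (z - x)" using \<delta>(2)[of z] by (simp add: dist_norm norm_minus_commute)
    moreover have "norm (U z - U x) \<le> norm (U z - U x - U' (z - x)) + norm (U' (z - x))"
      by (metis add.commute norm_triangle_sub)
    ultimately have "norm (U z - U x) \<le> norm (z - x) + norm (z - x) * K"
      using K(2)[of "z - x"] by linarith
    thus "norm (U x - U z) \<le> (1 + K) * dist x z"
      by (simp add: dist_norm norm_minus_commute algebra_simps)
  qed (use K \<delta> in auto)
qed

text \<open>With N = n + \<alpha> and \<alpha> \<ge> 1 this bound is not integrable at
  \<open>x\<close>; it serves on thin annuli around \<open>x\<close>, where the one power gained
  from differentiability suffices.\<close>

lemma differentiable_kernel_bound: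
  fixes U :: "real^'n::finite \<Rightarrow> real"
  assumes "U differentiable (at x)"
  obtains L \<delta> where "L \<ge> 0" "\<delta> > 0"
    "\<And>z. z \<noteq> x \<Longrightarrow> dist x z < \<delta> \<Longrightarrow> \<bar>(U x - U z) / norm (x - z) powr N\<bar> \<le> L * dist x z powr (1 - N)"
proof -
  obtain L \<delta> where L: "L \<ge> 0" "\<delta> > 0" "\<And>z. dist x z < \<delta> \<Longrightarrow> norm (U x - U z) \<le> L * dist x z"
    using differentiable_imp_local_lipschitz[OF assms] by blast
  show ?thesis
  proof (rule that[OF L(1,2)])
    fix z assume z: "z \<noteq> x" "dist x z < \<delta>"
    have "\<bar>(U x - U z) / norm (x - z) powr N\<bar> \<le> L * dist x z / dist x z powr N"
      using L(3)[OF z(2)] by (simp add: dist_norm divide_right_mono)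
    also have "\<dots> = L * dist x z powr (1 - N)" using z by (simp add: powr_diff)
    finally show "\<bar>(U x - U z) / norm (x - z) powr N\<bar> \<le> L * dist x z powr (1 - N)" .
  qed
qed

lemma differentiable_divide_powr:
  fixes t r :: real
  assumes "t > 0" "r > 0"
  shows "(\<lambda>t. (r / t) powr p) differentiable (at t)"
  unfolding differentiable_def has_field_derivative_def[symmetric]
  using assms by (auto intro!: exI derivative_eq_intros simp: has_field_derivative_def[symmetric])

lemma differentiable_norm_powr:
  fixes x :: "real^'n::finite"
  assumes "x \<noteq> 0" "r > 0"
  shows "(\<lambda>z. (r / norm z) powr p) differentiable (at x)"
  using differentiable_chain_at[OF differentiable_norm_at differentiable_divide_powr] assms
  by (simp add: o_def)

text \<open>The integral over the complement of a small ball changes sign under the inversion in the sphere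
  through \<open>x\<close>, which moves the ball only to second order; so it tends to \<open>0\<close>.\<close>

lemma
  fixes x :: "real^'n::finite" and \<alpha> r :: real
  assumes \<alpha>: "0 < \<alpha>" "\<alpha> < 2" and x: "x \<noteq> 0" and r: "r > 0"
  defines "h \<equiv> \<lambda>z. ((r / norm z) powr (real CARD('n) - \<alpha>) - (r / norm x) powr (real CARD('n) - \<alpha>)) /
      norm (x - z) powr (real CARD('n) + \<alpha>)"
  shows set_integrable_riesz_kernel: "\<And>\<epsilon>. \<epsilon> > 0 \<Longrightarrow> set_integrable lborel (- cball x \<epsilon>) h"
    and riesz_kernel_harmonic: "((\<lambda>\<epsilon>. LINT z:- cball x \<epsilon>|lborel. h z) \<longlongrightarrow> 0) (at_right 0)"
proof -
  let ?N = "real CARD('n) + \<alpha>" and ?p = "real CARD('n) - \<alpha>"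
  define a where "a = norm x"
  define \<phi> where "\<phi> z = (a / norm z) powr ?p" for z :: "real^'n"
  define g where "g z = (\<phi> x - \<phi> z) / norm (x - z) powr ?N" for z
  have a: "a > 0" using x by (simp add: a_def)
  have \<phi>x: "\<phi> x = 1" using a by (simp add: \<phi>_def flip: a_def)
  have ix: "inversion a x = x" using x by (simp add: inversion_def a_def)
  have \<phi>_inv: "\<phi> z * \<phi> (inversion a z) = 1" if "z \<noteq> 0" for z
    using that a by (simp add: \<phi>_def norm_inversion power2_eq_square flip: powr_mult)
  have [measurable]: "\<phi> \<in> borel_measurable borel" unfolding \<phi>_def by measurable
  \<comment> \<open>The factor \<open>\<phi>\<close> is the Kelvin transform of the constant 1, so
    its integrability against the kernel, including the singularity at the origin, is that of the
    plain kernel moved by the inversion.\<close>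
  have int_\<phi>: "set_integrable lborel (- cball x \<epsilon>) (\<lambda>z. \<phi> z * 1 / norm (x - z) powr ?N)" if "0 < \<epsilon>" "\<epsilon> < a" for \<epsilon>
  proof -
    have "set_integrable lborel (inversion a -` (- cball x \<epsilon>)) (\<lambda>y. 1 / norm (inversion a x - y) powr ?N)"
    proof (rule set_integrable_subset)
      show "set_integrable lborel (- cball (inversion a x) (\<epsilon> * norm (inversion a x) / (norm x + \<epsilon>)))
          (\<lambda>y. 1 / norm (inversion a x - y) powr ?N)"
        using that x a \<alpha> by (intro integrable_norm_powr_outside_ball) (auto simp: add_pos_pos)
    qed (use that x a inversion_outside_ball(2)[of x a \<epsilon>] in \<open>auto simp: a_def inversion_vimage_borel\<close>)
    thus ?thesis
      using set_integrable_kernel_inversion[OF x a, of "- cball x \<epsilon>" "\<lambda>_. 1" \<alpha>] by (simp add: \<phi>_def)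
  qed
  have int_g: "set_integrable lborel (- cball x \<epsilon>) g" if "0 < \<epsilon>" for \<epsilon>
  proof (rule set_integrable_subset)
    define \<epsilon>' where "\<epsilon>' = min \<epsilon> (a / 2)"
    have \<epsilon>': "0 < \<epsilon>'" "\<epsilon>' < a" "\<epsilon>' \<le> \<epsilon>" using that a by (auto simp: \<epsilon>'_def)
    have "set_integrable lborel (- cball x \<epsilon>') (\<lambda>z. 1 / norm (x - z) powr ?N - \<phi> z * 1 / norm (x - z) powr ?N)"
      by (intro set_integral_diff integrable_norm_powr_outside_ball int_\<phi> \<epsilon>' \<alpha>)
    thus "set_integrable lborel (- cball x \<epsilon>') g" by (simp add: g_def[abs_def] \<phi>x diff_divide_distrib)
    show "- cball x \<epsilon> \<subseteq> - cball x \<epsilon>'" using \<epsilon>' by auto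
  qed simp
  have h_eq: "h z = (- ((r / a) powr ?p)) * g z" for z
  proof -
    have "(r / norm y) powr ?p = (r / a) powr ?p * \<phi> y" for y :: "real^'n"
      using a r by (simp add: \<phi>_def powr_divide)
    thus ?thesis by (simp add: h_def g_def algebra_simps diff_divide_distrib)
  qed
  show "set_integrable lborel (- cball x \<epsilon>) h" if "\<epsilon> > 0" for \<epsilon>
    unfolding h_eq using int_g[OF that] by (intro set_integrable_mult_right)
  have inv_g: "(LINT z:inversion a -` (- cball x \<epsilon>)|lborel. g z) = - (LINT z:- cball x \<epsilon>|lborel. g z)" for \<epsilon>
  proof -
    have "(LINT y:inversion a -` (- cball x \<epsilon>)|lborel. (\<phi> x - \<phi> y) / norm (inversion a x - y) powr ?N) =
      (norm x / a) powr ?N * (LINT z:- cball x \<epsilon>|lborel. (a / norm z) powr ?p * (\<phi> x - \<phi> (inversion a z)) / norm (x - z) powr ?N)"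
      by (rule set_integral_kernel_inversion[OF x a]) auto
    also have "(norm x / a) powr ?N = 1" using a by (simp flip: a_def)
    also have "1 * (LINT z:- cball x \<epsilon>|lborel. (a / norm z) powr ?p * (\<phi> x - \<phi> (inversion a z)) / norm (x - z) powr ?N)
       = (LINT z:- cball x \<epsilon>|lborel. - g z)"
      unfolding mult_1 set_lebesgue_integral_def
    proof (rule integral_cong_AE)
      have "AE z in lborel. z \<noteq> (0::real^'n)" by (rule AE_lborel_singleton)
      thus "AE z in lborel. indicator (- cball x \<epsilon>) z *\<^sub>R ((a / norm z) powr ?p * (\<phi> x - \<phi> (inversion a z)) / norm (x - z) powr ?N)
         = indicator (- cball x \<epsilon>) z *\<^sub>R (- g z)"
      proof eventually_elim
        case (elim z)
        have "(a / norm z) powr ?p * (\<phi> x - \<phi> (inversion a z)) = - (\<phi> x - \<phi> z)"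
          using \<phi>_inv[OF elim] unfolding \<phi>_def[symmetric] by (simp add: \<phi>x right_diff_distrib)
        thus ?case by (simp only: g_def minus_divide_left)
      qed
    qed (auto simp: g_def)
    also have "\<dots> = - (LINT z:- cball x \<epsilon>|lborel. g z)" by (simp add: set_lebesgue_integral_def)
    finally show ?thesis by (simp add: ix g_def)
  qed
  obtain L \<delta> where L: "L \<ge> 0" "\<delta> > 0" "\<And>z. z \<noteq> x \<Longrightarrow> dist x z < \<delta> \<Longrightarrow> \<bar>g z\<bar> \<le> L * dist x z powr (1 - ?N)"
    unfolding g_def using differentiable_kernel_bound[of \<phi> x ?N] differentiable_norm_powr[OF x a]
    unfolding \<phi>_def by metis
  have "((\<lambda>\<epsilon>. (LINT z:inversion a -` (- cball x \<epsilon>)|lborel. g z) - (LINT z:- cball x (\<epsilon> * (a / a))|lborel. g z)) \<longlongrightarrow> 0) (at_right 0)"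
  proof (rule set_integral_annulus_limit[OF \<alpha> a a _ int_g L])
    show "inversion a -` (- cball x \<epsilon>) \<in> sets borel \<and> - cball x (\<epsilon> * a / (a - \<epsilon>)) \<subseteq> inversion a -` (- cball x \<epsilon>) \<and>
       inversion a -` (- cball x \<epsilon>) \<subseteq> - cball x (\<epsilon> * a / (a + \<epsilon>))" if "0 < \<epsilon>" "\<epsilon> < a" for \<epsilon>
      using inversion_outside_ball[OF x a that(1)] that
      by (auto simp: ix inversion_vimage_borel a_def[symmetric] simp del: vimage_Compl)
  qed
  \<comment> \<open>By \<open>inv_g\<close> the integral over the preimage is minus the one over the
    complement of the ball, so their difference is - 2 times the latter.\<close>
  hence "((\<lambda>\<epsilon>. - 2 * (LINT z:- cball x \<epsilon>|lborel. g z)) \<longlongrightarrow> 0) (at_right 0)"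
    using a by (simp add: inv_g)
  hence "((\<lambda>\<epsilon>. ((r / a) powr ?p / 2) * (- 2 * (LINT z:- cball x \<epsilon>|lborel. g z))) \<longlongrightarrow> ((r / a) powr ?p / 2) * 0) (at_right 0)"
    by (intro tendsto_intros)
  thus "((\<lambda>\<epsilon>. LINT z:- cball x \<epsilon>|lborel. h z) \<longlongrightarrow> 0) (at_right 0)"
    unfolding h_eq set_integral_mult_right by (simp add: mult_ac)
qed

text \<open>The difference quotient splits into three parts. \<open>g1\<close> belongs to the
  principal value at \<open>x\<close>; \<open>g2\<close> is pulled back from the image of
  \<open>x\<close>, where it is truncated by the preimage of a ball; \<open>g3\<close> carries the
  variation of the Kelvin factor and tends to 0, since that factor is \<alpha>-harmonic.\<close>

lemma
  fixes x :: "real^'n::finite" and \<alpha> r :: real and U :: "real^'n \<Rightarrow> real"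
  assumes \<alpha>: "0 < \<alpha>" "\<alpha> < 2" and x: "x \<noteq> 0" and r: "r > 0"
    and U: "U \<in> borel_measurable borel" "U differentiable (at (inversion r x))"
    and I: "frac_pv \<alpha> U x I" and J: "frac_pv \<alpha> U (inversion r x) J"
  defines "h \<equiv> \<lambda>z. (kelvin_diff \<alpha> r U x - kelvin_diff \<alpha> r U z) / norm (x - z) powr (real CARD('n) + \<alpha>)"
  shows set_integrable_kelvin_diff: "\<And>\<epsilon>. \<epsilon> > 0 \<Longrightarrow> set_integrable lborel (- cball x \<epsilon>) h"
    and frac_pv_kelvin_diff:
      "((\<lambda>\<epsilon>. LINT z:- cball x \<epsilon>|lborel. h z) \<longlongrightarrow> (r / norm x) powr (real CARD('n) + \<alpha>) * J - I) (at_right 0)"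
proof -
  let ?N = "real CARD('n) + \<alpha>" and ?p = "real CARD('n) - \<alpha>"
  let ?K = "\<lambda>z. norm (x - z) powr ?N"
  note U(1) [measurable]
  define x' where "x' = inversion r x"
  define a where "a = norm x"
  define b where "b = norm x'"
  have a: "a > 0" and b: "b > 0" using x r by (auto simp: a_def b_def x'_def)
  define g1 where "g1 z = (U x - U z) / ?K z" for z
  define g2 where "g2 z = (r / norm z) powr ?p * (U x' - U (inversion r z)) / ?K z" for z
  define g3 where "g3 z = ((r / norm z) powr ?p - (r / norm x) powr ?p) / ?K z" for z
  define f where "f y = (U x' - U y) / norm (x' - y) powr ?N" for y
  have h_eq: "h z = g2 z - g1 z - U x' * g3 z" for z
    by (simp add: h_def g1_def g2_def g3_def kelvin_diff_def x'_def algebra_simps diff_divide_distrib add_divide_distrib)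
  have int1: "set_integrable lborel (- cball x \<epsilon>) g1" if "\<epsilon> > 0" for \<epsilon>
    using I that by (simp add: frac_pv_def g1_def[abs_def])
  have intf: "set_integrable lborel (- cball x' \<epsilon>) f" if "\<epsilon> > 0" for \<epsilon>
    using J that by (simp add: frac_pv_def f_def[abs_def] x'_def)
  have limf: "((\<lambda>\<epsilon>. LINT z:- cball x' \<epsilon>|lborel. f z) \<longlongrightarrow> J) (at_right 0)"
    using J by (simp add: frac_pv_def f_def x'_def)
  have int3: "set_integrable lborel (- cball x \<epsilon>) g3" if "\<epsilon> > 0" for \<epsilon>
    unfolding g3_def by (rule set_integrable_riesz_kernel[OF \<alpha> x r that])
  have sets: "inversion r -` (- cball x \<epsilon>) \<in> sets borel \<and> - cball x' (\<epsilon> * b / (a - \<epsilon>)) \<subseteq> inversion r -` (- cball x \<epsilon>) \<and>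
       inversion r -` (- cball x \<epsilon>) \<subseteq> - cball x' (\<epsilon> * b / (a + \<epsilon>))" if "0 < \<epsilon>" "\<epsilon> < a" for \<epsilon>
    using inversion_outside_ball[OF x r that(1)] that
    by (auto simp: inversion_vimage_borel a_def[symmetric] b_def[symmetric] x'_def[symmetric] simp del: vimage_Compl)
  have int2': "set_integrable lborel (- cball x \<epsilon>) g2" if "0 < \<epsilon>" "\<epsilon> < a" for \<epsilon>
  proof -
    have "set_integrable lborel (inversion r -` (- cball x \<epsilon>)) f"
      by (rule set_integrable_subset[OF intf[of "\<epsilon> * b / (a + \<epsilon>)"]])
         (use sets[OF that] that a b in \<open>auto simp: add_pos_pos\<close>)
    thus ?thesis unfolding f_def x'_def
      by (subst (asm) set_integrable_kernel_inversion[OF x r]) (auto simp: g2_def[abs_def] x'_def)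
  qed
  have int2: "set_integrable lborel (- cball x \<epsilon>) g2" if "0 < \<epsilon>" for \<epsilon>
    by (rule set_integrable_subset[OF int2'[of "min \<epsilon> (a / 2)"]]) (use that a in auto)
  show "set_integrable lborel (- cball x \<epsilon>) h" if "\<epsilon> > 0" for \<epsilon>
    unfolding h_eq using int1[OF that] int2[OF that] int3[OF that] by (intro set_integral_diff) auto
  obtain L \<delta> where L: "L \<ge> 0" "\<delta> > 0" "\<And>z. z \<noteq> x' \<Longrightarrow> dist x' z < \<delta> \<Longrightarrow> \<bar>f z\<bar> \<le> L * dist x' z powr (1 - ?N)"
    unfolding f_def using differentiable_kernel_bound[of U x' ?N] U(2) unfolding x'_def by metis
  have "((\<lambda>\<epsilon>. (LINT z:inversion r -` (- cball x \<epsilon>)|lborel. f z) - (LINT z:- cball x' (\<epsilon> * (b / a))|lborel. f z)) \<longlongrightarrow> 0) (at_right 0)"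
    by (rule set_integral_annulus_limit[OF \<alpha> a b sets intf L])
  moreover have "((\<lambda>\<epsilon>. LINT z:- cball x' (\<epsilon> * (b / a))|lborel. f z) \<longlongrightarrow> J) (at_right 0)"
  proof (rule filterlim_compose[OF limf])
    have "((\<lambda>\<epsilon>. \<epsilon> * (b / a)) \<longlongrightarrow> 0 * (b / a)) (at_right 0)" by (intro tendsto_intros)
    moreover have "eventually (\<lambda>\<epsilon>. \<epsilon> * (b / a) \<in> {0<..} \<and> \<epsilon> * (b / a) \<noteq> 0) (at_right 0)"
      using eventually_at_right_less[of "0::real"] by eventually_elim (use a b in auto)
    ultimately show "filterlim (\<lambda>\<epsilon>. \<epsilon> * (b / a)) (at_right 0) (at_right 0)"
      by (simp add: filterlim_at eventually_conj_iff)
  qed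
  ultimately have "((\<lambda>\<epsilon>. ((LINT z:inversion r -` (- cball x \<epsilon>)|lborel. f z) - (LINT z:- cball x' (\<epsilon> * (b / a))|lborel. f z))
     + (LINT z:- cball x' (\<epsilon> * (b / a))|lborel. f z)) \<longlongrightarrow> 0 + J) (at_right 0)"
    by (rule tendsto_add)
  hence lim_inv: "((\<lambda>\<epsilon>. LINT z:inversion r -` (- cball x \<epsilon>)|lborel. f z) \<longlongrightarrow> J) (at_right 0)" by simp
  have LINT2: "(LINT z:- cball x \<epsilon>|lborel. g2 z) = (r / a) powr ?N * (LINT z:inversion r -` (- cball x \<epsilon>)|lborel. f z)" for \<epsilon>
  proof -
    have "(r / a) powr ?N * (a / r) powr ?N = 1" using a r by (simp add: powr_divide)
    moreover have "(LINT z:inversion r -` (- cball x \<epsilon>)|lborel. f z) = (a / r) powr ?N * (LINT z:- cball x \<epsilon>|lborel. g2 z)"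
      unfolding f_def x'_def
      by (subst set_integral_kernel_inversion[OF x r]) (auto simp: g2_def[abs_def] x'_def a_def)
    ultimately show ?thesis by (metis mult.assoc mult_1)
  qed
  have "((\<lambda>\<epsilon>. (LINT z:- cball x \<epsilon>|lborel. g2 z) - (LINT z:- cball x \<epsilon>|lborel. g1 z) -
     U x' * (LINT z:- cball x \<epsilon>|lborel. g3 z)) \<longlongrightarrow> (r / a) powr ?N * J - I - U x' * 0) (at_right 0)"
    unfolding LINT2 using I
    by (intro tendsto_intros lim_inv riesz_kernel_harmonic[OF \<alpha> x r, folded g3_def]) (simp add: frac_pv_def g1_def)
  moreover have "eventually (\<lambda>\<epsilon>. (LINT z:- cball x \<epsilon>|lborel. g2 z) - (LINT z:- cball x \<epsilon>|lborel. g1 z) -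
     U x' * (LINT z:- cball x \<epsilon>|lborel. g3 z) = (LINT z:- cball x \<epsilon>|lborel. h z)) (at_right 0)"
    using eventually_at_right_less[of "0::real"]
  proof eventually_elim
    case (elim \<epsilon>)
    note i = int1[OF elim] int2[OF elim] int3[OF elim]
    show ?case unfolding h_eq using i
      by (subst set_integral_diff(2), (intro set_integral_diff)?, simp_all)+
  qed
  ultimately show "((\<lambda>\<epsilon>. LINT z:- cball x \<epsilon>|lborel. h z) \<longlongrightarrow> (r / norm x) powr ?N * J - I) (at_right 0)"
    using Lim_transform_eventually by (fastforce simp: a_def)
qed

text \<open>For two points in the ball the last term is nonnegative, so after rescaling the image of
  \<open>x\<close> is at least as far from \<open>z\<close> as \<open>x\<close> is, and the
  reflected kernel is the smaller one. The term also measures the gap between the kernels.\<close>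

lemma norm_inversion_diff_sq:
  fixes x z :: "'a::real_inner"
  assumes "x \<noteq> 0" "r \<noteq> 0"
  shows "(norm x / r * norm (inversion r x - z))\<^sup>2 =
    (norm (x - z))\<^sup>2 + (r\<^sup>2 - (norm x)\<^sup>2) * (r\<^sup>2 - (norm z)\<^sup>2) / r\<^sup>2"
proof -
  have "(norm (a *\<^sub>R x - z))\<^sup>2 = a\<^sup>2 * (norm x)\<^sup>2 - 2 * a * (x \<bullet> z) + (norm z)\<^sup>2" for a
    unfolding power2_norm_eq_inner by (simp add: inner_diff inner_commute power2_eq_square)
  from this[of "r\<^sup>2 / (norm x)\<^sup>2"]
  have 1: "(norm (inversion r x - z))\<^sup>2 =
      (r\<^sup>2 / (norm x)\<^sup>2)\<^sup>2 * (norm x)\<^sup>2 - 2 * (r\<^sup>2 / (norm x)\<^sup>2) * (x \<bullet> z) + (norm z)\<^sup>2"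
    by (simp add: inversion_def)
  have 2: "(norm (x - z))\<^sup>2 = (norm x)\<^sup>2 - 2 * (x \<bullet> z) + (norm z)\<^sup>2"
    by (simp add: power2_norm_eq_inner inner_diff inner_commute)
  show ?thesis
    unfolding power_mult_distrib power_divide 1 2 using assms by (simp add: field_simps power2_eq_square)
qed

text \<open>The complement of the ball is folded into the ball by the inversion. By antisymmetry the two parts
  combine into an integral against the difference of two kernels, which is nonnegative.\<close>

lemma antisymmetric_pv_le:
  fixes x :: "real^'n::finite" and w :: "real^'n \<Rightarrow> real" and \<alpha> r k V :: real
  defines "K \<equiv> \<lambda>y z. norm (y - z) powr (real CARD('n) + \<alpha>)"
  assumes \<alpha>: "0 < \<alpha>" and x: "x \<noteq> 0" "norm x < r"
    and w [measurable]: "w \<in> borel_measurable borel" and cont: "continuous_on (- {0}) w"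
    and anti: "\<And>z. z \<noteq> 0 \<Longrightarrow> (r / norm z) powr (real CARD('n) - \<alpha>) * w (inversion r z) = - w z"
    and min: "\<And>z. z \<noteq> 0 \<Longrightarrow> norm z \<le> r \<Longrightarrow> w x \<le> w z" and wx: "w x \<le> 0"
    and E: "E \<in> fmeasurable lborel" "E \<subseteq> ball 0 r" and "k \<ge> 0"
    and k: "\<And>z. z \<in> E \<Longrightarrow> z \<noteq> 0 \<Longrightarrow> z \<noteq> x \<Longrightarrow>
       k \<le> (w z - w x) * (1 / K x z - (r / norm x) powr (real CARD('n) + \<alpha>) / K (inversion r x) z)"
    and int: "\<And>\<epsilon>. \<epsilon> > 0 \<Longrightarrow> set_integrable lborel (- cball x \<epsilon>) (\<lambda>z. (w x - w z) / K x z)"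
    and lim: "((\<lambda>\<epsilon>. LINT z:- cball x \<epsilon>|lborel. (w x - w z) / K x z) \<longlongrightarrow> V) (at_right 0)"
  shows "V \<le> w x * (LINT z:- ball 0 r|lborel. 1 / K x z) - k * measure lborel E"
proof -
  let ?N = "real CARD('n) + \<alpha>" and ?p = "real CARD('n) - \<alpha>"
  define x' where "x' = inversion r x"
  define \<phi> where "\<phi> z = (r / norm z) powr ?p" for z :: "real^'n"
  define K2 where "K2 z = (r / norm x) powr ?N / K x' z" for z
  define h where "h z = (w x - w z) / K x z" for z
  \<comment> \<open>The contribution of the exterior after folding: antisymmetry replaces the Kelvin
    factor times \<open>w\<close> at the inverted point by \<open>- w z\<close>.\<close>
  define q where "q z = (\<phi> z * w x + w z) * K2 z" for z
  define S where "S = cball (0::real^'n) r - {0}"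
  define A where "A = (LINT z:- ball 0 r|lborel. 1 / K x z)"
  have r: "r > 0" using x by (smt (verit) norm_ge_zero)
  have x': "x' \<noteq> 0" "inversion r x' = x" and nx': "norm x' = r\<^sup>2 / norm x"
    using x r by (auto simp: x'_def norm_inversion)
  have "norm x' > r"
  proof -
    have "r * norm x < r * r" using x r by simp
    thus ?thesis using x by (simp add: nx' power2_eq_square field_simps)
  qed
  have [measurable]: "K y \<in> borel_measurable borel" for y unfolding K_def by measurable
  have [measurable]: "\<phi> \<in> borel_measurable borel" unfolding \<phi>_def by measurable
  have [measurable]: "E \<in> sets borel" using E by auto
  have [measurable]: "S \<in> sets borel" by (simp add: S_def)
  have K2_nonneg: "K2 z \<ge> 0" for z by (simp add: K2_def K_def)
  have vS: "inversion r -` S = - ball 0 r"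
  proof (rule set_eqI)
    fix y :: "real^'n"
    show "y \<in> inversion r -` S \<longleftrightarrow> y \<in> - ball 0 r"
    proof (cases "y = 0")
      case False
      have "r\<^sup>2 / norm y \<le> r \<longleftrightarrow> r \<le> norm y"
        using False r by (simp add: power2_eq_square field_simps)
      thus ?thesis using False r by (simp add: S_def norm_inversion not_less)
    qed (use r in \<open>simp add: S_def\<close>)
  qed
  \<comment> \<open>The change of variables is taken at \<open>x'\<close>, whose inversion is
    \<open>x\<close>; the preimage of the punctured closed ball \<open>S\<close> is then the
    exterior domain.\<close>
  have CV: "set_integrable lborel (- ball 0 r) (\<lambda>y. G y / K x y) \<longleftrightarrow>
        set_integrable lborel S (\<lambda>z. \<phi> z * G (inversion r z) * K2 z)"
      "(LINT y:- ball 0 r|lborel. G y / K x y) = (LINT z:S|lborel. \<phi> z * G (inversion r z) * K2 z)"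
    if [measurable]: "G \<in> borel_measurable borel" for G
  proof -
    have c: "(norm x' / r) powr ?N = (r / norm x) powr ?N"
      using r by (simp add: nx' power2_eq_square)
    have c0: "(r / norm x) powr ?N \<noteq> 0" using r x by simp
    have e: "\<phi> z * G (inversion r z) * K2 z = (r / norm x) powr ?N * (\<phi> z * G (inversion r z) / K x' z)" for z
      by (simp add: K2_def)
    show "set_integrable lborel (- ball 0 r) (\<lambda>y. G y / K x y) \<longleftrightarrow>
        set_integrable lborel S (\<lambda>z. \<phi> z * G (inversion r z) * K2 z)"
      using set_integrable_kernel_inversion[OF x'(1) r, of S G \<alpha>] c0
      unfolding e unfolding vS x'(2) K_def \<phi>_def
      unfolding set_integrable_def real_scaleR_def mult.left_commute[of _ "(r / norm x) powr ?N"] integrable_mult_left_iff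
      by simp
    show "(LINT y:- ball 0 r|lborel. G y / K x y) = (LINT z:S|lborel. \<phi> z * G (inversion r z) * K2 z)"
      unfolding e set_integral_mult_right
      using set_integral_kernel_inversion[OF x'(1) r, of S G \<alpha>]
      unfolding vS x'(2) K_def \<phi>_def c by simp
  qed
  have intA: "set_integrable lborel (- ball 0 r) (\<lambda>y. 1 / K x y)" unfolding K_def
  proof (rule set_integrable_subset)
    show "set_integrable lborel (- cball x ((r - norm x) / 2)) (\<lambda>y. 1 / norm (x - y) powr ?N)"
      using x \<alpha> by (intro integrable_norm_powr_outside_ball) auto
    show "- ball 0 r \<subseteq> - cball x ((r - norm x) / 2)"
    proof (rule subsetI)
      fix y :: "real^'n" assume "y \<in> - ball 0 r"
      moreover have "norm y \<le> norm x + dist x y" by (metis dist_0_norm dist_triangle)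
      ultimately show "y \<in> - cball x ((r - norm x) / 2)" using x by auto
    qed
  qed simp
  have intS1: "set_integrable lborel S (\<lambda>z. \<phi> z * K2 z)" and A: "A = (LINT z:S|lborel. \<phi> z * K2 z)"
    using CV[of "\<lambda>_. 1"] intA by (simp_all add: A_def)
  have q_eq: "\<phi> z * (w x - w (inversion r z)) * K2 z = q z" if "z \<in> S" for z
    using anti[of z] that by (simp add: q_def S_def \<phi>_def right_diff_distrib)
  define \<delta> where "\<delta> = min (norm x) (r - norm x) / 2"
  have \<delta>: "\<delta> > 0" using x by (simp add: \<delta>_def)
  have D_sub: "z \<noteq> 0" "norm z < r" "z \<noteq> x'" if "z \<in> cball x \<delta>" for z
  proof -
    have "norm z \<le> norm x + dist x z" "norm x \<le> norm z + dist x z"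
      by (metis dist_0_norm dist_triangle) (metis dist_0_norm dist_commute dist_triangle)
    thus "z \<noteq> 0" "norm z < r" using that x \<delta> by (auto simp: \<delta>_def)
    with \<open>norm x' > r\<close> show "z \<noteq> x'" by auto
  qed
  \<comment> \<open>In the small removed ball the folded integrand has no interior counterpart to
    offset it. There it exceeds its main term by at most \<open>C\<close>, an error of
    \<open>C\<close> times a vanishing volume.\<close>
  have "bounded ((\<lambda>z. (w z - w x) * K2 z) ` cball x \<delta>)"
  proof (intro compact_imp_bounded compact_continuous_image continuous_intros)
    show "continuous_on (cball x \<delta>) w" by (rule continuous_on_subset[OF cont]) (use D_sub(1)[of 0] in auto)
    show "continuous_on (cball x \<delta>) K2" unfolding K2_def K_def using D_sub(3)[of x']
      by (intro continuous_intros) auto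
  qed auto
  then obtain C where C: "C > 0" "\<And>z. z \<in> cball x \<delta> \<Longrightarrow> (w z - w x) * K2 z \<le> C"
    unfolding bounded_pos by (fastforce simp: abs_le_iff)
  have K12: "K2 z \<le> 1 / K x z" if "norm z \<le> r" "z \<noteq> x" for z
  proof -
    have "(norm (x - z))\<^sup>2 \<le> (norm x / r * norm (x' - z))\<^sup>2"
      unfolding x'_def using that x r by (subst norm_inversion_diff_sq) (auto intro!: mult_nonneg_nonneg power_mono)
    hence "norm (x - z) \<le> norm x / r * norm (x' - z)"
      by (rule power2_le_imp_le) (use r in auto)
    hence "norm (x - z) powr ?N \<le> (norm x / r * norm (x' - z)) powr ?N"
      using \<alpha> by (intro powr_mono2) auto
    also have "\<dots> = (norm x / r) powr ?N * K x' z"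
      unfolding K_def by (rule powr_mult)
    finally have le: "K x z \<le> (norm x / r) powr ?N * K x' z" by (simp add: K_def)
    have "K2 z = 1 / ((norm x / r) powr ?N * K x' z)"
      using r x by (simp add: K2_def powr_divide)
    also have "\<dots> \<le> 1 / K x z" using le that by (intro divide_left_mono) (auto simp: K_def intro!: mult_pos_pos)
    finally show ?thesis .
  qed
  have cb: "cball x \<epsilon> \<in> fmeasurable lborel" for \<epsilon>
    by (rule fmeasurableI) (use emeasure_lborel_cball_finite[of x \<epsilon>] in auto)
  have bound: "(LINT z:- cball x \<epsilon>|lborel. h z) \<le> w x * A - k * measure lborel E + (C + k) * measure lborel (cball x \<epsilon>)"
    if \<epsilon>: "0 < \<epsilon>" "\<epsilon> < \<delta>" for \<epsilon>
  proof -
    let ?D = "cball x \<epsilon>"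
    have D: "z \<noteq> 0" "norm z < r" if "z \<in> ?D" for z using that \<epsilon> D_sub[of z] by auto
    have "x \<in> ?D" using \<epsilon> by simp
    have split: "- ?D = (ball 0 r - ?D) \<union> (- ball 0 r)" using D by auto
    have int1: "set_integrable lborel (ball 0 r - ?D) h"
      by (rule set_integrable_subset[OF int[OF \<epsilon>(1)], folded h_def]) auto
    have int2: "set_integrable lborel (- ball 0 r) h"
      by (rule set_integrable_subset[OF int[OF \<epsilon>(1)], folded h_def]) (use D in auto)
    have "set_integrable lborel S (\<lambda>z. \<phi> z * (w x - w (inversion r z)) * K2 z)"
      using int2 CV(1)[of "\<lambda>y. w x - w y"] by (simp add: h_def[abs_def])
    hence intq: "set_integrable lborel S q"
      unfolding set_integrable_def by (rule Bochner_Integration.integrable_cong[THEN iffD1, rotated 2])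
        (auto simp: q_eq indicator_def)
    have "(LINT z:- ?D|lborel. h z) = (LINT z:ball 0 r - ?D|lborel. h z) + (LINT z:- ball 0 r|lborel. h z)"
      unfolding split by (intro set_integral_Un int1 int2) auto
    also have "(LINT z:- ball 0 r|lborel. h z) = (LINT z:S|lborel. \<phi> z * (w x - w (inversion r z)) * K2 z)"
      unfolding h_def by (rule CV(2)) measurable
    also have "\<dots> = (LINT z:S|lborel. q z)"
      by (rule set_lebesgue_integral_cong) (auto simp: q_eq)
    also have "(LINT z:ball 0 r - ?D|lborel. h z) + (LINT z:S|lborel. q z) =
        (\<integral>z. indicator (ball 0 r - ?D) z * h z + indicator S z * q z \<partial>lborel)"
      using int1 intq by (simp add: set_lebesgue_integral_def set_integrable_def)
    also have "\<dots> \<le> (\<integral>z. w x * (indicator S z * (\<phi> z * K2 z)) + C * indicator ?D z - k * indicator (E - ?D) z \<partial>lborel)"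
    proof (rule integral_mono_AE)
      have "E - ?D \<in> fmeasurable lborel" using E by (intro fmeasurable.Diff cb)
      thus "integrable lborel (\<lambda>z. w x * (indicator S z * (\<phi> z * K2 z)) + C * indicator ?D z - k * indicator (E - ?D) z)"
        using intS1 by (intro Bochner_Integration.integrable_diff Bochner_Integration.integrable_add integrable_mult_right)
          (use cb[of \<epsilon>] in \<open>auto simp: set_integrable_def fmeasurable_def\<close>)
      show "integrable lborel (\<lambda>z. indicator (ball 0 r - ?D) z * h z + indicator S z * q z)"
        using int1 intq by (simp add: set_integrable_def)
      have "AE z in lborel. z \<noteq> (0::real^'n)" by (rule AE_lborel_singleton)
      thus "AE z in lborel. indicator (ball 0 r - ?D) z * h z + indicator S z * q z \<le>
          w x * (indicator S z * (\<phi> z * K2 z)) + C * indicator ?D z - k * indicator (E - ?D) z"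
      proof eventually_elim
        case (elim z)
        have q': "q z = w x * (\<phi> z * K2 z) + (w z - w x) * K2 z + w x * K2 z"
          by (simp add: q_def algebra_simps)
        have neg: "w x * K2 z \<le> 0" using wx K2_nonneg by (simp add: mult_nonpos_nonneg)
        consider "norm z > r" | "norm z = r" | "norm z < r" "z \<in> ?D" | "norm z < r" "z \<notin> ?D" by linarith
        thus ?case
        proof cases
          case 1
          hence "z \<notin> ?D" "z \<notin> E" using D(2)[of z] E(2) by auto
          thus ?thesis using 1 by (simp add: S_def)
        next
          case 2
          have "inversion r z = z" using 2 r by (simp add: inversion_def)
          hence "w z = 0" using anti[OF elim] 2 r by simp
          moreover have "z \<notin> ?D" "z \<notin> E" using D[of z] 2 E by auto
          ultimately show ?thesis using 2 elim q' by (simp add: S_def)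
        next
          case 3
          thus ?thesis using q' neg C(2)[of z] elim \<epsilon> by (simp add: S_def)
        next
          case 4
          hence "z \<noteq> x" using \<open>x \<in> ?D\<close> by auto
          have le: "k * indicator (E - ?D) z \<le> (w z - w x) * (1 / K x z - K2 z)"
          proof (cases "z \<in> E")
            case True
            thus ?thesis using k[OF True elim \<open>z \<noteq> x\<close>] 4 by (simp add: K2_def x'_def)
          next
            case False
            thus ?thesis using min[OF elim] K12[of z] 4 \<open>z \<noteq> x\<close> by simp
          qed
          have "h z = - ((w z - w x) * (1 / K x z))" by (simp add: h_def minus_divide_left)
          with le neg have "h z + q z \<le> w x * (\<phi> z * K2 z) - k * indicator (E - ?D) z"
            unfolding q' by (simp only: right_diff_distrib)
          thus ?thesis using 4 elim by (simp add: S_def)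
        qed
      qed
    qed
    also have "\<dots> = w x * A + C * measure lborel ?D - k * measure lborel (E - ?D)"
    proof -
      have "E - ?D \<in> fmeasurable lborel" using E by (intro fmeasurable.Diff cb)
      thus ?thesis using intS1 cb[of \<epsilon>]
        by (simp add: A set_lebesgue_integral_def set_integrable_def fmeasurable_def)
    qed
    also have "\<dots> \<le> w x * A + C * measure lborel ?D - k * (measure lborel E - measure lborel ?D)"
    proof -
      have "measure lborel E \<le> measure lborel ((E - ?D) \<union> ?D)"
        using E by (intro measure_mono_fmeasurable fmeasurable.Un fmeasurable.Diff cb) auto
      also have "\<dots> \<le> measure lborel (E - ?D) + measure lborel ?D"
        using E by (intro measure_Un_le) auto
      finally show ?thesis using \<open>k \<ge> 0\<close> by (simp add: mult_left_mono)
    qed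
    finally show ?thesis by (simp add: algebra_simps)
  qed
  have "((\<lambda>\<epsilon>. w x * A - k * measure lborel E + (C + k) * (unit_ball_vol (real CARD('n)) * \<epsilon> ^ CARD('n)))
     \<longlongrightarrow> w x * A - k * measure lborel E + (C + k) * (unit_ball_vol (real CARD('n)) * 0)) (at_right 0)"
    using zero_power[OF zero_less_card_finite[where 'a = 'n], where 'a = real]
    by (auto intro!: tendsto_eq_intros)
  hence "((\<lambda>\<epsilon>. w x * A - k * measure lborel E + (C + k) * (unit_ball_vol (real CARD('n)) * \<epsilon> ^ CARD('n)))
     \<longlongrightarrow> w x * A - k * measure lborel E) (at_right 0)" by simp
  moreover have "eventually (\<lambda>\<epsilon>. 0 < \<epsilon> \<and> \<epsilon> < \<delta>) (at_right 0)"
    using \<delta> by (auto simp: eventually_at_right intro!: exI[of _ \<delta>])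
  hence "eventually (\<lambda>\<epsilon>. (LINT z:- cball x \<epsilon>|lborel. h z) \<le>
     w x * A - k * measure lborel E + (C + k) * (unit_ball_vol (real CARD('n)) * \<epsilon> ^ CARD('n))) (at_right 0)"
    by eventually_elim (use bound in \<open>auto simp: content_cball\<close>)
  ultimately show ?thesis
    using lim unfolding A_def[symmetric] h_def[symmetric]
    by (intro tendsto_le[OF trivial_limit_at_right_real])
qed

text \<open>Bernoulli's inequality with a real exponent: Young's inequality for
  \<open>t powr q\<close> and 1 with weights 1/q and 1 - 1/q bounds \<open>t\<close>, and
  multiplication by \<open>q\<close> gives the tangent line.\<close>

lemma powr_ge_tangent:
  fixes t q :: real
  assumes "t > 0" "q \<ge> 1"
  shows "1 + q * (t - 1) \<le> t powr q"
proof -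
  have "(t powr q) powr (1 / q) * 1 powr (1 - 1 / q) \<le> 1 / q * t powr q + (1 - 1 / q) * 1"
    using assms by (intro Youngs_inequality_0) auto
  hence "q * t \<le> q * (1 / q * t powr q + (1 - 1 / q) * 1)"
    using assms by (intro mult_left_mono) (auto simp: powr_powr)
  thus ?thesis using assms by (simp add: algebra_simps)
qed

section \<open>Translation and completion of the principal value\<close>

lemma set_integral_translate:
  fixes h :: "'a::euclidean_space \<Rightarrow> real"
  assumes [measurable]: "h \<in> borel_measurable borel"
  shows "set_integrable lborel (- cball (a + x) \<epsilon>) h \<longleftrightarrow> set_integrable lborel (- cball x \<epsilon>) (\<lambda>z. h (a + z))"
    and "(LINT z:- cball (a + x) \<epsilon>|lborel. h z) = (LINT z:- cball x \<epsilon>|lborel. h (a + z))"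
proof -
  let ?F = "\<lambda>z. indicator (- cball (a + x) \<epsilon>) z *\<^sub>R h z"
  have F: "?F \<in> borel_measurable borel" by measurable
  have eq: "?F (a + z) = indicator (- cball x \<epsilon>) z *\<^sub>R h (a + z)" for z
    by (simp add: indicator_def dist_norm)
  show "set_integrable lborel (- cball (a + x) \<epsilon>) h \<longleftrightarrow> set_integrable lborel (- cball x \<epsilon>) (\<lambda>z. h (a + z))"
    using integrable_distr_eq[of "(+) a" lborel borel ?F] F
    by (simp only: set_integrable_def lborel_distr_plus eq) simp
  show "(LINT z:- cball (a + x) \<epsilon>|lborel. h z) = (LINT z:- cball x \<epsilon>|lborel. h (a + z))"
    using integral_distr[of "(+) a" lborel borel ?F] F
    by (simp only: set_lebesgue_integral_def lborel_distr_plus eq) simp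
qed

lemma frac_pv_translate:
  fixes u :: "real^'n::finite \<Rightarrow> real"
  assumes [measurable]: "u \<in> borel_measurable borel" and "frac_pv \<alpha> u (a + x) I"
  shows "frac_pv \<alpha> (\<lambda>z. u (a + z) + \<eta>) x I"
  using assms(2) unfolding frac_pv_def by (simp add: set_integral_translate)

lemma frac_pv_of_has_frac_laplacian:
  fixes u :: "real^'n::finite \<Rightarrow> real"
  assumes [measurable]: "u \<in> borel_measurable borel" and "has_frac_laplacian c \<alpha> u x v" and "c > 0"
  shows "frac_pv \<alpha> u x (v / c)"
proof -
  let ?h = "\<lambda>z. (u x - u z) / norm (x - z) powr (real CARD('n) + \<alpha>)"
  have m: "(\<lambda>z. indicator (- cball x \<epsilon>) z *\<^sub>R ?h z) \<in> borel_measurable lborel" for \<epsilon>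
    by measurable
  show ?thesis
    using assms(2,3) unfolding has_frac_laplacian_def has_pv_integral_def frac_pv_def
      set_integrable_def set_lebesgue_integral_def
    by (auto simp only: integrable_completion[OF m] integral_completion[OF m]) auto
qed

lemma kelvin_diff_sphere:
  assumes "norm z = r" "r > 0"
  shows "kelvin_diff \<alpha> r U z = 0"
  using assms by (simp add: kelvin_diff_def inversion_def)

text \<open>The Kelvin factors at \<open>z\<close> and at its image are reciprocal, so the transform
  is an involution off the centre and swaps the two terms of the difference.\<close>

lemma kelvin_diff_antisymmetric:
  fixes z :: "real^'n::finite"
  assumes "z \<noteq> 0" "r > 0"
  shows "(r / norm z) powr (real CARD('n) - \<alpha>) * kelvin_diff \<alpha> r U (inversion r z) = - kelvin_diff \<alpha> r U z"
proof -
  let ?p = "real CARD('n) - \<alpha>"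
  have "(r / norm z) powr ?p * (r / norm (inversion r z)) powr ?p = 1"
    using assms by (simp add: norm_inversion power2_eq_square flip: powr_mult)
  thus ?thesis using assms by (simp add: kelvin_diff_def algebra_simps)
qed

lemma continuous_on_kelvin_diff:
  assumes "continuous_on UNIV U" "r \<noteq> 0"
  shows "continuous_on (- {0}) (kelvin_diff \<alpha> r U)"
proof -
  have "continuous_on (- {0}) (\<lambda>z. U (inversion r z))"
    by (rule continuous_on_compose2[OF assms(1) continuous_on_inversion]) auto
  thus ?thesis unfolding kelvin_diff_def[abs_def] using assms
    by (intro continuous_intros) (auto intro: continuous_on_subset)
qed

lemma borel_measurable_kelvin_diff [measurable]:
  assumes [measurable]: "U \<in> borel_measurable borel"
  shows "kelvin_diff \<alpha> r U \<in> borel_measurable borel"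
  unfolding kelvin_diff_def[abs_def] by measurable

text \<open>For n > \<alpha> and \<eta> > 0 the added term is nonnegative in the ball, vanishes on
  the sphere and blows up at the centre, which makes it a barrier against minima running into the
  centre.\<close>

lemma kelvin_diff_add_const:
  fixes z :: "real^'n::finite"
  shows "kelvin_diff \<alpha> r (\<lambda>y. U y + \<eta>) z =
    kelvin_diff \<alpha> r U z + \<eta> * ((r / norm z) powr (real CARD('n) - \<alpha>) - 1)"
  by (simp add: kelvin_diff_def algebra_simps)

text \<open>On the ray through \<open>x\<close>, the ball of radius \<open>d\<close> = r - |x| about
  the point \<open>y\<close> of norm r + d avoids the open ball of radius \<open>r\<close> and stays
  within 3d of \<open>x\<close>. There the kernel is at least (3d)^(-n-\<alpha>), and the volume of
  order d^n leaves d^(-\<alpha>).\<close>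

lemma exterior_kernel_lower_bound:
  fixes x :: "real^'n::finite"
  assumes "0 < \<alpha>" "x \<noteq> 0" "norm x < r"
  defines "N \<equiv> real CARD('n) + \<alpha>"
  shows "unit_ball_vol (real CARD('n)) * 3 powr (- N) * (r - norm x) powr (- \<alpha>)
    \<le> (LINT z:- ball 0 r|lborel. 1 / norm (x - z) powr N)"
proof -
  define d where "d = r - norm x"
  define y where "y = x + (2 * d / norm x) *\<^sub>R x"
  have d: "d > 0" using assms by (simp add: d_def)
  have ny: "norm y = norm x + 2 * d"
  proof -
    have "y = (1 + 2 * d / norm x) *\<^sub>R x" by (simp add: y_def algebra_simps)
    thus ?thesis using assms d by (simp add: distrib_right)
  qed
  have xy: "norm (x - y) = 2 * d" using assms d by (simp add: y_def)
  have B: "norm z \<ge> r" "norm (x - z) \<le> 3 * d" "z \<noteq> x" if "z \<in> cball y d" for z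
  proof -
    have "norm y \<le> norm z + dist y z" by (metis dist_0_norm dist_triangle dist_commute)
    thus 1: "norm z \<ge> r" using that ny by (simp add: d_def)
    have "dist x z \<le> dist x y + dist y z" by (rule dist_triangle)
    thus "norm (x - z) \<le> 3 * d" using that xy by (simp add: dist_norm)
    show "z \<noteq> x" using 1 assms by auto
  qed
  have cb: "cball y d \<in> fmeasurable lborel"
    by (rule fmeasurableI) (use emeasure_lborel_cball_finite[of y d] in auto)
  have int: "set_integrable lborel (- ball 0 r) (\<lambda>z. 1 / norm (x - z) powr N)"
  proof (rule set_integrable_subset)
    show "set_integrable lborel (- cball x (d / 2)) (\<lambda>z. 1 / norm (x - z) powr N)"
      unfolding N_def using d assms(1) by (intro integrable_norm_powr_outside_ball) auto
    show "- ball 0 r \<subseteq> - cball x (d / 2)"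
    proof (rule subsetI)
      fix z :: "real^'n" assume "z \<in> - ball 0 r"
      moreover have "norm z \<le> norm x + dist x z" by (metis dist_0_norm dist_triangle)
      ultimately show "z \<in> - cball x (d / 2)" using d by (auto simp: d_def)
    qed
  qed simp
  have "unit_ball_vol (real CARD('n)) * 3 powr (- N) * d powr (- \<alpha>) = (3 * d) powr (- N) * measure lborel (cball y d)"
  proof -
    have "d powr (- N) * d ^ CARD('n) = d powr (- N + real CARD('n))"
      using d by (simp only: powr_add powr_realpow)
    also have "- N + real CARD('n) = - \<alpha>" by (simp add: N_def)
    finally have "d powr (- \<alpha>) = d powr (- N) * d ^ CARD('n)" by simp
    moreover have "(3 * d) powr (- N) = 3 powr (- N) * d powr (- N)" by (rule powr_mult)
    ultimately show ?thesis using d by (simp add: content_cball)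
  qed
  also have "\<dots> = (\<integral>z. indicator (cball y d) z * (3 * d) powr (- N) \<partial>lborel)" by simp
  also have "\<dots> \<le> (LINT z:- ball 0 r|lborel. 1 / norm (x - z) powr N)"
    unfolding set_lebesgue_integral_def real_scaleR_def
  proof (rule integral_mono)
    show "integrable lborel (\<lambda>z. indicator (- ball 0 r) z * (1 / norm (x - z) powr N))"
      using int by (simp add: set_integrable_def)
    show "integrable lborel (\<lambda>z. indicator (cball y d) z * (3 * d) powr (- N))"
      using cb by (intro integrable_mult_left) (auto simp: fmeasurable_def)
    show "indicator (cball y d) z * (3 * d) powr (- N) \<le> indicator (- ball 0 r) z * (1 / norm (x - z) powr N)" for z
    proof (cases "z \<in> cball y d")
      case True
      have "(3 * d) powr (- N) \<le> norm (x - z) powr (- N)"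
        using B[OF True] assms(1) by (intro powr_mono2') (auto simp: N_def)
      also have "\<dots> = 1 / norm (x - z) powr N" by (rule powr_minus_divide)
      finally show ?thesis using True B(1)[OF True] by simp
    qed (simp add: indicator_def)
  qed
  finally show ?thesis by (simp add: d_def)
qed

section \<open>Behaviour of inversions at infinity\<close>

lemma norm_ratio_at_infinity:
  fixes a b :: "'a::real_normed_vector"
  shows "((\<lambda>x. norm (x - b) / norm (x - a)) \<longlongrightarrow> 1) at_infinity"
    and "filterlim (\<lambda>x. norm (x - a)) at_top at_infinity"
proof -
  have "filterlim (\<lambda>x. - a + x) at_infinity at_infinity"
    by (rule tendsto_add_filterlim_at_infinity[OF tendsto_const filterlim_ident])
  hence "filterlim (\<lambda>x. x - a) at_infinity at_infinity" by simp
  thus top: "filterlim (\<lambda>x. norm (x - a)) at_top at_infinity"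
    by (rule filterlim_at_infinity_imp_norm_at_top)
  have lim: "((\<lambda>x. norm (a - b) / norm (x - a)) \<longlongrightarrow> 0) at_infinity"
    by (intro tendsto_divide_0[OF tendsto_const] filterlim_at_top_imp_at_infinity top)
  have "eventually (\<lambda>x. norm (norm (x - b) / norm (x - a) - 1) \<le> norm (a - b) / norm (x - a)) at_infinity"
    using filterlim_at_top_dense[THEN iffD1, OF top, rule_format, of 0]
  proof eventually_elim
    case (elim x)
    have "\<bar>norm (x - b) - norm (x - a)\<bar> \<le> norm (a - b)"
      using norm_triangle_ineq3[of "x - b" "x - a"] by simp
    moreover have "norm (x - b) / norm (x - a) - 1 = (norm (x - b) - norm (x - a)) / norm (x - a)"
      using elim by (simp add: diff_divide_distrib)
    ultimately show ?case using elim by (simp add: divide_right_mono)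
  qed
  hence "((\<lambda>x. norm (x - b) / norm (x - a) - 1) \<longlongrightarrow> 0) at_infinity"
    by (rule Lim_null_comparison) (rule lim)
  thus "((\<lambda>x. norm (x - b) / norm (x - a)) \<longlongrightarrow> 1) at_infinity"
    by (rule LIM_zero_cancel)
qed

lemma inversion_tendsto_0_at_infinity:
  "((\<lambda>x. a + inversion r (x - b)) \<longlongrightarrow> a) (at_infinity :: 'a::euclidean_space filter)"
proof -
  have "((\<lambda>x. r\<^sup>2 / norm (x - b)) \<longlongrightarrow> 0) (at_infinity :: 'a::euclidean_space filter)"
    by (intro tendsto_divide_0[OF tendsto_const] filterlim_at_top_imp_at_infinity norm_ratio_at_infinity)
  hence "((\<lambda>x. inversion r (x - b)) \<longlongrightarrow> 0) (at_infinity :: 'a::euclidean_space filter)"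
    by (subst tendsto_norm_zero_iff[symmetric]) (simp add: norm_inversion)
  from tendsto_add[OF tendsto_const[of a] this] show ?thesis by simp
qed

text \<open>Here \<open>q a\<close> is the square of the radius of the sphere with centre \<open>a\<close> under which \<open>u\<close> is invariant.
  Reading \<open>rel\<close> as \<open>y \<rightarrow> \<infinity>\<close> gives the expansion of \<open>q\<close> at infinity up to \<open>o(|y|)\<close> in terms of
  \<open>q' a\<close>; its linear term cannot depend on \<open>a\<close>.\<close>

lemma quadratic_if_inversion_invariant:
  fixes q :: "'a::euclidean_space \<Rightarrow> real"
  assumes pos: "\<And>a. q a > 0" and diff: "\<And>a. q differentiable (at a)"
    and rel: "\<And>a y. y \<noteq> 0 \<Longrightarrow> q (a + y) * q a = (norm y)\<^sup>2 * q (a + (q a / (norm y)\<^sup>2) *\<^sub>R y)"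
  obtains b k where "k > 0" "\<And>x. q x = (norm (x - b))\<^sup>2 + k"
proof -
  obtain D where D: "\<And>a. (q has_derivative D a) (at a)"
    using diff unfolding differentiable_def by metis
  have lin: "linear (D a)" for a
    using has_derivative_linear[OF D] .
  have lim: "((\<lambda>t. (q (t *\<^sub>R e) - t\<^sup>2 * (norm e)\<^sup>2) / t) \<longlongrightarrow> D a e - 2 * (a \<bullet> e)) at_top" if e: "e \<noteq> 0" for a e
  proof -
    \<comment> \<open>Chosen so that a + y t = t e for every centre: the quotient whose limit is
      computed does not involve \<open>a\<close>, and comparing the limits for \<open>a\<close> and
      for 0 determines \<open>D a\<close>.\<close>
    define y where "y t = t *\<^sub>R e - a" for t :: real
    define h where "h t = (q a / (norm (y t))\<^sup>2) *\<^sub>R y t" for t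
    define E where "E h = (q (a + h) - q a - D a h) / norm h" for h
    have "filterlim (\<lambda>t. - norm a + norm e * t) at_top at_top"
      using e by (intro filterlim_tendsto_add_at_top[OF tendsto_const]
          filterlim_tendsto_pos_mult_at_top[OF tendsto_const] filterlim_ident) auto
    moreover have "eventually (\<lambda>t. - norm a + norm e * t \<le> norm (y t)) at_top"
      using eventually_gt_at_top[of 0]
    proof eventually_elim
      case (elim t)
      thus ?case using norm_triangle_ineq2[of "t *\<^sub>R e" a] by (simp add: y_def mult.commute)
    qed
    ultimately have ny: "filterlim (\<lambda>t. norm (y t)) at_top at_top" by (rule filterlim_at_top_mono)
    have nh: "norm (h t) = q a / norm (y t)" for t
      using pos[of a] by (simp add: h_def power2_eq_square)
    have y0: "eventually (\<lambda>t. norm (y t) > 0) at_top"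
      using ny unfolding filterlim_at_top_dense by blast
    have "((\<lambda>t. q a / norm (y t)) \<longlongrightarrow> 0) at_top"
      by (intro tendsto_divide_0[OF tendsto_const] filterlim_at_top_imp_at_infinity ny)
    hence "(h \<longlongrightarrow> 0) at_top" by (subst tendsto_norm_zero_iff[symmetric]) (simp add: nh)
    moreover have "eventually (\<lambda>t. h t \<noteq> 0) at_top"
      using y0 by eventually_elim (use pos[of a] in \<open>auto simp: h_def dest: less_imp_neq\<close>)
    ultimately have h: "filterlim h (at 0) at_top" by (simp add: filterlim_at)
    have "((\<lambda>h. norm (E h)) \<longlongrightarrow> 0) (at 0)"
      using D[of a] unfolding has_derivative_at by (simp add: E_def)
    hence "(E \<longlongrightarrow> 0) (at 0)" by (rule tendsto_norm_zero_cancel)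
    hence E: "((\<lambda>t. E (h t)) \<longlongrightarrow> 0) at_top" by (rule filterlim_compose[OF _ h])
    have inv: "((\<lambda>t::real. 1 / t) \<longlongrightarrow> 0) at_top"
      by (intro tendsto_divide_0[OF tendsto_const] filterlim_at_top_imp_at_infinity filterlim_ident)
    have "((\<lambda>t. (D a e - 2 * (a \<bullet> e)) + (1 / t) * ((norm a)\<^sup>2 - D a a) + norm (e - (1 / t) *\<^sub>R a) * E (h t)) \<longlongrightarrow>
       (D a e - 2 * (a \<bullet> e)) + 0 * ((norm a)\<^sup>2 - D a a) + norm (e - 0 *\<^sub>R a) * 0) at_top"
      by (intro tendsto_intros inv E)
    moreover have "eventually (\<lambda>t. (D a e - 2 * (a \<bullet> e)) + (1 / t) * ((norm a)\<^sup>2 - D a a) + norm (e - (1 / t) *\<^sub>R a) * E (h t)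
        = (q (t *\<^sub>R e) - t\<^sup>2 * (norm e)\<^sup>2) / t) at_top"
      using y0 eventually_gt_at_top[of 0]
    proof eventually_elim
      case (elim t)
      hence h0: "norm (h t) > 0" using pos[of a] by (simp add: nh)
      have Dh: "D a (h t) = q a / (norm (y t))\<^sup>2 * D a (y t)"
        using linear_scale[OF lin, of a "q a / (norm (y t))\<^sup>2" "y t"] by (simp add: h_def)
      have "q (a + h t) = q a + D a (h t) + norm (h t) * E (h t)"
        using h0 by (simp add: E_def)
      hence "q (t *\<^sub>R e) * q a = (norm (y t))\<^sup>2 * (q a + D a (h t) + norm (h t) * E (h t))"
        using rel[of "y t" a] elim by (simp add: y_def h_def)
      also have "\<dots> = q a * ((norm (y t))\<^sup>2 + D a (y t) + norm (y t) * E (h t))"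
        using elim by (simp add: Dh nh field_simps power2_eq_square)
      finally have "q (t *\<^sub>R e) = (norm (y t))\<^sup>2 + D a (y t) + norm (y t) * E (h t)"
        using pos[of a] by simp
      moreover have "(norm (y t))\<^sup>2 = t\<^sup>2 * (norm e)\<^sup>2 - 2 * t * (a \<bullet> e) + (norm a)\<^sup>2"
        unfolding power2_norm_eq_inner y_def by (simp add: inner_diff inner_commute power2_eq_square)
      moreover have "D a (y t) = t * D a e - D a a"
        unfolding y_def by (simp add: linear_diff[OF lin] linear_scale[OF lin])
      moreover have "norm (y t) = t * norm (e - (1 / t) *\<^sub>R a)"
      proof -
        have "y t = t *\<^sub>R (e - (1 / t) *\<^sub>R a)" using elim by (simp add: y_def scaleR_diff_right)
        thus ?thesis using elim by simp
      qed
      ultimately show ?case using elim by (simp add: field_simps)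
    qed
    ultimately have "((\<lambda>t. (q (t *\<^sub>R e) - t\<^sup>2 * (norm e)\<^sup>2) / t) \<longlongrightarrow>
       (D a e - 2 * (a \<bullet> e)) + 0 * ((norm a)\<^sup>2 - D a a) + norm (e - 0 *\<^sub>R a) * 0) at_top"
      by (rule Lim_transform_eventually)
    thus ?thesis by simp
  qed
  define v where "v = adjoint (D 0) 1"
  have v: "D 0 x = x \<bullet> v" for x
    using adjoint_works[OF lin, of x 0 1] by (simp add: v_def)
  \<comment> \<open>\<open>v\<close> is the gradient of \<open>q\<close> at 0. Completing the square
    gives this \<open>b\<close>, for which the derivative of \<open>q\<close> is that of the squared
    distance from \<open>b\<close>.\<close>
  define b where "b = - (1 / 2) *\<^sub>R v"
  have DD: "D a e = 2 * ((a - b) \<bullet> e)" for a e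
  proof (cases "e = 0")
    case True
    thus ?thesis using linear_0[OF lin] by simp
  next
    case False
    have "D a e - 2 * (a \<bullet> e) = D 0 e - 2 * (0 \<bullet> e)"
      by (rule tendsto_unique[OF _ lim[OF False] lim[OF False]]) simp
    thus ?thesis by (simp add: v b_def inner_diff_left inner_commute algebra_simps)
  qed
  have "\<exists>k. \<forall>x\<in>UNIV. q x - (norm (x - b))\<^sup>2 = k"
  proof (rule has_derivative_zero_constant)
    fix x
    have "((\<lambda>x. q x - (x - b) \<bullet> (x - b)) has_derivative (\<lambda>h. 0)) (at x)"
      by (rule derivative_eq_intros D refl)+ (simp add: DD inner_commute fun_eq_iff)
    thus "((\<lambda>x. q x - (norm (x - b))\<^sup>2) has_derivative (\<lambda>h. 0)) (at x within UNIV)"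
      by (simp add: power2_norm_eq_inner)
  qed simp
  then obtain k where k: "\<And>x. q x - (norm (x - b))\<^sup>2 = k" by blast
  show ?thesis
  proof (rule that)
    show "k > 0" using k[of b] pos[of b] by simp
    show "q x = (norm (x - b))\<^sup>2 + k" for x using k[of x] by simp
  qed
qed

section \<open>Moving spheres\<close>

locale frac_solution =
  fixes \<alpha> \<tau> c :: real and f :: "real \<Rightarrow> real" and u :: "real^'n::finite \<Rightarrow> real"
  assumes \<alpha>: "0 < \<alpha>" "\<alpha> < 2" and n_gt: "real CARD('n) > \<alpha>"
    and \<tau>: "\<tau> = (real CARD('n) + \<alpha>) / (real CARD('n) - \<alpha>)"
    and c: "c > 0"
    and f_nonneg: "\<And>t. t > 0 \<Longrightarrow> f t \<ge> 0"
    and f_bounded: "locally_bounded_pos f"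
    and f_antimono: "antimono_on {0<..} (\<lambda>t. f t / t powr \<tau>)"
    and u_diff: "\<And>x. u differentiable (at x)"
    and u_pos: "\<And>x. u x > 0"
    and eq: "\<And>x. frac_pv \<alpha> u x (f (u x) / c)"
begin

definition w :: "real^'n \<Rightarrow> real \<Rightarrow> real^'n \<Rightarrow> real" where
  "w a r = kelvin_diff \<alpha> r (\<lambda>y. u (a + y))"

definition K :: "real^'n \<Rightarrow> real^'n \<Rightarrow> real" where
  "K x z = norm (x - z) powr (real CARD('n) + \<alpha>)"

lemma u_cont: "continuous_on S u"
  by (intro continuous_at_imp_continuous_on ballI differentiable_imp_continuous_within u_diff)

lemma u_borel [measurable]: "u \<in> borel_measurable borel"
  by (rule borel_measurable_continuous_onI) (rule u_cont)

lemma \<tau>_gt: "\<tau> > 1"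
  using \<alpha> n_gt by (simp add: \<tau> field_simps)

lemma frac_pv_shift: "frac_pv \<alpha> (\<lambda>z. u (a + z) + \<eta>) x (f (u (a + x)) / c)"
  by (rule frac_pv_translate[OF u_borel eq])

lemma frac_pv_w:
  assumes "x \<noteq> 0" "r > 0"
  shows "\<epsilon> > 0 \<Longrightarrow> set_integrable lborel (- cball x \<epsilon>)
      (\<lambda>z. (kelvin_diff \<alpha> r (\<lambda>y. u (a + y) + \<eta>) x - kelvin_diff \<alpha> r (\<lambda>y. u (a + y) + \<eta>) z) / K x z)"
    and "((\<lambda>\<epsilon>. LINT z:- cball x \<epsilon>|lborel.
        (kelvin_diff \<alpha> r (\<lambda>y. u (a + y) + \<eta>) x - kelvin_diff \<alpha> r (\<lambda>y. u (a + y) + \<eta>) z) / K x z) \<longlongrightarrow>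
      ((r / norm x) powr (real CARD('n) + \<alpha>) * f (u (a + inversion r x)) - f (u (a + x))) / c) (at_right 0)"
proof -
  have U: "(\<lambda>y. u (a + y) + \<eta>) \<in> borel_measurable borel" by measurable
  have d: "(\<lambda>y. u (a + y) + \<eta>) differentiable (at z)" for z
    using differentiable_chain_at[of "\<lambda>y. a + y" z u] u_diff[of "a + z"]
    by (auto simp: o_def intro!: derivative_intros)
  show "\<epsilon> > 0 \<Longrightarrow> set_integrable lborel (- cball x \<epsilon>)
      (\<lambda>z. (kelvin_diff \<alpha> r (\<lambda>y. u (a + y) + \<eta>) x - kelvin_diff \<alpha> r (\<lambda>y. u (a + y) + \<eta>) z) / K x z)"
    unfolding K_def by (rule set_integrable_kelvin_diff[OF \<alpha> assms U d frac_pv_shift frac_pv_shift])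
  show "((\<lambda>\<epsilon>. LINT z:- cball x \<epsilon>|lborel.
        (kelvin_diff \<alpha> r (\<lambda>y. u (a + y) + \<eta>) x - kelvin_diff \<alpha> r (\<lambda>y. u (a + y) + \<eta>) z) / K x z) \<longlongrightarrow>
      ((r / norm x) powr (real CARD('n) + \<alpha>) * f (u (a + inversion r x)) - f (u (a + x))) / c) (at_right 0)"
    using frac_pv_kelvin_diff[OF \<alpha> assms U d frac_pv_shift frac_pv_shift]
    by (simp add: K_def diff_divide_distrib)
qed

section \<open>The nonlinearity and the inequality at a minimum\<close>

lemma f_powr_decreasing:
  assumes "0 < t" "t \<le> s"
  shows "f s * t powr \<tau> \<le> f t * s powr \<tau>"
proof -
  have "f s / s powr \<tau> \<le> f t / t powr \<tau>"
    using f_antimono assms by (auto simp: monotone_on_def)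
  thus ?thesis using assms by (simp add: field_simps)
qed

text \<open>Let \<open>v\<close> be the Kelvin transform at \<open>x\<close> and \<open>s\<close>
  the value of \<open>u\<close>. The Kelvin factor is at least 1, so t \<le> v \<le> s, and
  monotonicity of f t / t^\<tau> bounds the transformed term below by f s (v/s)^\<tau>; here \<tau>
  (n-\<alpha>) = n+\<alpha> is used. Bernoulli's inequality turns this into f s - \<tau> (f s / s)
  (s - v), and s - v \<le> S.\<close>

lemma kelvin_nonlinearity_bound:
  assumes x: "x \<noteq> 0" "norm x \<le> r" and w: "w a r x \<le> 0" "- S \<le> w a r x"
    and C: "\<tau> * f (u (a + x)) / u (a + x) \<le> C" and S: "S \<ge> 0"
  shows "- (C * S) \<le> (r / norm x) powr (real CARD('n) + \<alpha>) * f (u (a + inversion r x)) - f (u (a + x))"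
proof -
  let ?p = "real CARD('n) - \<alpha>"
  define s where "s = u (a + x)"
  define t where "t = u (a + inversion r x)"
  define \<phi> where "\<phi> = (r / norm x) powr ?p"
  define v where "v = \<phi> * t"
  have s: "s > 0" and t: "t > 0" by (auto simp: s_def t_def u_pos)
  have q: "r / norm x \<ge> 1" using x by simp
  hence \<phi>: "\<phi> \<ge> 1" using n_gt by (auto simp: \<phi>_def ge_one_powr_ge_zero)
  have wv: "w a r x = v - s" by (simp add: w_def kelvin_diff_def v_def s_def t_def \<phi>_def)
  have v: "v > 0" "v \<le> s" using \<phi> t w by (auto simp: v_def wv[unfolded v_def])
  have "t \<le> v" using \<phi> t by (simp add: v_def)
  hence ts: "t \<le> s" using v by simp
  have "\<phi> powr \<tau> = (r / norm x) powr (real CARD('n) + \<alpha>)"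
    using n_gt by (simp add: \<phi>_def powr_powr \<tau>)
  hence e: "(r / norm x) powr (real CARD('n) + \<alpha>) * t powr \<tau> = v powr \<tau>"
    using \<phi> t by (simp add: v_def powr_mult)
  have "f s * (v / s) powr \<tau> = (r / norm x) powr (real CARD('n) + \<alpha>) * (f s * t powr \<tau>) / s powr \<tau>"
    using v s by (simp add: powr_divide e[symmetric])
  also have "\<dots> \<le> (r / norm x) powr (real CARD('n) + \<alpha>) * (f t * s powr \<tau>) / s powr \<tau>"
    by (intro divide_right_mono mult_left_mono f_powr_decreasing t ts) auto
  also have "\<dots> = (r / norm x) powr (real CARD('n) + \<alpha>) * f t" using s by simp
  finally have 1: "f s * (v / s) powr \<tau> \<le> (r / norm x) powr (real CARD('n) + \<alpha>) * f t" .
  have "f s * (1 + \<tau> * (v / s - 1)) \<le> f s * (v / s) powr \<tau>"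
    using v s \<tau>_gt by (intro mult_left_mono powr_ge_tangent f_nonneg) auto
  also have "f s * (1 + \<tau> * (v / s - 1)) = f s - (\<tau> * f s / s) * (s - v)"
    using s by (simp add: field_simps)
  finally have 2: "f s - (\<tau> * f s / s) * (s - v) \<le> f s * (v / s) powr \<tau>" .
  have "(\<tau> * f s / s) * (s - v) \<le> C * S"
    using C v w wv S s \<tau>_gt f_nonneg[OF s] by (intro mult_mono') (auto simp: s_def[symmetric])
  with 1 2 show ?thesis by (simp add: s_def t_def)
qed

text \<open>What the equation yields at a minimum \<open>x\<close> of depth more than S/2: the
  folded principal value on the left, the nonlinearity on the right. \<open>E\<close>,
  \<open>m\<close> and \<open>q\<close> stay free for two uses. The empty set gives the distance of
  \<open>x\<close> from the sphere; a set on which \<open>w a r\<close> is at least \<open>m\<close>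
  and the kernel difference at least \<open>q\<close> gives a contradiction for small
  \<open>S\<close>.\<close>

definition minimum_bound :: "real^'n \<Rightarrow> real \<Rightarrow> real \<Rightarrow> real \<Rightarrow> real^'n \<Rightarrow> bool" where
  "minimum_bound a r S C x \<longleftrightarrow> (\<forall>E m q. E \<in> fmeasurable lborel \<longrightarrow> E \<subseteq> ball 0 r \<longrightarrow> 0 \<le> m \<longrightarrow> 0 \<le> q \<longrightarrow>
     (\<forall>z\<in>E. z \<noteq> 0 \<longrightarrow> m \<le> w a r z) \<longrightarrow>
     (\<forall>z\<in>E. z \<noteq> x \<longrightarrow> q \<le> 1 / K x z - (r / norm x) powr (real CARD('n) + \<alpha>) / K (inversion r x) z) \<longrightarrow>
     c * (S / 2 * (LINT z:- ball 0 r|lborel. 1 / K x z) + m * q * measure lborel E) \<le> C * S)"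

text \<open>The point \<open>x\<close> minimizes the Kelvin difference of \<open>u + \<eta>\<close> with a small constant \<open>\<eta> > 0\<close>. Passing
  to \<open>u + \<eta>\<close> does not change the equation, but lets the difference blow up at the centre of the
  sphere, so that the minimum is attained although \<open>w a r\<close> need not have a limit there.\<close>

lemma maximum_principle:
  assumes r: "r > 0" and S: "S > 0"
    and C: "\<And>z. norm z \<le> r \<Longrightarrow> \<tau> * f (u (a + z)) / u (a + z) \<le> C"
    and wS: "\<And>z. z \<noteq> 0 \<Longrightarrow> norm z \<le> r \<Longrightarrow> - S \<le> w a r z"
    and z0: "z0 \<noteq> 0" "norm z0 \<le> r" "w a r z0 < - S / 2"
  obtains x where "x \<noteq> 0" "norm x < r"
    "minimum_bound a r S C x"
proof -
  let ?p = "real CARD('n) - \<alpha>"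
  define \<phi> where "\<phi> z = (r / norm z) powr ?p" for z :: "real^'n"
  have p: "?p > 0" using n_gt by simp
  have \<phi>1: "\<phi> z \<ge> 1" if "z \<noteq> 0" "norm z \<le> r" for z
    using that p by (auto simp: \<phi>_def intro!: ge_one_powr_ge_zero)
  define D where "D = - S / 2 - w a r z0"
  \<comment> \<open>The lift at \<open>z0\<close> is less than \<eta> times the Kelvin factor, that
    is D/2, so the lifted value stays below - S / 2.\<close>
  define \<eta> where "\<eta> = D / (2 * \<phi> z0)"
  have D: "D > 0" using z0 by (simp add: D_def)
  have \<eta>: "\<eta> > 0" using D \<phi>1[OF z0(1,2)] by (simp add: \<eta>_def)
  define U where "U y = u (a + y) + \<eta>" for y
  define W where "W = kelvin_diff \<alpha> r U"
  have W_eq: "W z = w a r z + \<eta> * (\<phi> z - 1)" for z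
    unfolding W_def U_def[abs_def] w_def \<phi>_def by (rule kelvin_diff_add_const)
  have Uc: "continuous_on UNIV U" unfolding U_def[abs_def]
    by (intro continuous_intros continuous_on_compose2[OF u_cont]) auto
  have contW: "continuous_on (- {0}) W" unfolding W_def
    by (rule continuous_on_kelvin_diff[OF Uc]) (use r in auto)
  have Wz0: "W z0 < - S / 2"
  proof -
    have "\<eta> * (\<phi> z0 - 1) \<le> \<eta> * \<phi> z0" using \<eta> by simp
    also have "\<dots> < D" using D \<phi>1[OF z0(1,2)] by (simp add: \<eta>_def)
    finally show ?thesis by (simp add: W_eq D_def)
  qed
  have Ww: "w a r z \<le> W z" if "z \<noteq> 0" "norm z \<le> r" for z
    using \<phi>1[OF that] \<eta> by (simp add: W_eq)
  \<comment> \<open>Within distance \<rho> of the centre the Kelvin factor is at least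
    \<open>B\<close>, so the lift is at least \<open>S\<close> and outweighs the lowest possible
    value of \<open>w\<close>. This confines the minimum to a compact shell.\<close>
  define B where "B = 1 + S / \<eta>"
  define \<rho> where "\<rho> = r / B powr (1 / ?p)"
  have B: "B > 1" using S \<eta> by (simp add: B_def)
  have \<rho>: "\<rho> > 0" using B r by (simp add: \<rho>_def)
  have near: "W z \<ge> 0" if "z \<noteq> 0" "norm z < \<rho>" "norm z \<le> r" for z
  proof -
    have "B powr (1 / ?p) \<le> r / norm z"
      using that B by (simp add: \<rho>_def field_simps)
    hence "(B powr (1 / ?p)) powr ?p \<le> \<phi> z"
      unfolding \<phi>_def using B p by (intro powr_mono2) auto
    hence "B \<le> \<phi> z" using B p by (simp add: powr_powr)
    hence "S \<le> \<eta> * (\<phi> z - 1)" using \<eta> by (simp add: B_def field_simps)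
    thus ?thesis using wS[of z] that by (simp add: W_eq)
  qed
  have "norm z0 \<ge> \<rho>" using near[of z0] z0 Wz0 S by force
  hence z0K: "z0 \<in> cball 0 r - ball 0 \<rho>" using z0 by simp
  have "compact (cball 0 r - ball (0::real^'n) \<rho>)" by (intro compact_diff) auto
  moreover have "continuous_on (cball 0 r - ball 0 \<rho>) W"
    by (rule continuous_on_subset[OF contW]) (use \<rho> in auto)
  ultimately obtain x where x: "x \<in> cball 0 r - ball 0 \<rho>" "\<And>z. z \<in> cball 0 r - ball 0 \<rho> \<Longrightarrow> W x \<le> W z"
    using continuous_attains_inf[of "cball 0 r - ball 0 \<rho>" W] z0K by blast
  have Wx: "W x < - S / 2" using x(2)[OF z0K] Wz0 by simp
  have x0: "x \<noteq> 0" using x(1) \<rho> by auto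
  have "norm x \<noteq> r" using kelvin_diff_sphere[OF _ r, of x \<alpha> U] Wx S by (auto simp: W_def)
  hence xr: "norm x < r" using x(1) by simp
  have min: "W x \<le> W z" if "z \<noteq> 0" "norm z \<le> r" for z
    using x(2)[of z] near[OF that(1) _ that(2)] Wx S that by (cases "norm z < \<rho>") auto
  have "w a r x \<le> 0" using Ww[OF x0] xr Wx S by simp
  hence nl: "- (C * S) \<le> (r / norm x) powr (real CARD('n) + \<alpha>) * f (u (a + inversion r x)) - f (u (a + x))"
    using x0 xr wS[OF x0] C S by (intro kelvin_nonlinearity_bound) auto
  have "minimum_bound a r S C x"
    unfolding minimum_bound_def
  proof (intro allI impI)
    fix E :: "(real^'n) set" and m q :: real
    assume E: "E \<in> fmeasurable lborel" "E \<subseteq> ball 0 r" and mq: "m \<ge> 0" "q \<ge> 0"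
      and "\<forall>z\<in>E. z \<noteq> 0 \<longrightarrow> m \<le> w a r z"
        "\<forall>z\<in>E. z \<noteq> x \<longrightarrow> q \<le> 1 / K x z - (r / norm x) powr (real CARD('n) + \<alpha>) / K (inversion r x) z"
    hence m: "\<And>z. z \<in> E \<Longrightarrow> z \<noteq> 0 \<Longrightarrow> m \<le> w a r z"
      and q: "\<And>z. z \<in> E \<Longrightarrow> z \<noteq> x \<Longrightarrow> q \<le> 1 / K x z - (r / norm x) powr (real CARD('n) + \<alpha>) / K (inversion r x) z"
      by blast+
    let ?A = "LINT z:- ball 0 r|lborel. 1 / K x z"
    have "0 \<le> ?A" unfolding set_lebesgue_integral_def by (intro integral_nonneg_AE) (auto simp: K_def)
    have "((r / norm x) powr (real CARD('n) + \<alpha>) * f (u (a + inversion r x)) - f (u (a + x))) / c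
       \<le> W x * ?A - (m * q) * measure lborel E"
      unfolding K_def
    proof (rule antisymmetric_pv_le[OF \<alpha>(1) x0 xr _ contW])
      show "W \<in> borel_measurable borel" unfolding W_def U_def[abs_def] by measurable
      show "(r / norm z) powr ?p * W (inversion r z) = - W z" if "z \<noteq> 0" for z
        unfolding W_def by (rule kelvin_diff_antisymmetric[OF that r])
      show "m * q \<le> (W z - W x) * (1 / norm (x - z) powr (real CARD('n) + \<alpha>) -
          (r / norm x) powr (real CARD('n) + \<alpha>) / norm (inversion r x - z) powr (real CARD('n) + \<alpha>))"
        if "z \<in> E" "z \<noteq> 0" "z \<noteq> x" for z
      proof (rule mult_mono)
        show "m \<le> W z - W x" using m[OF that(1,2)] Ww[OF that(2)] E that(1) Wx S by force
      qed (use q[OF that(1,3)] mq m[OF that(1,2)] Ww[OF that(2)] E that(1) Wx S in \<open>force simp: K_def\<close>)+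
    qed (use min Wx S E mq frac_pv_w(1)[OF x0 r, where a = a and \<eta> = \<eta>]
          frac_pv_w(2)[OF x0 r, where a = a and \<eta> = \<eta>] in \<open>auto simp: K_def W_def U_def[abs_def]\<close>)
    also have "\<dots> \<le> - (S / 2) * ?A - (m * q) * measure lborel E"
      using Wx \<open>0 \<le> ?A\<close> by (intro diff_right_mono mult_right_mono) auto
    finally show "c * (S / 2 * ?A + m * q * measure lborel E) \<le> C * S"
      using nl c by (simp add: field_simps)
  qed
  thus ?thesis by (rule that[OF x0 xr])
qed

section \<open>Nonnegativity for small radii\<close>

definition P :: "real^'n \<Rightarrow> real \<Rightarrow> bool" where
  "P a r \<longleftrightarrow> (\<forall>z. z \<noteq> 0 \<longrightarrow> norm z \<le> r \<longrightarrow> 0 \<le> w a r z)"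

text \<open>On the ball \<open>u\<close> stays in a compact subset of the positive reals, where
  \<open>f\<close> is bounded and the denominator is bounded away from 0.\<close>

lemma nonlinearity_quotient_bound:
  obtains C where "C > 0" "\<And>z. norm z \<le> R \<Longrightarrow> \<tau> * f (u (a + z)) / u (a + z) \<le> C"
proof -
  let ?Y = "u ` cball a (max R 0)"
  have Y: "compact ?Y" by (intro compact_continuous_image u_cont compact_cball)
  hence "bounded (f ` ?Y)" using f_bounded u_pos by (auto simp: locally_bounded_pos_def)
  then obtain M where M: "M > 0" "\<And>y. y \<in> ?Y \<Longrightarrow> \<bar>f y\<bar> \<le> M" unfolding bounded_pos by force
  have "?Y \<noteq> {}" by auto
  from compact_attains_inf[OF Y this] obtain m where m: "m \<in> ?Y" "\<And>y. y \<in> ?Y \<Longrightarrow> m \<le> y" by blast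
  have m0: "m > 0" using m(1) u_pos by auto
  show ?thesis
  proof (rule that)
    show "\<tau> * M / m > 0" using M m0 \<tau>_gt by simp
    fix z :: "real^'n" assume "norm z \<le> R"
    hence "u (a + z) \<in> ?Y" by (intro imageI) (simp add: dist_norm)
    with m M(2) have "m \<le> u (a + z)" "f (u (a + z)) \<le> M" by (force simp: abs_le_iff)+
    thus "\<tau> * f (u (a + z)) / u (a + z) \<le> \<tau> * M / m"
      using m0 M \<tau>_gt by (intro frac_le mult_left_mono) auto
  qed
qed

text \<open>The Kelvin term is nonnegative, so - w is bounded by \<open>u\<close> on the ball and
  \<open>S\<close> can be taken as the supremum of - w. Because of the puncture it need not be
  attained; hence only a point below - S / 2 is chosen.\<close>

lemma maximum_principle_not_P:
  assumes r: "r > 0" and "\<not> P a r"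
    and C: "\<And>z. norm z \<le> r \<Longrightarrow> \<tau> * f (u (a + z)) / u (a + z) \<le> C"
  obtains S z0 x where "S > 0" "z0 \<noteq> 0" "norm z0 \<le> r" "w a r z0 < - S / 2" "x \<noteq> 0" "norm x < r"
    "minimum_bound a r S C x"
proof -
  let ?Z = "cball 0 r - {0::real^'n}"
  let ?X = "(\<lambda>z. - w a r z) ` ?Z"
  obtain z1 where z1: "z1 \<in> ?Z" "w a r z1 < 0" using assms(2) by (auto simp: P_def)
  have "compact (u ` cball a r)" by (intro compact_continuous_image u_cont compact_cball)
  then obtain M where M: "\<And>y. y \<in> u ` cball a r \<Longrightarrow> y \<le> M"
    using compact_imp_bounded bounded_imp_bdd_above unfolding bdd_above_def by meson
  have "- w a r z \<le> M" if "z \<in> ?Z" for z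
  proof -
    have "- w a r z \<le> u (a + z)" unfolding w_def kelvin_diff_def using u_pos[THEN less_imp_le] by simp
    also have "\<dots> \<le> M" using that by (intro M imageI) (simp add: dist_norm)
    finally show ?thesis .
  qed
  hence bdd: "bdd_above ?X" by (rule bdd_aboveI2)
  define S where "S = Sup ?X"
  have wS: "- S \<le> w a r z" if "z \<in> ?Z" for z
    using cSup_upper[OF imageI[OF that, of "\<lambda>z. - w a r z"] bdd] by (simp add: S_def)
  have S: "S > 0" using wS[OF z1(1)] z1(2) by linarith
  have "S / 2 < Sup ?X" using S by (simp add: S_def)
  moreover have "?X \<noteq> {}" using z1(1) by blast
  ultimately obtain y where "y \<in> ?X" "S / 2 < y" using less_cSupD by metis
  then obtain z0 where z0: "z0 \<in> ?Z" "S / 2 < - w a r z0" by blast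
  show ?thesis
    by (rule maximum_principle[OF r S C, where ?z0.0 = z0]) (use wS z0 S that[of S z0] in auto)
qed

text \<open>With the empty set in \<open>minimum_bound\<close> only the exterior integral remains,
  and this is at least a constant times (r - |x|)^(-\<alpha>). The factor \<open>S\<close> cancels,
  so the distance does not depend on the depth of the minimum.\<close>

lemma not_P_boundary_distance:
  assumes r: "r > 0" and "S > 0" and x: "x \<noteq> 0" "norm x < r"
    and main: "minimum_bound a r S C x"
    and "C > 0"
  shows "(c * (unit_ball_vol (real CARD('n)) * 3 powr (- (real CARD('n) + \<alpha>))) / (2 * C)) powr (1 / \<alpha>) \<le> r - norm x"
proof -
  let ?V = "unit_ball_vol (real CARD('n)) * 3 powr (- (real CARD('n) + \<alpha>))"
  let ?A = "LINT z:- ball 0 r|lborel. 1 / K x z"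
  have d: "r - norm x > 0" using x by simp
  have "c * (S / 2 * ?A) \<le> C * S" using main[unfolded minimum_bound_def, rule_format, of "{}" 0 0] by simp
  hence "c * ?A \<le> 2 * C" using \<open>S > 0\<close> by (simp add: field_simps)
  moreover have "c * (?V * (r - norm x) powr (- \<alpha>)) \<le> c * ?A"
    using exterior_kernel_lower_bound[OF \<alpha>(1) x] c by (simp add: K_def)
  ultimately have "c * (?V * (r - norm x) powr (- \<alpha>)) \<le> 2 * C" by linarith
  hence "c * ?V / (2 * C) \<le> (r - norm x) powr \<alpha>"
    using d \<open>C > 0\<close> by (simp add: powr_minus_divide field_simps)
  hence "(c * ?V / (2 * C)) powr (1 / \<alpha>) \<le> ((r - norm x) powr \<alpha>) powr (1 / \<alpha>)"
    using c \<open>C > 0\<close> \<alpha> by (intro powr_mono2) auto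
  thus ?thesis using d \<alpha> by (simp add: powr_powr)
qed

text \<open>With \<open>C\<close> taken over the unit ball, the distance \<open>d\<close> is the
  same for all radii below 1, and no point of a ball of radius less than \<open>d\<close> has
  distance \<open>d\<close> from its sphere.\<close>

lemma P_small: "\<exists>r0>0. \<forall>r. 0 < r \<longrightarrow> r < r0 \<longrightarrow> P a r"
proof -
  obtain C where C: "C > 0" "\<And>z. norm z \<le> 1 \<Longrightarrow> \<tau> * f (u (a + z)) / u (a + z) \<le> C"
    by (rule nonlinearity_quotient_bound[of 1 a]) blast
  define d where "d = (c * (unit_ball_vol (real CARD('n)) * 3 powr (- (real CARD('n) + \<alpha>))) / (2 * C)) powr (1 / \<alpha>)"
  have "unit_ball_vol (real CARD('n)) \<noteq> 0"
    using unit_ball_vol_pos[of "real CARD('n)"] by linarith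
  hence d: "d > 0" using c C by (simp add: d_def)
  have "P a r" if r: "0 < r" "r < min 1 d" for r
  proof (rule ccontr)
    assume "\<not> P a r"
    have C': "\<And>z. norm z \<le> r \<Longrightarrow> \<tau> * f (u (a + z)) / u (a + z) \<le> C" using C(2) r by simp
    obtain S z0 x where *: "S > 0" "x \<noteq> 0" "norm x < r"
    "minimum_bound a r S C x"
      using maximum_principle_not_P[OF r(1) \<open>\<not> P a r\<close> C'] by metis
    have "d \<le> r - norm x"
      unfolding d_def by (rule not_P_boundary_distance[OF r(1) *(1-4) C(1)])
    thus False using r norm_ge_zero[of x] by linarith
  qed
  thus ?thesis using d by (intro exI[of _ "min 1 d"]) auto
qed

text \<open>The inversion of radius \<open>s\<close> at \<open>z\<close> agrees with that of radius
  \<open>r\<close> at (r/s)^2 z, so the Kelvin terms of the two radii differ by a constant factor.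
  What remains involves \<open>u\<close> only at bounded points, even where the inverted point runs
  off to infinity.\<close>

lemma w_rescale:
  assumes "z \<noteq> 0" "r > 0" "s > 0"
  shows "w a s z = (r / s) powr (real CARD('n) - \<alpha>) * (w a r ((r / s)\<^sup>2 *\<^sub>R z) + u (a + (r / s)\<^sup>2 *\<^sub>R z)) - u (a + z)"
proof -
  let ?p = "real CARD('n) - \<alpha>" and ?z = "(r / s)\<^sup>2 *\<^sub>R z"
  have "inversion r ?z = inversion s z"
    using assms by (simp add: inversion_def power_mult_distrib power_divide power2_eq_square)
  hence 1: "w a r ?z + u (a + ?z) = (r / norm ?z) powr ?p * u (a + inversion s z)"
    by (simp add: w_def kelvin_diff_def)
  have 2: "(r / s) powr ?p * (r / norm ?z) powr ?p = (s / norm z) powr ?p"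
    using assms by (simp add: power2_eq_square flip: powr_mult)
  show ?thesis
    unfolding 1 by (simp only: mult.assoc[symmetric] 2 w_def kelvin_diff_def)
qed

text \<open>Together with the previous identity this shows that the negative part of \<open>w a s\<close> tends to \<open>0\<close>
  uniformly as \<open>s\<close> decreases to a radius \<open>r\<close> with \<open>P a r\<close>.\<close>

lemma u_rescale_uniform:
  assumes "r > 0" "e > 0"
  obtains \<delta> where "\<delta> > 0" "\<And>s z. r < s \<Longrightarrow> s < r + \<delta> \<Longrightarrow> norm z \<le> R \<Longrightarrow>
    u (a + z) - (r / s) powr (real CARD('n) - \<alpha>) * u (a + (r / s)\<^sup>2 *\<^sub>R z) < e"
proof -
  let ?p = "real CARD('n) - \<alpha>"
  let ?F = "\<lambda>(t::real, z::real^'n). t powr ?p * u (a + t\<^sup>2 *\<^sub>R z)"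
  let ?T = "{1/2..1} \<times> cball (0::real^'n) R"
  have "continuous_on ?T ?F"
    unfolding case_prod_unfold
    by (intro continuous_intros continuous_on_compose2[OF u_cont]) auto
  hence "uniformly_continuous_on ?T ?F"
    by (intro compact_uniformly_continuous compact_Times) auto
  from uniformly_continuous_onE[OF this \<open>e > 0\<close>] obtain d where d: "d > 0"
    "\<And>x x'. x \<in> ?T \<Longrightarrow> x' \<in> ?T \<Longrightarrow> dist x' x < d \<Longrightarrow> dist (?F x') (?F x) < e" by blast
  show ?thesis
  proof (rule that)
    \<comment> \<open>The bound \<open>r\<close> keeps r/s above 1/2, within the compact set; the
      bound \<open>d * r\<close> gives 1 - r/s < d.\<close>
    show "min r (d * r) > 0" using assms d by simp
    fix s and z :: "real^'n" assume s: "r < s" "s < r + min r (d * r)" and z: "norm z \<le> R"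
    have "1 / 2 \<le> r / s" "r / s \<le> 1" using s assms by (auto simp: field_simps)
    have "1 - r / s = (s - r) / s" using s assms by (simp add: diff_divide_distrib)
    also have "\<dots> \<le> (s - r) / r" using s assms by (intro divide_left_mono) auto
    also have "\<dots> < d" using s assms by (simp add: field_simps)
    finally have "dist (1, z) (r / s, z) < d" using \<open>r / s \<le> 1\<close> by (simp add: dist_Pair_Pair dist_real_def)
    hence "dist (?F (1, z)) (?F (r / s, z)) < e"
      using \<open>1 / 2 \<le> r / s\<close> \<open>r / s \<le> 1\<close> z by (intro d) auto
    thus "u (a + z) - (r / s) powr ?p * u (a + (r / s)\<^sup>2 *\<^sub>R z) < e"
      by (simp add: dist_real_def)
  qed
qed

text \<open>The distance identity gives B^2 \<ge> A^2 + d d', where \<open>A\<close> and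
  \<open>B\<close> are the distances whose powers form the two kernels. The resulting lower bound
  for the difference decreases in \<open>A\<close>, and A \<le> 2 T, so it is evaluated at 2 T. It
  is uniform in \<open>s\<close>, as moving the radius requires.\<close>

lemma kernel_gap:
  fixes x z :: "real^'n"
  assumes "x \<noteq> 0" "s > 0" "norm x \<le> s - d" "norm z \<le> s - d'" "d > 0" "d' > 0" "s \<le> T" "z \<noteq> x"
  shows "(2 * T) powr (- (real CARD('n) + \<alpha>)) *
      (1 - (1 + d * d' / (2 * T)\<^sup>2) powr (- (real CARD('n) + \<alpha>) / 2))
    \<le> 1 / K x z - (s / norm x) powr (real CARD('n) + \<alpha>) / K (inversion s x) z"
proof -
  let ?N = "real CARD('n) + \<alpha>"
  define A where "A = norm (x - z)"
  define B where "B = norm x / s * norm (inversion s x - z)"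
  have N: "?N > 0" using \<alpha> by simp
  have A: "A > 0" "A \<le> 2 * T"
    using assms norm_triangle_ineq4[of x z] by (auto simp: A_def)
  have T: "T > 0" using assms by simp
  have B2: "A\<^sup>2 + d * d' \<le> B\<^sup>2"
  proof -
    have "d * s \<le> (s - norm x) * (s + norm x)" "d' * s \<le> (s - norm z) * (s + norm z)"
      using assms by (auto intro!: mult_mono)
    hence "d * s \<le> s\<^sup>2 - (norm x)\<^sup>2" "d' * s \<le> s\<^sup>2 - (norm z)\<^sup>2"
      by (simp_all add: power2_eq_square algebra_simps)
    hence "(d * s) * (d' * s) \<le> (s\<^sup>2 - (norm x)\<^sup>2) * (s\<^sup>2 - (norm z)\<^sup>2)"
      using assms by (intro mult_mono) (auto intro: order_trans[rotated])
    hence "d * d' \<le> (s\<^sup>2 - (norm x)\<^sup>2) * (s\<^sup>2 - (norm z)\<^sup>2) / s\<^sup>2"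
      using assms by (simp add: field_simps power2_eq_square)
    thus ?thesis using norm_inversion_diff_sq[of x s z] assms by (simp add: A_def B_def)
  qed
  have "B > 0"
  proof -
    have "B\<^sup>2 > 0" using B2 A assms by (smt (verit) mult_pos_pos zero_less_power)
    moreover have "B \<ge> 0" using assms by (simp add: B_def)
    ultimately show ?thesis by (cases "B = 0") auto
  qed
  have sq: "(y\<^sup>2) powr (- ?N / 2) = y powr (- ?N)" if "y > 0" for y :: real
  proof -
    have "(y\<^sup>2) powr (- ?N / 2) = (y powr 2) powr (- ?N / 2)" using that by simp
    also have "\<dots> = y powr (2 * (- ?N / 2))" by (rule powr_powr)
    also have "2 * (- ?N / 2) = - ?N" by (simp add: field_simps)
    finally show ?thesis .
  qed
  have "B powr (- ?N) = (B\<^sup>2) powr (- ?N / 2)" by (rule sq[OF \<open>B > 0\<close>, symmetric])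
  also have "\<dots> \<le> (A\<^sup>2 + d * d') powr (- ?N / 2)"
    using B2 A assms N by (intro powr_mono2') (auto intro!: add_pos_pos)
  also have "A\<^sup>2 + d * d' = A\<^sup>2 * (1 + d * d' / A\<^sup>2)" using A by (simp add: field_simps)
  also have "\<dots> powr (- ?N / 2) = (A\<^sup>2) powr (- ?N / 2) * (1 + d * d' / A\<^sup>2) powr (- ?N / 2)"
    by (rule powr_mult)
  also have "(A\<^sup>2) powr (- ?N / 2) = A powr (- ?N)" by (rule sq[OF A(1)])
  also have "A powr (- ?N) * (1 + d * d' / A\<^sup>2) powr (- ?N / 2) \<le>
      A powr (- ?N) * (1 + d * d' / (2 * T)\<^sup>2) powr (- ?N / 2)"
    using A T assms N
    by (intro mult_left_mono powr_mono2' add_left_mono divide_left_mono power_mono mult_pos_pos)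
       (auto intro!: add_pos_pos)
  finally have "A powr (- ?N) * (1 - (1 + d * d' / (2 * T)\<^sup>2) powr (- ?N / 2)) \<le> A powr (- ?N) - B powr (- ?N)"
    by (simp add: right_diff_distrib)
  moreover have "(2 * T) powr (- ?N) * (1 - (1 + d * d' / (2 * T)\<^sup>2) powr (- ?N / 2)) \<le>
      A powr (- ?N) * (1 - (1 + d * d' / (2 * T)\<^sup>2) powr (- ?N / 2))"
  proof (intro mult_right_mono powr_mono2')
    have "(1 + d * d' / (2 * T)\<^sup>2) powr (- ?N / 2) \<le> (1 + d * d' / (2 * T)\<^sup>2) powr 0"
      using assms N by (intro powr_mono) auto
    also have "\<dots> \<le> 1" by simp
    finally show "0 \<le> 1 - (1 + d * d' / (2 * T)\<^sup>2) powr (- ?N / 2)" by simp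
  qed (use A N in auto)
  moreover have "1 / K x z = A powr (- ?N)" by (simp only: K_def A_def powr_minus_divide)
  moreover have "(s / norm x) powr ?N / K (inversion s x) z = B powr (- ?N)"
  proof -
    have "B powr (- ?N) = (norm x / s) powr (- ?N) * norm (inversion s x - z) powr (- ?N)"
      unfolding B_def by (rule powr_mult)
    also have "(norm x / s) powr (- ?N) = 1 / (norm x / s) powr ?N" by (rule powr_minus_divide)
    also have "1 / (norm x / s) powr ?N = (s / norm x) powr ?N"
      by (simp add: powr_divide)
    finally show ?thesis by (simp only: K_def powr_minus_divide) simp
  qed
  ultimately show ?thesis by linarith
qed

text \<open>If \<open>P a s\<close> failed just beyond \<open>r\<close>, the rescaling estimate
  would keep \<open>S\<close> below 2 \<open>e\<close>, and the minimum would stay at distance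
  \<open>d\<close> from the sphere. The set \<open>E\<close>, where \<open>w a s\<close> is at least
  \<open>m\<close>, then contributes a fixed positive amount to \<open>minimum_bound\<close>, which
  C S is too small to dominate.\<close>

lemma P_extend:
  assumes r: "r > 0" and P: "P a r" and z1: "z1 \<noteq> 0" "norm z1 < r" "w a r z1 > 0"
  shows "\<exists>\<delta>>0. \<forall>s. r < s \<longrightarrow> s < r + \<delta> \<longrightarrow> P a s"
proof -
  let ?N = "real CARD('n) + \<alpha>" and ?p = "real CARD('n) - \<alpha>"
  obtain C where C: "C > 0" "\<And>z. norm z \<le> r + 1 \<Longrightarrow> \<tau> * f (u (a + z)) / u (a + z) \<le> C"
    by (rule nonlinearity_quotient_bound[of "r + 1" a]) blast
  define d where "d = (c * (unit_ball_vol (real CARD('n)) * 3 powr (- ?N)) / (2 * C)) powr (1 / \<alpha>)"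
  have "unit_ball_vol (real CARD('n)) \<noteq> 0"
    using unit_ball_vol_pos[of "real CARD('n)"] by linarith
  hence d: "d > 0" using c C by (simp add: d_def)
  \<comment> \<open>Near \<open>z1\<close> the difference exceeds 2 m by continuity, and at least
    3/4 of 2 m minus m/4, which is more than m, survives the change of radius.\<close>
  define m where "m = w a r z1 / 4"
  have m: "m > 0" using z1 by (simp add: m_def)
  have "continuous_on UNIV (\<lambda>y. u (a + y))"
    by (intro continuous_on_compose2[OF u_cont] continuous_intros) auto
  hence "continuous_on (- {0}) (w a r)"
    unfolding w_def by (rule continuous_on_kelvin_diff) (use r in simp)
  hence "isCont (w a r) z1" using z1 by (simp add: continuous_on_eq_continuous_at open_Compl)
  hence "eventually (\<lambda>z. w a r z > 2 * m) (at z1)"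
    unfolding isCont_def by (rule order_tendstoD) (use m in \<open>simp add: m_def\<close>)
  then obtain \<rho>1 where \<rho>1: "\<rho>1 > 0" "\<And>z. z \<noteq> z1 \<Longrightarrow> dist z z1 < \<rho>1 \<Longrightarrow> w a r z > 2 * m"
    unfolding eventually_at by auto
  define \<rho> where "\<rho> = Min {\<rho>1 / 2, norm z1 / 2, (r - norm z1) / 2}"
  have \<rho>: "\<rho> > 0" "\<rho> < \<rho>1" "\<rho> < norm z1"
    using \<rho>1 z1 by (auto simp: \<rho>_def min_less_iff_disj)
  have \<rho>': "\<rho> \<le> (r - norm z1) / 2" unfolding \<rho>_def by (rule Min_le) auto
  have wE: "w a r z \<ge> 2 * m" if "dist z1 z \<le> \<rho>" for z
    using \<rho>1(2)[of z] that \<rho> m by (cases "z = z1") (auto simp: m_def dist_commute)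
  \<comment> \<open>Half of the radius \<rho>: the rescaled point (r/s)^2 z may move by \<rho>/2 and
    still lies where \<open>w a r\<close> is at least 2 m.\<close>
  define E where "E = cball z1 (\<rho> / 2)"
  define d' where "d' = (r - norm z1) / 2"
  have d': "d' > 0" using z1 by (simp add: d'_def)
  have Er: "norm z \<le> r - d'" if "z \<in> E" for z
  proof -
    have "norm z \<le> norm z1 + dist z1 z" by (metis dist_0_norm dist_triangle)
    thus ?thesis using that \<rho>' z1(2) by (simp add: E_def d'_def field_simps)
  qed
  have vE: "measure lborel E > 0" using \<rho> by (simp add: E_def content_cball)
  have Em: "E \<in> fmeasurable lborel"
    unfolding E_def by (rule fmeasurableI) (use emeasure_lborel_cball_finite[of z1 "\<rho> / 2"] in auto)
  \<comment> \<open>The kernel gap for distances \<open>d\<close> of the minimum and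
    \<open>d'\<close> of \<open>E\<close> from the sphere, with T = r + 1 bounding all radii
    considered.\<close>
  define q where "q = (2 * (r + 1)) powr (- ?N) * (1 - (1 + d * d' / (2 * (r + 1))\<^sup>2) powr (- ?N / 2))"
  have q: "q > 0"
  proof -
    define y where "y = 1 + d * d' / (2 * (r + 1))\<^sup>2"
    have "y > 1" using d d' r by (simp add: y_def)
    hence "y powr (- ?N / 2) < y powr 0" using \<alpha> by (intro powr_less_mono) auto
    also have "y powr 0 = 1" using \<open>y > 1\<close> by simp
    finally show ?thesis unfolding q_def y_def[symmetric] using r by (intro mult_pos_pos) auto
  qed
  \<comment> \<open>The first bound protects the value \<open>m\<close> on \<open>E\<close>; the
    second makes C times 2 e at most half of the contribution of \<open>E\<close>.\<close>
  define e where "e = min (m / 4) (c * (m * q * measure lborel E) / (4 * C))"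
  have e: "e > 0" using m q vE c C by (simp add: e_def)
  obtain \<delta>1 where \<delta>1: "\<delta>1 > 0" "\<And>s z. r < s \<Longrightarrow> s < r + \<delta>1 \<Longrightarrow> norm z \<le> r + 1 \<Longrightarrow>
    u (a + z) - (r / s) powr ?p * u (a + (r / s)\<^sup>2 *\<^sub>R z) < e"
    by (rule u_rescale_uniform[OF r e, of "r + 1" a]) blast
  have "((\<lambda>s. (r / s) powr ?p) \<longlongrightarrow> (r / r) powr ?p) (at_right r)"
    using r by (intro tendsto_intros) auto
  hence "eventually (\<lambda>s. (r / s) powr ?p > 3 / 4) (at_right r)"
    by (rule order_tendstoD) (use r in simp)
  then obtain b2 where b2: "b2 > r" "\<And>s. r < s \<Longrightarrow> s < b2 \<Longrightarrow> (r / s) powr ?p > 3 / 4"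
    unfolding eventually_at_right_field by blast
  have "((\<lambda>s. (1 - (r / s)\<^sup>2) * r) \<longlongrightarrow> (1 - (r / r)\<^sup>2) * r) (at_right r)"
    using r by (intro tendsto_intros) auto
  hence "eventually (\<lambda>s. (1 - (r / s)\<^sup>2) * r < \<rho> / 2) (at_right r)"
    by (rule order_tendstoD) (use r \<rho> in simp)
  then obtain b3 where b3: "b3 > r" "\<And>s. r < s \<Longrightarrow> s < b3 \<Longrightarrow> (1 - (r / s)\<^sup>2) * r < \<rho> / 2"
    unfolding eventually_at_right_field by blast
  have "P a s" if s: "r < s" "s < r + Min {1, \<delta>1, b2 - r, b3 - r}" for s
  proof (rule ccontr)
    assume "\<not> P a s"
    have s': "s > 0" "s < r + 1" "s < r + \<delta>1" "s < b2" "s < b3" using s r by auto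
    have C': "\<And>z. norm z \<le> s \<Longrightarrow> \<tau> * f (u (a + z)) / u (a + z) \<le> C" using C(2) s' by simp
    obtain S z0 x where S: "S > 0" and z0: "z0 \<noteq> 0" "norm z0 \<le> s" "w a s z0 < - S / 2"
      and x: "x \<noteq> 0" "norm x < s" and main:
    "minimum_bound a s S C x"
      using maximum_principle_not_P[OF s'(1) \<open>\<not> P a s\<close> C'] by metis
    have dx: "d \<le> s - norm x"
      unfolding d_def by (rule not_P_boundary_distance[OF s'(1) S x main C(1)])
    have rs: "0 < r / s" "r / s \<le> 1" using s s' r by auto
    hence rs2: "0 < (r / s)\<^sup>2" "(r / s)\<^sup>2 \<le> 1" by (simp_all only: power_le_one less_imp_le zero_less_power)
    have lower: "w a s z \<ge> (r / s) powr ?p * w a r ((r / s)\<^sup>2 *\<^sub>R z) - e" if "z \<noteq> 0" "norm z \<le> s" for z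
      using w_rescale[OF that(1) r s'(1), of a] \<delta>1(2)[of s z] that s s' by (simp add: distrib_left)
    have "S < 2 * e"
    proof -
      have "norm ((r / s)\<^sup>2 *\<^sub>R z0) \<le> r"
      proof -
        have "(r / s)\<^sup>2 * norm z0 \<le> (r / s)\<^sup>2 * s" using z0 rs2 by (intro mult_left_mono) auto
        also have "\<dots> = r * (r / s)" using s' by (simp add: power2_eq_square)
        also have "\<dots> \<le> r" using mult_left_le[of "r / s" r] rs r by simp
        finally show ?thesis by simp
      qed
      hence "0 \<le> w a r ((r / s)\<^sup>2 *\<^sub>R z0)" using P z0 rs2 by (simp add: P_def)
      hence "0 \<le> (r / s) powr ?p * w a r ((r / s)\<^sup>2 *\<^sub>R z0)" by simp
      with lower[OF z0(1,2)] z0(3) show ?thesis by linarith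
    qed
    have "c * (S / 2 * (LINT z:- ball 0 s|lborel. 1 / K x z) + m * q * measure lborel E) \<le> C * S"
    proof (rule main[unfolded minimum_bound_def, rule_format, OF Em])
      show "E \<subseteq> ball 0 s" using Er d' s by force
      fix z assume z: "z \<in> E"
      show "m \<le> w a s z" if "z \<noteq> 0"
      proof -
        have nz: "norm z \<le> r" using Er[OF z] d' by simp
        have "dist z ((r / s)\<^sup>2 *\<^sub>R z) = (1 - (r / s)\<^sup>2) * norm z"
        proof -
          have "z - (r / s)\<^sup>2 *\<^sub>R z = (1 - (r / s)\<^sup>2) *\<^sub>R z" by (simp add: algebra_simps)
          thus ?thesis using rs2 by (simp add: dist_norm)
        qed
        also have "\<dots> \<le> (1 - (r / s)\<^sup>2) * r" using nz rs2 by (intro mult_left_mono) auto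
        also have "\<dots> < \<rho> / 2" using b3 s s' by simp
        finally have "dist z ((r / s)\<^sup>2 *\<^sub>R z) < \<rho> / 2" .
        moreover have "dist z1 ((r / s)\<^sup>2 *\<^sub>R z) \<le> dist z1 z + dist z ((r / s)\<^sup>2 *\<^sub>R z)" by (rule dist_triangle)
        ultimately have "2 * m \<le> w a r ((r / s)\<^sup>2 *\<^sub>R z)" using z by (intro wE) (simp add: E_def)
        hence "3 / 4 * (2 * m) \<le> (r / s) powr ?p * w a r ((r / s)\<^sup>2 *\<^sub>R z)"
          using b2 s s' m by (intro mult_mono) (auto intro: less_imp_le)
        moreover have "e \<le> m / 4" by (simp add: e_def)
        ultimately show ?thesis using lower[OF that] nz s m by simp
      qed
      show "q \<le> 1 / K x z - (s / norm x) powr ?N / K (inversion s x) z" if "z \<noteq> x"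
        unfolding q_def
        by (rule kernel_gap[OF x(1) s'(1)]) (use dx Er[OF z] d d' s s' that in auto)
    qed (use m q in auto)
    moreover have "0 \<le> (LINT z:- ball 0 s|lborel. 1 / K x z)"
      unfolding set_lebesgue_integral_def by (intro integral_nonneg_AE) (auto simp: K_def)
    hence "0 \<le> c * (S / 2 * (LINT z:- ball 0 s|lborel. 1 / K x z))" using c S by simp
    ultimately have "c * (m * q * measure lborel E) \<le> C * S" by (simp add: distrib_left)
    also have "\<dots> < C * (2 * e)" using C \<open>S < 2 * e\<close> by simp
    also have "\<dots> \<le> C * (2 * (c * (m * q * measure lborel E) / (4 * C)))"
      using C by (intro mult_left_mono) (auto simp: e_def)
    also have "\<dots> = c * (m * q * measure lborel E) / 2" using C by simp
    finally show False using c m q vE by simp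
  qed
  thus ?thesis using \<delta>1 b2 b3 by (intro exI[of _ "Min {1, \<delta>1, b2 - r, b3 - r}"]) auto
qed

text \<open>A point strictly inside the ball lies in all balls of slightly smaller radius, and
  \<open>w a s z\<close> is continuous in \<open>s\<close>; on the sphere itself the difference
  vanishes.\<close>

lemma P_closed:
  assumes r: "r > 0" and "\<And>s. 0 < s \<Longrightarrow> s < r \<Longrightarrow> P a s"
  shows "P a r"
  unfolding P_def
proof (intro allI impI)
  fix z :: "real^'n" assume z: "z \<noteq> 0" "norm z \<le> r"
  show "0 \<le> w a r z"
  proof (cases "norm z = r")
    case True
    thus ?thesis using kelvin_diff_sphere[OF True r] by (simp add: w_def)
  next
    case False
    have "((\<lambda>s. u (a + inversion s z)) \<longlongrightarrow> u (a + inversion r z)) (at_left r)"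
    proof (rule isCont_tendsto_compose[of _ u])
      show "isCont u (a + inversion r z)" using u_cont[of UNIV] by (simp add: continuous_on_eq_continuous_at)
      show "((\<lambda>s. a + inversion s z) \<longlongrightarrow> a + inversion r z) (at_left r)"
        unfolding inversion_def using z by (intro tendsto_intros) auto
    qed
    hence "((\<lambda>s. w a s z) \<longlongrightarrow> w a r z) (at_left r)"
      unfolding w_def kelvin_diff_def using z r by (intro tendsto_intros) auto
    moreover have "eventually (\<lambda>s. s > norm z \<and> s < r) (at_left r)"
      using eventually_at_left_real[of "norm z" r] False z by (auto elim: eventually_mono)
    hence "eventually (\<lambda>s. 0 \<le> w a s z) (at_left r)"
    proof eventually_elim
      case (elim s)
      hence "P a s" using assms(2)[of s] norm_ge_zero[of z] by linarith
      thus ?case using elim z by (simp add: P_def)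
    qed
    ultimately show ?thesis by (intro tendsto_lowerbound[OF _ _ trivial_limit_at_left_real])
  qed
qed

text \<open>\<open>R\<close> is an infimum of bad radii because \<open>P a r\<close> is not known to
  be monotone in \<open>r\<close>. By closedness \<open>P a R\<close> holds, and a positive value of
  \<open>w a R\<close> in the ball would extend nonnegativity past \<open>R\<close>. So
  \<open>w a R\<close> vanishes in the punctured ball, and antisymmetry carries this to the
  exterior.\<close>

lemma moving_spheres_dichotomy:
  "(\<forall>r>0. P a r) \<or> (\<exists>r>0. \<forall>z. z \<noteq> 0 \<longrightarrow> w a r z = 0)"
proof (cases "\<forall>r>0. P a r")
  case False
  define X where "X = {r. r > 0 \<and> \<not> P a r}"
  have X: "X \<noteq> {}" "bdd_below X" using False by (auto simp: X_def intro!: bdd_belowI[of _ 0])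
  define R where "R = Inf X"
  obtain r0 where r0: "r0 > 0" "\<And>r. 0 < r \<Longrightarrow> r < r0 \<Longrightarrow> P a r" using P_small[of a] by blast
  have "r0 \<le> R" unfolding R_def using X(1) r0(2) by (intro cInf_greatest) (auto simp: X_def not_less[symmetric])
  hence R: "R > 0" using r0 by simp
  have "P a s" if "0 < s" "s < R" for s
    using cInf_lower[OF _ X(2), of s] that by (force simp: R_def X_def)
  hence PR: "P a R" by (rule P_closed[OF R])
  have zero: "w a R z = 0" if z: "z \<noteq> 0" "norm z \<le> R" for z
  proof (rule ccontr)
    assume "w a R z \<noteq> 0"
    hence "w a R z > 0" using PR z by (force simp: P_def)
    moreover from this have "norm z \<noteq> R" using kelvin_diff_sphere[OF _ R, of z] by (auto simp: w_def)
    ultimately obtain \<delta> where \<delta>: "\<delta> > 0" "\<And>s. R < s \<Longrightarrow> s < R + \<delta> \<Longrightarrow> P a s"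
      using P_extend[OF R PR, of z] z by auto
    have "R + \<delta> \<le> Inf X"
    proof (rule cInf_greatest[OF X(1)])
      fix s assume s: "s \<in> X"
      have "R \<le> s" using cInf_lower[OF s X(2)] by (simp add: R_def)
      moreover have "s \<noteq> R" using s PR by (auto simp: X_def)
      ultimately show "R + \<delta> \<le> s" using \<delta>(2)[of s] s by (force simp: X_def)
    qed
    thus False using \<delta> by (simp add: R_def)
  qed
  have "w a R z = 0" if "z \<noteq> 0" for z
  proof (cases "norm z \<le> R")
    case False
    hence "R * R \<le> R * norm z" using R by simp
    hence "norm (inversion R z) \<le> R" using that by (simp add: norm_inversion power2_eq_square field_simps)
    hence "w a R (inversion R z) = 0" using zero that R by simp
    thus ?thesis using kelvin_diff_antisymmetric[OF that R, of \<alpha> "\<lambda>y. u (a + y)"] by (simp add: w_def)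
  qed (use zero that in simp)
  thus ?thesis using R by blast
qed simp

section \<open>Classification\<close>

text \<open>Two points can be exchanged by an inversion whose centre is arbitrarily far away on the line
  through them; the Kelvin factor then tends to \<open>1\<close>.\<close>

lemma constant_if_all_P:
  assumes "\<And>a r. r > 0 \<Longrightarrow> P a r"
  shows "u x = u y"
proof -
  let ?p = "real CARD('n) - \<alpha>"
  have le: "u x \<le> u y" if "x \<noteq> y" for x y
  proof -
    define d where "d = norm (x - y)"
    define e where "e = (1 / d) *\<^sub>R (x - y)"
    have d: "d > 0" using that by (simp add: d_def)
    have e: "norm e = 1" "d *\<^sub>R e = x - y" using d by (simp_all add: e_def d_def)
    have ev: "u x \<le> sqrt (1 + d / t) powr ?p * u y" if t: "t > 0" for t
    proof -
      \<comment> \<open>The squared radius is the product of the distances \<open>t\<close> and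
        \<open>t + d\<close> of \<open>x\<close> and \<open>y\<close> from the centre x + t e, so
        the inversion exchanges the two points.\<close>
      define r where "r = sqrt (t * (t + d))"
      define z where "z = - (t *\<^sub>R e)"
      have r2: "r\<^sup>2 = t * (t + d)" and r: "r > 0" using t d by (simp_all add: r_def)
      have nz: "norm z = t" using t e by (simp add: z_def)
      have "t\<^sup>2 \<le> r\<^sup>2" unfolding r2 using t d by (simp add: power2_eq_square)
      hence "t \<le> r" by (rule power2_le_imp_le) (use r in simp)
      moreover have "z \<noteq> 0" using nz t by auto
      ultimately have "0 \<le> w (x + t *\<^sub>R e) r z" using assms[OF r, of "x + t *\<^sub>R e"] nz by (simp add: P_def)
      moreover have "x + t *\<^sub>R e + z = x" by (simp add: z_def)
      moreover have "x + t *\<^sub>R e + inversion r z = y"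
      proof -
        have "inversion r z = - ((t * (t + d) / t) *\<^sub>R e)"
          unfolding inversion_def r2 nz by (simp add: z_def power2_eq_square)
        also have "t * (t + d) / t = t + d" using t by simp
        finally show ?thesis using e(2) by (simp add: algebra_simps)
      qed
      moreover have "r / norm z = sqrt (1 + d / t)"
      proof -
        have "sqrt (1 + d / t) = sqrt (t * (t + d) / t\<^sup>2)"
          using t by (intro arg_cong[of _ _ sqrt]) (simp add: power2_eq_square field_simps)
        thus ?thesis using t by (simp add: r_def nz real_sqrt_divide)
      qed
      ultimately show ?thesis by (simp add: w_def kelvin_diff_def)
    qed
    have "((\<lambda>t. d / t) \<longlongrightarrow> 0) at_top"
      by (intro tendsto_divide_0[OF tendsto_const] filterlim_at_top_imp_at_infinity filterlim_ident)
    hence "((\<lambda>t. sqrt (1 + d / t) powr ?p * u y) \<longlongrightarrow> sqrt (1 + 0) powr ?p * u y) at_top"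
      by (intro tendsto_intros) auto
    hence "((\<lambda>t. sqrt (1 + d / t) powr ?p * u y) \<longlongrightarrow> u y) at_top" by simp
    thus ?thesis
      by (rule tendsto_lowerbound) (auto intro: eventually_mono[OF eventually_gt_at_top[of 0]] ev)
  qed
  show ?thesis using le[of x y] le[of y x] by (cases "x = y") auto
qed

section \<open>Solutions with an invariant sphere\<close>

lemma isCont_u: "isCont u x"
  using u_cont[of UNIV] by (simp add: continuous_on_eq_continuous_at)

text \<open>By invariance u x is a Kelvin factor times \<open>u\<close> at the inverted point, which
  tends to \<open>a\<close>. The reference point \<open>b\<close> is free since |x - b|/|x - a|
  tends to 1; this lets the radii of different centres be compared.\<close>

lemma decay_at_infinity:
  assumes r: "r > 0" and w0: "\<And>z. z \<noteq> 0 \<Longrightarrow> w a r z = 0"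
  shows "((\<lambda>x. norm (x - b) powr (real CARD('n) - \<alpha>) * u x) \<longlongrightarrow> r powr (real CARD('n) - \<alpha>) * u a) at_infinity"
proof -
  let ?p = "real CARD('n) - \<alpha>"
  have A: "((\<lambda>x. r * (norm (x - b) / norm (x - a))) \<longlongrightarrow> r * 1) at_infinity"
    by (intro tendsto_intros norm_ratio_at_infinity)
  have B: "((\<lambda>x. u (a + inversion r (x - a))) \<longlongrightarrow> u a) at_infinity"
    by (rule isCont_tendsto_compose[OF isCont_u inversion_tendsto_0_at_infinity])
  have "((\<lambda>x. (r * (norm (x - b) / norm (x - a))) powr ?p * u (a + inversion r (x - a))) \<longlongrightarrow>
      (r * 1) powr ?p * u a) at_infinity"
    by (intro tendsto_mult tendsto_powr A B tendsto_const) (use r in simp)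
  moreover have "eventually (\<lambda>x. (r * (norm (x - b) / norm (x - a))) powr ?p * u (a + inversion r (x - a)) =
      norm (x - b) powr ?p * u x) at_infinity"
    using filterlim_at_top_dense[THEN iffD1, OF norm_ratio_at_infinity(2)[of a], rule_format, of 0]
  proof eventually_elim
    case (elim x)
    hence "w a r (x - a) = 0" by (intro w0) auto
    hence "u x = (r / norm (x - a)) powr ?p * u (a + inversion r (x - a))"
      by (simp add: w_def kelvin_diff_def)
    moreover have "(r * (norm (x - b) / norm (x - a))) powr ?p = norm (x - b) powr ?p * (r / norm (x - a)) powr ?p"
      unfolding powr_mult[symmetric] by (simp add: mult.commute)
    ultimately show ?case by simp
  qed
  ultimately have "((\<lambda>x. norm (x - b) powr ?p * u x) \<longlongrightarrow> (r * 1) powr ?p * u a) at_infinity"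
    by (rule Lim_transform_eventually)
  thus ?thesis by simp
qed

text \<open>Evaluated at the image of a far point \<open>x\<close>, nonnegativity bounds
  \<open>u\<close> near \<open>b\<close> by (|x - b|/s)^(n-\<alpha>) u x. As \<open>x\<close> tends
  to infinity this becomes u b \<le> L / s^(n-\<alpha>), which fails for large \<open>s\<close>
  since u b > 0.\<close>

lemma not_all_P:
  assumes lim: "((\<lambda>x. norm (x - b) powr (real CARD('n) - \<alpha>) * u x) \<longlongrightarrow> L) at_infinity"
    and P: "\<And>r. r > 0 \<Longrightarrow> P b r"
  shows False
proof -
  let ?p = "real CARD('n) - \<alpha>"
  have p: "?p > 0" using n_gt by simp
  have le: "u b \<le> L / s powr ?p" if s: "s > 0" for s
  proof (rule tendsto_le[of at_infinity])
    show "((\<lambda>x. u (b + inversion s (x - b))) \<longlongrightarrow> u b) at_infinity"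
      by (rule isCont_tendsto_compose[OF isCont_u inversion_tendsto_0_at_infinity])
    show "((\<lambda>x. norm (x - b) powr ?p * u x / s powr ?p) \<longlongrightarrow> L / s powr ?p) at_infinity"
      using s by (intro tendsto_intros lim) auto
    show "eventually (\<lambda>x. u (b + inversion s (x - b)) \<le> norm (x - b) powr ?p * u x / s powr ?p) at_infinity"
      using filterlim_at_top_dense[THEN iffD1, OF norm_ratio_at_infinity(2)[of b], rule_format, of s]
    proof eventually_elim
      case (elim x)
      let ?z = "inversion s (x - b)"
      have xb: "x - b \<noteq> 0" using elim s by auto
      have "s * s \<le> s * norm (x - b)" using elim s by simp
      hence "norm ?z \<le> s" using elim s xb by (simp add: norm_inversion power2_eq_square field_simps)
      hence "0 \<le> w b s ?z" using P[OF s] xb s by (simp add: P_def)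
      moreover have "s / norm ?z = norm (x - b) / s"
        using s xb by (simp add: norm_inversion power2_eq_square)
      ultimately have "u (b + ?z) \<le> (norm (x - b) / s) powr ?p * u x"
        using s by (simp add: w_def kelvin_diff_def)
      thus ?case by (simp add: powr_divide)
    qed
  qed (use trivial_limit_at_infinity[where 'a = "real^'n"] in simp)
  \<comment> \<open>For s^(n-\<alpha>) = B the estimate reads u b * B \<le> L, while u b * B = max 0
    L + u b exceeds \<open>L\<close>. The maximum keeps \<open>B\<close> positive whatever the sign
    of \<open>L\<close>.\<close>
  define B where "B = max 0 L / u b + 1"
  have B: "B > 0" using u_pos[of b] by (simp add: B_def add_nonneg_pos)
  have "u b \<le> L / (B powr (1 / ?p)) powr ?p" by (rule le) (use B in simp)
  hence "u b * B \<le> L" using B p by (simp add: powr_powr field_simps)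
  moreover have "u b * B = max 0 L + u b" using u_pos[of b] by (simp add: B_def field_simps)
  ultimately show False using u_pos[of b] by linarith
qed

text \<open>The principal value of the zero function is 0, so the equation relates the two values of
  \<open>f\<close> by the factor (r/|x|)^(n+\<alpha>). The \<tau>-th powers of the two values of
  \<open>u\<close> are related by the same factor.\<close>

lemma nonlinearity_invariant:
  assumes r: "r > 0" and w0: "\<And>z. z \<noteq> 0 \<Longrightarrow> w a r z = 0" and x: "x \<noteq> 0"
  shows "f (u (a + x)) / u (a + x) powr \<tau> = f (u (a + inversion r x)) / u (a + inversion r x) powr \<tau>"
proof -
  let ?N = "real CARD('n) + \<alpha>" and ?p = "real CARD('n) - \<alpha>"
  have 0: "(LINT z:- cball x \<epsilon>|lborel. (w a r x - w a r z) / K x z) = 0" for \<epsilon>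
    unfolding set_lebesgue_integral_def
  proof (rule integral_eq_zero_AE)
    have "AE z in lborel. z \<noteq> (0::real^'n)" by (rule AE_lborel_singleton)
    thus "AE z in lborel. indicator (- cball x \<epsilon>) z *\<^sub>R ((w a r x - w a r z) / K x z) = 0"
      by eventually_elim (simp add: w0 x)
  qed
  have "((\<lambda>\<epsilon>. LINT z:- cball x \<epsilon>|lborel. (w a r x - w a r z) / K x z) \<longlongrightarrow>
     ((r / norm x) powr ?N * f (u (a + inversion r x)) - f (u (a + x))) / c) (at_right 0)"
    using frac_pv_w(2)[OF x r, where a = a and \<eta> = 0] by (simp add: w_def)
  hence "((r / norm x) powr ?N * f (u (a + inversion r x)) - f (u (a + x))) / c = 0"
    unfolding 0 by (simp add: tendsto_const_iff)
  hence f: "f (u (a + x)) = (r / norm x) powr ?N * f (u (a + inversion r x))" using c by simp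
  have "u (a + x) = (r / norm x) powr ?p * u (a + inversion r x)"
    using w0[OF x] by (simp add: w_def kelvin_diff_def)
  hence "u (a + x) powr \<tau> = (r / norm x) powr ?N * u (a + inversion r x) powr \<tau>"
    using n_gt by (simp add: powr_mult powr_powr \<tau>)
  thus ?thesis using f r x by simp
qed

text \<open>All centres share the limit \<open>L\<close> of the decay at infinity, so
  r(a)^(n-\<alpha>) u a = L. Hence the squared radius \<open>q\<close> is a power of L / u,
  differentiable along with \<open>u\<close>, and invariance under each sphere becomes a functional
  equation for \<open>q\<close> alone.\<close>

lemma bubble_form:
  assumes "\<And>a. \<exists>r>0. \<forall>z. z \<noteq> 0 \<longrightarrow> w a r z = 0"
  obtains L k b where "L > 0" "k > 0"
    "\<And>x. u x = L / ((norm (x - b))\<^sup>2 + k) powr ((real CARD('n) - \<alpha>) / 2)"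
    "\<And>a z. z \<noteq> 0 \<Longrightarrow> w a (sqrt ((norm (a - b))\<^sup>2 + k)) z = 0"
proof -
  let ?p = "real CARD('n) - \<alpha>"
  have p: "?p > 0" using n_gt by simp
  obtain r where r: "\<And>a. r a > 0" and w0: "\<And>a z. z \<noteq> 0 \<Longrightarrow> w a (r a) z = 0"
    using assms by metis
  define L where "L = r 0 powr ?p * u 0"
  have L: "L > 0" using r[of 0] u_pos[of 0] by (simp add: L_def)
  have rL: "r a powr ?p * u a = L" for a
    unfolding L_def
    by (rule tendsto_unique[OF trivial_limit_at_infinity decay_at_infinity[OF r w0, where b = 0]
          decay_at_infinity[OF r w0, where b = 0]])
  have root: "x = y" if "x powr ?p = y powr ?p" "x > 0" "y > 0" for x y
  proof -
    have "z = (z powr ?p) powr (1 / ?p)" if "z > 0" for z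
      using that p by (simp add: powr_powr)
    with that show ?thesis by metis
  qed
  define q where "q a = (r a)\<^sup>2" for a
  have q: "q a > 0" for a using r[of a] by (simp add: q_def)
  have q_powr: "q a powr (s / 2) = r a powr s" for a s
  proof -
    have "q a powr (s / 2) = (r a powr 2) powr (s / 2)" using r[of a] by (simp add: q_def)
    also have "\<dots> = r a powr (2 * (s / 2))" by (rule powr_powr)
    finally show ?thesis by simp
  qed
  have q_eq: "q = (\<lambda>a. (L / u a) powr (2 / ?p))"
  proof
    fix a
    have "L / u a = r a powr ?p" using rL[of a] u_pos[of a] by (simp add: field_simps)
    hence "(L / u a) powr (2 / ?p) = r a powr (?p * (2 / ?p))" by (simp only: powr_powr)
    also have "?p * (2 / ?p) = 2" using p nonzero_mult_div_cancel_left[of ?p 2] by (simp only: times_divide_eq_right)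
    finally have "(L / u a) powr (2 / ?p) = r a powr 2" .
    thus "q a = (L / u a) powr (2 / ?p)" using r[of a] by (simp add: q_def)
  qed
  obtain b k where k: "k > 0" "\<And>x. q x = (norm (x - b))\<^sup>2 + k"
  proof (rule quadratic_if_inversion_invariant[of q])
    show "q differentiable (at a)" for a
      unfolding q_eq
      using differentiable_chain_at[OF u_diff differentiable_divide_powr[OF u_pos L]] by (simp add: o_def)
    fix a y :: "real^'n" assume y: "y \<noteq> 0"
    let ?a = "a + (q a / (norm y)\<^sup>2) *\<^sub>R y"
    have "u (a + y) = (r a / norm y) powr ?p * u ?a"
      using w0[OF y, of a] by (simp add: w_def kelvin_diff_def inversion_def q_def)
    \<comment> \<open>Both sides equal \<open>L\<close>; cancelling the common value of
      \<open>u\<close> leaves a relation between radii.\<close>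
    hence "r (a + y) powr ?p * ((r a / norm y) powr ?p * u ?a) = r ?a powr ?p * u ?a"
      using rL[of "a + y"] rL[of ?a] by simp
    hence "(r (a + y) * (r a / norm y)) powr ?p = r ?a powr ?p"
      using u_pos[of ?a] by (simp only: powr_mult mult.assoc[symmetric] mult_right_cancel[OF less_imp_neq[symmetric]])
    hence "r (a + y) * (r a / norm y) = r ?a"
      by (rule root) (use y r in auto)
    hence "r (a + y) * r a = norm y * r ?a" using y by (simp add: field_simps)
    hence "(r (a + y) * r a)\<^sup>2 = (norm y * r ?a)\<^sup>2" by simp
    thus "q (a + y) * q a = (norm y)\<^sup>2 * q ?a" by (simp add: q_def power_mult_distrib)
  qed (use q in blast)+
  show ?thesis
  proof (rule that[OF L k(1)])
    show "u x = L / ((norm (x - b))\<^sup>2 + k) powr (?p / 2)" for x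
      using rL[of x] r[of x] unfolding k(2)[symmetric] q_powr by (simp add: field_simps)
    show "w a (sqrt ((norm (a - b))\<^sup>2 + k)) z = 0" if "z \<noteq> 0" for a z
      using w0[OF that, of a] r[of a] unfolding k(2)[symmetric] by (simp add: q_def)
  qed
qed

text \<open>At a strict maximum the integrand is nonnegative, so the truncated integrals grow as the
  ball shrinks. Were their limit 0, the integrand would vanish almost everywhere outside the unit
  ball, where it is in fact positive.\<close>

lemma f_pos_at_strict_max:
  assumes "\<And>z. z \<noteq> b \<Longrightarrow> u z < u b"
  shows "f (u b) > 0"
proof (rule ccontr)
  let ?h = "\<lambda>z. (u b - u z) / norm (b - z) powr (real CARD('n) + \<alpha>)"
  let ?T = "\<lambda>\<epsilon>. LINT z:- cball b \<epsilon>|lborel. ?h z"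
  assume "\<not> f (u b) > 0"
  hence "f (u b) = 0" using f_nonneg[OF u_pos[of b]] by simp
  hence lim: "(?T \<longlongrightarrow> 0) (at_right 0)" using eq[of b] unfolding frac_pv_def by simp
  have int: "set_integrable lborel (- cball b \<epsilon>) ?h" if "\<epsilon> > 0" for \<epsilon>
    using eq[of b] that unfolding frac_pv_def by blast
  have h0: "?h z \<ge> 0" for z using assms[of z] by (cases "z = b") auto
  have "eventually (\<lambda>\<epsilon>. \<epsilon> \<in> {0<..<1::real}) (at_right 0)" by (rule eventually_at_right_real) simp
  hence "eventually (\<lambda>\<epsilon>. ?T 1 \<le> ?T \<epsilon>) (at_right 0)"
  proof eventually_elim
    case (elim \<epsilon>)
    show ?case unfolding set_lebesgue_integral_def
      by (rule integral_mono) (use int[of 1] int[of \<epsilon>] elim h0 in \<open>auto simp: set_integrable_def indicator_def\<close>)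
  qed
  hence "?T 1 \<le> 0" by (intro tendsto_lowerbound[OF lim]) auto
  moreover have "?T 1 \<ge> 0"
    unfolding set_lebesgue_integral_def by (intro integral_nonneg_AE AE_I2 scaleR_nonneg_nonneg h0) simp
  ultimately have "(\<integral>z. indicator (- cball b 1) z *\<^sub>R ?h z \<partial>lborel) = 0"
    unfolding set_lebesgue_integral_def by simp
  moreover have "AE z in lborel. 0 \<le> indicator (- cball b 1) z *\<^sub>R ?h z"
    by (intro AE_I2 scaleR_nonneg_nonneg h0) simp
  ultimately have "AE z in lborel. indicator (- cball b 1) z *\<^sub>R ?h z = 0"
    using integral_nonneg_eq_0_iff_AE[OF int[of 1, unfolded set_integrable_def]] by simp
  hence "AE z in lborel. z \<in> cball b 1"
  proof eventually_elim
    case (elim z)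
    show ?case
    proof (rule ccontr)
      assume z: "z \<notin> cball b 1"
      hence "z \<noteq> b" by auto
      hence "?h z > 0" using assms[of z] by simp
      with elim z show False by auto
    qed
  qed
  hence "emeasure lborel (UNIV :: (real^'n) set) = emeasure lborel (cball b 1)"
    by (intro emeasure_eq_AE) auto
  thus False using emeasure_lborel_cball_finite[of b 1] by simp
qed

text \<open>The alternative is whether some invariant sphere exists. If so, the decay it implies
  excludes nonnegativity for all radii at any centre, so every centre has such a sphere. The form of
  \<open>f\<close> follows because f t / t^\<tau> takes the same value at \<open>u b\<close> and at
  every \<open>u y\<close>, and \<open>u\<close> attains all positive values up to its
  maximum.\<close>

lemma classification:
  "(\<exists>C\<^sub>0>0. f C\<^sub>0 = 0 \<and> (\<forall>x. u x = C\<^sub>0)) \<or>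
    (\<exists>C>0.
       (\<exists>M. M \<in> range u \<and> (\<forall>x. u x \<le> M) \<and>
          (\<forall>t. 0 < t \<and> t \<le> M \<longrightarrow> f t = C * t powr \<tau>)) \<and>
       (\<exists>\<beta>\<^sub>1 \<beta>\<^sub>2 x\<^sub>0. \<beta>\<^sub>1 > 0 \<and> \<beta>\<^sub>2 > 0 \<and>
          (\<forall>x. u x = \<beta>\<^sub>1 /
             ((norm (x - x\<^sub>0))\<^sup>2 + \<beta>\<^sub>2\<^sup>2) powr ((real CARD('n) - \<alpha>) / 2))))"
proof (cases "\<exists>a. \<exists>r>0. \<forall>z. z \<noteq> 0 \<longrightarrow> w a r z = 0")
  case False
  hence "P a r" if "r > 0" for a r using moving_spheres_dichotomy[of a] that by blast
  hence "u x = u 0" for x by (rule constant_if_all_P)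
  then obtain C0 where C0: "\<And>x. u x = C0" by blast
  have "((\<lambda>\<epsilon>::real. 0 :: real) \<longlongrightarrow> f C0 / c) (at_right 0)"
    using eq[of 0] unfolding frac_pv_def by (simp add: C0 set_lebesgue_integral_def)
  hence "f C0 = 0" using c by (simp add: tendsto_const_iff)
  thus ?thesis using C0 u_pos by metis
next
  case True
  let ?p = "real CARD('n) - \<alpha>"
  have p: "?p > 0" using n_gt by simp
  from True obtain a r where ar: "r > 0" "\<And>z. z \<noteq> 0 \<Longrightarrow> w a r z = 0" by blast
  have "\<exists>r>0. \<forall>z. z \<noteq> 0 \<longrightarrow> w a' r z = 0" for a'
    using moving_spheres_dichotomy[of a'] not_all_P[OF decay_at_infinity[OF ar]] by blast
  then obtain L k b where L: "L > 0" and k: "k > 0"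
    and u_eq: "\<And>x. u x = L / ((norm (x - b))\<^sup>2 + k) powr (?p / 2)"
    and w0: "\<And>a z. z \<noteq> 0 \<Longrightarrow> w a (sqrt ((norm (a - b))\<^sup>2 + k)) z = 0"
    using bubble_form by metis
  define C where "C = f (u b) / u b powr \<tau>"
  have lt: "u z < u b" if "z \<noteq> b" for z
  proof -
    have "k powr (?p / 2) < ((norm (z - b))\<^sup>2 + k) powr (?p / 2)"
      using that k p by (intro powr_less_mono2) auto
    moreover have "k powr (?p / 2) > 0" using k by simp
    ultimately have "L / ((norm (z - b))\<^sup>2 + k) powr (?p / 2) < L / k powr (?p / 2)"
      using L by (intro divide_strict_left_mono mult_pos_pos) linarith+
    thus ?thesis by (simp add: u_eq)
  qed
  have C: "C > 0" using f_pos_at_strict_max[OF lt] u_pos[of b] by (simp add: C_def)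
  have f_eq: "f (u y) = C * u y powr \<tau>" for y
  proof (cases "y = b")
    case False
    define v where "v = y - b"
    \<comment> \<open>The centre lies on the line through \<open>y\<close> and \<open>b\<close>,
      beyond \<open>b\<close>, at distance k/|v| from it. With squared radius |a - b|^2 + k the
      image of \<open>b\<close> has distance |a - b| + k/|a - b| = |a - b| + |v| from the centre,
      hence it is \<open>y\<close>.\<close>
    define a where "a = b - (k / (norm v)\<^sup>2) *\<^sub>R v"
    define r where "r = sqrt ((norm (a - b))\<^sup>2 + k)"
    have v: "v \<noteq> 0" using False by (simp add: v_def)
    have r: "r > 0" using k by (simp add: r_def add_nonneg_pos)
    have r2: "r\<^sup>2 = (norm (a - b))\<^sup>2 + k" using k by (simp add: r_def add_nonneg_nonneg)
    have ab: "b - a = (k / (norm v)\<^sup>2) *\<^sub>R v" by (simp add: a_def)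
    have nab: "(norm (b - a))\<^sup>2 = k\<^sup>2 / (norm v)\<^sup>2"
      using v k by (simp add: ab power_mult_distrib power_divide power2_eq_square)
    have "b - a \<noteq> 0" using v k by (simp add: ab)
    hence "f (u (a + (b - a))) / u (a + (b - a)) powr \<tau> =
       f (u (a + inversion r (b - a))) / u (a + inversion r (b - a)) powr \<tau>"
      by (intro nonlinearity_invariant[OF r]) (use w0 in \<open>auto simp: r_def\<close>)
    moreover have "a + inversion r (b - a) = y"
    proof -
      have "r\<^sup>2 / (norm (b - a))\<^sup>2 = 1 + (norm v)\<^sup>2 / k"
        using k v unfolding r2 norm_minus_commute[of a b] nab by (simp add: field_simps power2_eq_square)
      hence "inversion r (b - a) = (1 + (norm v)\<^sup>2 / k) *\<^sub>R (b - a)" by (simp only: inversion_def)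
      also have "\<dots> = (b - a) + v" using k v by (simp add: ab algebra_simps)
      finally show ?thesis by (simp add: v_def)
    qed
    ultimately have "C = f (u y) / u y powr \<tau>" by (simp add: C_def)
    thus ?thesis using u_pos[of y] by simp
  qed (use u_pos[of b] in \<open>simp add: C_def\<close>)
  have range: "\<exists>y. u y = t" if t: "0 < t" "t \<le> u b" for t
  proof -
    \<comment> \<open>Solves L / Q^((n-\<alpha>)/2) = t. The bound t \<le> u b amounts to k \<le> Q,
      so the value \<open>t\<close> is attained at distance sqrt (Q - k) from
      \<open>b\<close>.\<close>
    define Q where "Q = (L / t) powr (2 / ?p)"
    have "L / k powr (?p / 2) = u b" using k by (simp add: u_eq)
    hence "k powr (?p / 2) \<le> L / t" using t L k by (simp add: field_simps)
    hence "(k powr (?p / 2)) powr (2 / ?p) \<le> Q"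
      unfolding Q_def using p by (intro powr_mono2) auto
    have half: "x / 2 * (2 / x) = 1" "2 / x * (x / 2) = 1" if "x \<noteq> 0" for x :: real
      using that by simp_all
    have p0: "?p \<noteq> 0" using p by simp
    from \<open>(k powr (?p / 2)) powr (2 / ?p) \<le> Q\<close> have kQ: "k \<le> Q"
      unfolding powr_powr half[OF p0] using k by simp
    obtain e :: "real^'n" where e: "norm e = sqrt (Q - k)"
      using vector_choose_size[of "sqrt (Q - k)"] kQ by auto
    have "u (b + e) = L / Q powr (?p / 2)" using e kQ by (simp add: u_eq)
    also have "Q powr (?p / 2) = L / t" unfolding Q_def powr_powr half[OF p0] using L t by simp
    also have "L / (L / t) = t" using L by simp
    finally show ?thesis by blast
  qed
  show ?thesis
  proof (intro disjI2 exI conjI allI impI)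
    show "u b \<in> range u" by simp
    show "u x \<le> u b" for x using lt[of x] by (cases "x = b") auto
    show "f t = C * t powr \<tau>" if "0 < t \<and> t \<le> u b" for t
      using range[of t] that f_eq by blast
    show "u x = L / ((norm (x - b))\<^sup>2 + (sqrt k)\<^sup>2) powr (?p / 2)" for x
      using k by (simp add: u_eq)
  qed (use C L k in auto)
qed

end

theorem theorem1p3:
  fixes \<alpha> \<tau> c :: real and f :: "real \<Rightarrow> real" and u :: "real^'n::finite \<Rightarrow> real"
  assumes "0 < \<alpha>" and "\<alpha> < 2"
    and "real CARD('n) > \<alpha>"
    and "\<tau> = (real CARD('n) + \<alpha>) / (real CARD('n) - \<alpha>)"
    and "c > 0"
    and "\<And>t. t > 0 \<Longrightarrow> f t \<ge> 0"
    and "locally_bounded_pos f"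
    and "antimono_on {0<..} (\<lambda>t. f t / t powr \<tau>)"
    and "u \<in> L_space \<alpha>" and "u \<in> C11_loc"
    and "\<And>x. u x > 0"
    and "\<And>x. has_frac_laplacian c \<alpha> u x (f (u x))"
  shows "(\<exists>C\<^sub>0>0. f C\<^sub>0 = 0 \<and> (\<forall>x. u x = C\<^sub>0)) \<or>
    (\<exists>C>0.
       (\<exists>M. M \<in> range u \<and> (\<forall>x. u x \<le> M) \<and>
          (\<forall>t. 0 < t \<and> t \<le> M \<longrightarrow> f t = C * t powr \<tau>)) \<and>
       (\<exists>\<beta>\<^sub>1 \<beta>\<^sub>2 x\<^sub>0. \<beta>\<^sub>1 > 0 \<and> \<beta>\<^sub>2 > 0 \<and>
          (\<forall>x. u x = \<beta>\<^sub>1 /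
             ((norm (x - x\<^sub>0))\<^sup>2 + \<beta>\<^sub>2\<^sup>2) powr ((real CARD('n) - \<alpha>) / 2))))"
proof -
  have diff: "u differentiable (at x)" for x
    using \<open>u \<in> C11_loc\<close> unfolding C11_loc_def gderiv_def differentiable_def by blast
  have "continuous_on UNIV u"
    by (intro continuous_at_imp_continuous_on ballI differentiable_imp_continuous_within diff)
  hence meas: "u \<in> borel_measurable borel" by (rule borel_measurable_continuous_onI)
  interpret frac_solution \<alpha> \<tau> c f u
  proof unfold_locales
    show "frac_pv \<alpha> u x (f (u x) / c)" for x
      by (rule frac_pv_of_has_frac_laplacian[OF meas assms(12) assms(5)])
  qed (fact assms diff)+
  show ?thesis by (rule classification)
qed

end
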